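(* (1) Let $0<\alpha<1$ and $p,q>0$. If $SG_{\alpha,p}(A,B)\prec_{\log}\widetilde{SG}_{\alpha,q}(A,B)$ for all $A,B\in\mathbb{M}_2^{++}$, then $\alpha\le1/2$ and $p/q\le2(1-\alpha)$. (2) Let $0<\alpha<1$ and $p,q>0$. If $p/q\ge\max\bigl\{1,\frac{1-\alpha}{\alpha}\bigr\}$, then $\widetilde{SG}_{\alpha,q}(A,B)\prec_{\log}SG_{\alpha,p}(A,B)$ for all $A,B\ge0$ with $s(A)\ge s(B)$. Moreover, if $\widetilde{SG}_{\alpha,q}(A,B)\prec_{\log}SG_{\alpha,p}(A,B)$ for all $A,B\in\mathbb{M}_2^{++}$, then $p/q\ge2(1-\alpha)$. (Note that $2(1-\alpha)\le\max\bigl\{1,\frac{1-\alpha}{\alpha}\bigr\}$ for $0<\alpha<1$.) (3) Let $\alpha>1$ and $p,q>0$. If $p\le q$, then $SG_{\alpha,p}(A,B)\prec_{\log}\widetilde{SG}_{\alpha,q}(A,B)$ for all $A,B\ge0$ with $s(A)\ge s(B)$. (4) Let $\alpha>1$. For any $p,q>0$ there exist $A,B\in\mathbb{M}_2^{++}$ such that $\widetilde{SG}_{\alpha,q}(A,B)\not\prec_{\log}SG_{\alpha,p}(A,B)$.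
   Context: Notation: $\mathbb{M}_n$ is the set of $n\times n$ complex matrices, $\mathbb{M}_n^+$ (resp. $\mathbb{M}_n^{++}$) the positive semidefinite (resp. positive definite) ones. $A\ge0$ (resp. $A>0$) means $A\in\mathbb{M}_n^+$ (resp. $A\in\mathbb{M}_n^{++}$) for some $n\in\mathbb{N}$; matrices appearing together have the same size. $s(A)$ is the support projection of $A\ge0$. $A^{-1}$ denotes the generalized inverse (the inverse on the support of $A$, zero on the kernel), and $A^r:=(A^{-1})^{-r}$ for $r<0$. For $\alpha>0$ and $A,B\ge0$ with $s(A)\ge s(B)$, $A\#_\alpha B:=A^{1/2}(A^{-1/2}BA^{-1/2})^{\alpha}A^{1/2}$, and $\#:=\#_{1/2}$. For $s(A)\ge s(B)$: $SG_{\alpha,p}(A,B):=\bigl((A^{-p}\#B^p)^{\alpha}A^p(A^{-p}\#B^p)^{\alpha}\bigr)^{1/p}$ and $\widetilde{SG}_{\alpha,p}(A,B):=\bigl((A^{-p}\#_\alpha B^p)^{1/2}A^{2(1-\alpha)p}(A^{-p}\#_\alpha B^p)^{1/2}\bigr)^{1/p}$. Log-majorization: for $X,Y\in\mathbb{M}_n^+$ with eigenvalues $\lambda_1(\cdot)\ge\dots\ge\lambda_n(\cdot)$ counted with multiplicity, $X\prec_{\log}Y$ means $\prod_{i=1}^k\lambda_i(X)\le\prod_{i=1}^k\lambda_i(Y)$ for $1\le k\le n$, with equality for $k=n$. *)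

theory Defs
  imports Complex_Main "Jordan_Normal_Form.Schur_Decomposition"
begin

definition hermitian_mat :: "nat \<Rightarrow> complex mat \<Rightarrow> bool" where
  "hermitian_mat n A \<longleftrightarrow> A \<in> carrier_mat n n \<and> mat_adjoint A = A"

definition psd_mat :: "nat \<Rightarrow> complex mat \<Rightarrow> bool" where
  "psd_mat n A \<longleftrightarrow> hermitian_mat n A \<and>
     (\<forall>v \<in> carrier_vec n. 0 \<le> Re ((A *\<^sub>v v) \<bullet>c v))"

definition pd_mat :: "nat \<Rightarrow> complex mat \<Rightarrow> bool" where
  "pd_mat n A \<longleftrightarrow> hermitian_mat n A \<and>
     (\<forall>v \<in> carrier_vec n. v \<noteq> 0\<^sub>v n \<longrightarrow> 0 < Re ((A *\<^sub>v v) \<bullet>c v))"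

definition loewner_le :: "nat \<Rightarrow> complex mat \<Rightarrow> complex mat \<Rightarrow> bool" where
  "loewner_le n A B \<longleftrightarrow> hermitian_mat n A \<and> hermitian_mat n B \<and> psd_mat n (B - A)"

definition unitary_mat :: "nat \<Rightarrow> complex mat \<Rightarrow> bool" where
  "unitary_mat n U \<longleftrightarrow> U \<in> carrier_mat n n \<and>
     U * mat_adjoint U = 1\<^sub>m n \<and> mat_adjoint U * U = 1\<^sub>m n"

text \<open>Functional calculus: if \<open>A = U diag(d) U*\<close> with \<open>U\<close> unitary and \<open>d\<close> real, then
  \<open>f(A) = U diag(f \<circ> d) U*\<close>. For Hermitian \<open>A\<close> such a decomposition exists and the
  result does not depend on it; for other matrices the value is unspecified.\<close>

definition herm_fun :: "(real \<Rightarrow> real) \<Rightarrow> complex mat \<Rightarrow> complex mat" where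
  "herm_fun f A = (SOME C. \<exists>U d. unitary_mat (dim_row A) U \<and>
     A = U * mat_diag (dim_row A) (\<lambda>i. complex_of_real (d i)) * mat_adjoint U \<and>
     C = U * mat_diag (dim_row A) (\<lambda>i. complex_of_real (f (d i))) * mat_adjoint U)"

definition supp_proj :: "complex mat \<Rightarrow> complex mat" where
  "supp_proj A = herm_fun (\<lambda>x. if x = 0 then 0 else 1) A"

text \<open>Inverse on the support, zero on the kernel, because \<open>inverse 0 = 0\<close>.\<close>

definition gen_inv :: "complex mat \<Rightarrow> complex mat" where
  "gen_inv A = herm_fun inverse A"

text \<open>Powers of positive semidefinite matrices. As \<open>0 powr 0 = 0\<close>, the power \<open>A\<^sup>0\<close>
  would be the support projection.\<close>

definition psd_pow :: "complex mat \<Rightarrow> real \<Rightarrow> complex mat" where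
  "psd_pow A r = (if r < 0 then herm_fun (\<lambda>x. x powr (- r)) (gen_inv A)
                  else herm_fun (\<lambda>x. x powr r) A)"

definition geom_mean :: "real \<Rightarrow> complex mat \<Rightarrow> complex mat \<Rightarrow> complex mat" where
  "geom_mean \<alpha> A B =
     psd_pow A (1/2) * psd_pow (psd_pow A (-1/2) * B * psd_pow A (-1/2)) \<alpha> * psd_pow A (1/2)"

definition SG :: "real \<Rightarrow> real \<Rightarrow> complex mat \<Rightarrow> complex mat \<Rightarrow> complex mat" where
  "SG \<alpha> p A B =
     (let G = geom_mean (1/2) (psd_pow A (- p)) (psd_pow B p)
      in psd_pow (psd_pow G \<alpha> * psd_pow A p * psd_pow G \<alpha>) (1/p))"

definition SG_tilde :: "real \<Rightarrow> real \<Rightarrow> complex mat \<Rightarrow> complex mat \<Rightarrow> complex mat" where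
  "SG_tilde \<alpha> p A B =
     (let G = geom_mean \<alpha> (psd_pow A (- p)) (psd_pow B p)
      in psd_pow (psd_pow G (1/2) * psd_pow A (2 * (1 - \<alpha>) * p) * psd_pow G (1/2)) (1/p))"

text \<open>Eigenvalues in decreasing order, with multiplicity. Taking real parts loses nothing for
  Hermitian matrices.\<close>

definition eigvals_desc :: "complex mat \<Rightarrow> real list" where
  "eigvals_desc A = rev (sorted_list_of_multiset (image_mset Re (proots (char_poly A))))"

definition log_maj :: "nat \<Rightarrow> complex mat \<Rightarrow> complex mat \<Rightarrow> bool" where
  "log_maj n X Y \<longleftrightarrow>
     (\<forall>k \<in> {1..n}. (\<Prod>i<k. eigvals_desc X ! i) \<le> (\<Prod>i<k. eigvals_desc Y ! i)) \<and>
     (\<Prod>i<n. eigvals_desc X ! i) = (\<Prod>i<n. eigvals_desc Y ! i)"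

end

theory Submission
  imports Defs "HOL-Analysis.Elementary_Metric_Spaces"
begin

text \<open>Put \<open>Z\<^sub>p = A\<^sup>p\<^sup>/\<^sup>2 B\<^sup>p A\<^sup>p\<^sup>/\<^sup>2\<close>. Since \<open>0 powr r = 0\<close> for every real \<open>r\<close>, generalized powers satisfy
  \<open>A\<^sup>r A\<^sup>s = A\<^sup>r\<^sup>+\<^sup>s\<close> without exception, so singular matrices need no limiting argument. Compound matrices
  commute with products and powers and reduce log-majorization to implications between
  \<open>SG \<le> c\<close> and \<open>SG_tilde \<le> c\<close>. The first bound says \<open>G\<^sup>2\<^sup>\<alpha> \<le> c\<^sup>p A\<^sup>-\<^sup>p\<close> for the solution \<open>G\<close> of
  \<open>G A\<^sup>p G = B\<^sup>p\<close>, the second one \<open>Z\<^sub>q\<^sup>\<alpha> \<le> c\<^sup>q A\<^sup>(\<^sup>2\<^sup>\<alpha>\<^sup>-\<^sup>1\<^sup>)\<^sup>q\<close>. For \<open>\<alpha> < 1\<close> the Loewner-Heinz inequality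
  leads from the first to the second. For \<open>\<alpha> > 1\<close> it turns the second one into a bound
  \<open>B\<^sup>p \<le> c\<^sup>p\<^sup>/\<^sup>\<alpha> A\<^sup>p\<^sup>(\<^sup>1\<^sup>-\<^sup>1\<^sup>/\<^sup>\<alpha>\<^sup>)\<close>, and a Furuta type inequality gives the first one back.

  The necessary conditions come from pairs of two by two matrices in which \<open>B\<close> (or \<open>A\<close> with \<open>G\<close> fixed)
  degenerates to a rank one projection: there both sides become products of moments of a two-point
  distribution, which can be made bounded or unbounded independently of each other.\<close>

subsection \<open>The spectral theorem\<close>

text \<open>The constant \<open>c\<close> stands in for eigenvalues: \<open>k\<close>-fold partial
  products are largest eigenvalues of compounds, and two such numbers are compared once every bound
  \<open>c\<close> for one side is a bound for the other. What remains are matrix inequalities in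
  arbitrary size, and equality of determinants for \<open>k = n\<close>. For \<alpha> < 1,
  \<open>G\<close> is eliminated between two inequalities by Loewner-Heinz with the exponents q/p
  and (1-\<alpha>)q/(\<alpha>p); that both are at most 1 is the condition on p/q in (2). For
  \<alpha> > 1 the power 2\<alpha> of \<open>G\<close> to be bounded exceeds 1, out of reach of
  Loewner-Heinz, hence the Furuta type inequality. The necessary condition in (2) needs both
  degenerations. With \<open>B\<close> of rank one, the growing moment of order 2(1-\<alpha>)q on
  the side of \<open>SG_tilde\<close> competes with the moment of order q, which has a negative
  exponent there and can stay bounded meanwhile only if 2(1-\<alpha>) > 1. For \<alpha> \<ge> 1/2
  the mean \<open>G\<close> is therefore fixed instead.\<close>

lemma square_mult_carrier [simp]:
  "A \<in> carrier_mat n n \<Longrightarrow> B \<in> carrier_mat n n \<Longrightarrow> A * B \<in> carrier_mat n n"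
  by auto

lemma adjoint_carrier [simp]:
  "A \<in> carrier_mat n m \<Longrightarrow> mat_adjoint A \<in> carrier_mat m n"
  unfolding mat_adjoint_def by auto

lemma adjoint_dim [simp]:
  "dim_row (mat_adjoint A) = dim_col A" "dim_col (mat_adjoint A) = dim_row A"
  unfolding mat_adjoint_def by auto

lemma adjoint_index [simp]:
  "i < dim_col A \<Longrightarrow> j < dim_row A \<Longrightarrow> mat_adjoint A $$ (i, j) = conjugate (A $$ (j, i))"
  unfolding mat_adjoint_def by (simp add: mat_of_rows_index)

lemma adjoint_adjoint [simp]: "mat_adjoint (mat_adjoint (A :: complex mat)) = A"
  by (rule eq_matI) auto

lemma adjoint_mult:
  fixes A B :: "complex mat"
  assumes "A \<in> carrier_mat n m" "B \<in> carrier_mat m k"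
  shows "mat_adjoint (A * B) = mat_adjoint B * mat_adjoint A"
  using assms by (intro eq_matI) (auto simp: scalar_prod_def mult.commute)

lemma adjoint_minus:
  fixes A B :: "complex mat"
  assumes "A \<in> carrier_mat n m" "B \<in> carrier_mat n m"
  shows "mat_adjoint (A - B) = mat_adjoint A - mat_adjoint B"
  using assms by (intro eq_matI) auto

lemma adjoint_smult:
  fixes A :: "complex mat"
  shows "mat_adjoint (c \<cdot>\<^sub>m A) = cnj c \<cdot>\<^sub>m mat_adjoint A"
  by (intro eq_matI) auto

lemma adjoint_one [simp]: "mat_adjoint (1\<^sub>m n :: complex mat) = 1\<^sub>m n"
  by (intro eq_matI) auto

lemma adjoint_diag_real [simp]:
  "mat_adjoint (mat_diag n (\<lambda>i. complex_of_real (d i))) = mat_diag n (\<lambda>i. complex_of_real (d i))"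
  by (intro eq_matI) (auto simp: mat_diag_def)

lemma cscalar_adjoint:
  fixes A :: "complex mat"
  assumes "A \<in> carrier_mat n m" "v \<in> carrier_vec m" "w \<in> carrier_vec n"
  shows "(A *\<^sub>v v) \<bullet>c w = v \<bullet>c (mat_adjoint A *\<^sub>v w)"
proof -
  have "(A *\<^sub>v v) \<bullet>c w = (\<Sum>i<n. \<Sum>j<m. A $$ (i,j) * v $ j * cnj (w $ i))"
    using assms by (auto simp: scalar_prod_def sum_distrib_right atLeast0LessThan intro!: sum.cong)
  also have "\<dots> = (\<Sum>j<m. \<Sum>i<n. A $$ (i,j) * v $ j * cnj (w $ i))"
    by (rule sum.swap)
  also have "\<dots> = v \<bullet>c (mat_adjoint A *\<^sub>v w)"
    using assms
    by (auto simp: scalar_prod_def sum_distrib_left atLeast0LessThan mult_ac intro!: sum.cong)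
  finally show ?thesis .
qed

lemma csquare_eq_sum:
  fixes v :: "complex vec"
  assumes "v \<in> carrier_vec n"
  shows "v \<bullet>c v = complex_of_real (\<Sum>i<n. (cmod (v $ i))\<^sup>2)"
  using assms by (auto simp: scalar_prod_def atLeast0LessThan complex_norm_square[symmetric] intro!: sum.cong)

lemma csquare_pos:
  fixes v :: "complex vec"
  assumes "v \<in> carrier_vec n" "v \<noteq> 0\<^sub>v n"
  shows "0 < Re (v \<bullet>c v)" "v \<bullet>c v = complex_of_real (Re (v \<bullet>c v))"
proof -
  obtain i where i: "i < n" "v $ i \<noteq> 0"
    using assms by (metis carrier_vecD eq_vecI index_zero_vec)
  have "0 < (\<Sum>i<n. (cmod (v $ i))\<^sup>2)"
    by (rule sum_pos2[of _ i]) (use i in auto)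
  then show "0 < Re (v \<bullet>c v)" "v \<bullet>c v = complex_of_real (Re (v \<bullet>c v))"
    using csquare_eq_sum[OF assms(1)] by auto
qed

lemma unitary_matD:
  assumes "unitary_mat n U"
  shows "U \<in> carrier_mat n n" "U * mat_adjoint U = 1\<^sub>m n" "mat_adjoint U * U = 1\<^sub>m n"
  using assms by (auto simp: unitary_mat_def)

lemma unitary_matI:
  assumes "U \<in> carrier_mat n n" "mat_adjoint U * U = 1\<^sub>m n"
  shows "unitary_mat n U"
  using assms mat_mult_left_right_inverse[of "mat_adjoint U" n U] by (auto simp: unitary_mat_def)

lemma unitary_mat_mult:
  assumes "unitary_mat n U" "unitary_mat n V"
  shows "unitary_mat n (U * V)"
proof (rule unitary_matI)
  note U = unitary_matD[OF assms(1)] and V = unitary_matD[OF assms(2)]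
  note [simp] = U V
  show "U * V \<in> carrier_mat n n" by (rule mult_carrier_mat[OF U(1) V(1)])
  have "mat_adjoint (U * V) * (U * V) = mat_adjoint V * (mat_adjoint U * U) * V"
    by (simp only: adjoint_mult[OF U(1) V(1)])
       (simp add: assoc_mult_mat[of _ n n _ n _ n] del: U(2,3) V(2,3))
  then show "mat_adjoint (U * V) * (U * V) = 1\<^sub>m n"
    by (simp add: right_mult_one_mat[of _ n n])
qed

text \<open>Gram-Schmidt on a basis starting with \<open>v\<close> gives orthogonal columns, which
  are then scaled to unit length. The factor \<open>c\<close> is left open because \<open>v\<close>
  need not be a unit vector and a multiple of an eigenvector serves equally well.\<close>

lemma exists_unitary_first_col:
  fixes v :: "complex vec"
  assumes v: "v \<in> carrier_vec n" and v0: "v \<noteq> 0\<^sub>v n"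
  obtains U c where "unitary_mat n U" "col U 0 = c \<cdot>\<^sub>v v"
proof -
  interpret cof_vec_space n "TYPE(complex)" .
  define b where "b = basis_completion v"
  define ws where "ws = gram_schmidt n b"
  have n: "n \<noteq> 0" using v v0 by auto
  from basis_completion[OF v v0, folded b_def]
  have dist_b: "distinct b" and indep: "\<not> lin_dep (set b)" and b: "set b \<subseteq> carrier_vec n"
    and hdb: "hd b = v" and len_b: "length b = n" by auto
  from hdb len_b n obtain vs where bv: "b = v # vs" by (cases b) auto
  from gram_schmidt_result[OF b dist_b indep refl, folded ws_def]
  have ws: "set ws \<subseteq> carrier_vec n" "corthogonal ws" "length ws = n"
    by (auto simp: len_b)
  from gram_schmidt_hd[OF v, of vs, folded bv] have hdws: "hd ws = v"
    unfolding ws_def .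
  have wc: "ws ! i \<in> carrier_vec n" if "i < n" for i
    using ws that by auto
  have wo: "(ws ! i \<bullet>c ws ! j = 0) = (i \<noteq> j)" if "i < n" "j < n" for i j
    using corthogonalD[OF ws(2)] that ws(3) by auto
  define c where "c i = complex_of_real (1 / sqrt (Re (ws ! i \<bullet>c ws ! i)))" for i
  define U where "U = mat n n (\<lambda>(i,j). c j * ws ! j $ i)"
  have U: "U \<in> carrier_mat n n" by (simp add: U_def)
  have colU: "col U j = c j \<cdot>\<^sub>v ws ! j" if "j < n" for j
    using that wc[OF that] by (intro eq_vecI) (auto simp: U_def)
  have "mat_adjoint U * U = 1\<^sub>m n"
  proof (rule eq_matI)
    fix i j assume ij: "i < dim_row (1\<^sub>m n :: complex mat)" "j < dim_col (1\<^sub>m n :: complex mat)"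
    then have i: "i < n" and j: "j < n" by auto
    have "(mat_adjoint U * U) $$ (i,j) = (\<Sum>k<n. cnj (c i * ws ! i $ k) * (c j * ws ! j $ k))"
      using i j by (auto simp: U_def scalar_prod_def atLeast0LessThan intro!: sum.cong)
    also have "\<dots> = cnj (c i) * c j * (\<Sum>k<n. ws ! j $ k * cnj (ws ! i $ k))"
      by (simp add: sum_distrib_left mult_ac)
    also have "(\<Sum>k<n. ws ! j $ k * cnj (ws ! i $ k)) = ws ! j \<bullet>c ws ! i"
      using wc[OF i] wc[OF j] by (auto simp: scalar_prod_def atLeast0LessThan intro!: sum.cong)
    finally have e: "(mat_adjoint U * U) $$ (i,j) = cnj (c i) * c j * (ws ! j \<bullet>c ws ! i)" .
    show "(mat_adjoint U * U) $$ (i,j) = 1\<^sub>m n $$ (i,j)"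
    proof (cases "i = j")
      case False
      with e wo[OF j i] i j show ?thesis by simp
    next
      case True
      have "ws ! i \<noteq> 0\<^sub>v n" using wo[OF i i] conjugate_square_eq_0_vec[OF wc[OF i]] by auto
      from csquare_pos[OF wc[OF i] this]
      obtain r where r: "r > 0" "ws ! i \<bullet>c ws ! i = complex_of_real r" by blast
      have "complex_of_real (1 / sqrt r) * complex_of_real (1 / sqrt r) * complex_of_real r
            = complex_of_real ((1 / sqrt r) * (1 / sqrt r) * r)"
        by (simp only: of_real_mult)
      also have "(1 / sqrt r) * (1 / sqrt r) * r = 1" using r by simp
      finally show ?thesis using e True i r by (simp add: c_def)
    qed
  qed (use U in auto)
  then have "unitary_mat n U" using unitary_matI U by blast
  moreover have "col U 0 = c 0 \<cdot>\<^sub>v v"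
    using colU[of 0] n hdws ws(3) by (metis hd_conv_nth length_0_conv neq0_conv)
  ultimately show thesis using that by blast
qed

lemma exists_eigenvector:
  fixes A :: "complex mat"
  assumes A: "A \<in> carrier_mat n n" and n: "n \<noteq> 0"
  obtains v e where "v \<in> carrier_vec n" "v \<noteq> 0\<^sub>v n" "A *\<^sub>v v = e \<cdot>\<^sub>v v"
proof -
  have "degree (char_poly A) = n" using degree_monic_char_poly[OF A] by simp
  with n have "\<not> constant (poly (char_poly A))" by (simp add: constant_degree)
  from fundamental_theorem_of_algebra[OF this] obtain e where "poly (char_poly A) e = 0" by auto
  then have "eigenvalue A e" using eigenvalue_root_char_poly[OF A] by simp
  then obtain v where "eigenvector A v e" unfolding eigenvalue_def by blast
  with A that show thesis unfolding eigenvector_def by auto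
qed

lemma hermitian_matD:
  assumes "hermitian_mat n A"
  shows "A \<in> carrier_mat n n" "mat_adjoint A = A"
  using assms by (auto simp: hermitian_mat_def)

lemma hermitian_conj:
  assumes "hermitian_mat n A" "X \<in> carrier_mat n n"
  shows "hermitian_mat n (X * A * mat_adjoint X)"
proof -
  note A = hermitian_matD[OF assms(1)]
  have "mat_adjoint (X * A * mat_adjoint X) = X * (A * mat_adjoint X)"
    using A assms(2) by (simp add: adjoint_mult[of _ n n _ n])
  also have "\<dots> = X * A * mat_adjoint X"
    using A assms(2) by (simp add: assoc_mult_mat[of _ n n _ n _ n])
  finally show ?thesis using A assms(2) by (auto simp: hermitian_mat_def)
qed

lemma adjoint_four_block:
  fixes A B C D :: "complex mat"
  assumes "A \<in> carrier_mat k k" "B \<in> carrier_mat k m" "C \<in> carrier_mat m k" "D \<in> carrier_mat m m"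
  shows "mat_adjoint (four_block_mat A B C D) =
    four_block_mat (mat_adjoint A) (mat_adjoint C) (mat_adjoint B) (mat_adjoint D)"
  using assms by (intro eq_matI) auto

lemma adjoint_zero [simp]: "mat_adjoint (0\<^sub>m n m :: complex mat) = 0\<^sub>m m n"
  by (intro eq_matI) auto

text \<open>Deflation: in an orthonormal basis whose first vector is an eigenvector, the first
  column of the matrix is \<open>(e, 0, ..., 0)\<close>. Self-adjointness forces the same on the
  first row and makes \<open>e\<close> real, so a Hermitian block of size \<open>m\<close> splits
  off for the induction.\<close>

theorem spectral_theorem:
  assumes "hermitian_mat n A"
  shows "\<exists>U d. unitary_mat n U \<and>
    A = U * mat_diag n (\<lambda>i. complex_of_real (d i)) * mat_adjoint U"
  using assms
proof (induction n arbitrary: A)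
  case 0
  then have "A = 1\<^sub>m 0" by (intro eq_matI) (auto simp: hermitian_mat_def)
  moreover have "unitary_mat 0 (1\<^sub>m 0)" by (auto intro: unitary_matI)
  ultimately show ?case by (intro exI[of _ "1\<^sub>m 0"]) (auto intro!: eq_matI)
next
  case (Suc m)
  let ?n = "Suc m"
  note A = hermitian_matD[OF Suc.prems]
  obtain v e where v: "v \<in> carrier_vec ?n" "v \<noteq> 0\<^sub>v ?n" "A *\<^sub>v v = e \<cdot>\<^sub>v v"
    using exists_eigenvector[OF A(1)] by auto
  obtain W c where W: "unitary_mat ?n W" and cW: "col W 0 = c \<cdot>\<^sub>v v"
    using exists_unitary_first_col[OF v(1,2)] by blast
  note W' = unitary_matD[OF W]
  define A' where "A' = mat_adjoint W * A * W"
  have A'h: "hermitian_mat ?n A'"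
    using hermitian_conj[OF Suc.prems, of "mat_adjoint W"] W'(1) by (simp add: A'_def)
  note A' = hermitian_matD[OF A'h]
  have "A *\<^sub>v col W 0 = e \<cdot>\<^sub>v col W 0"
    using A(1) v by (simp add: cW mult_mat_vec smult_smult_assoc mult.commute)
  moreover have "col (A * W) 0 = A *\<^sub>v col W 0" by (rule col_mult2[OF A(1) W'(1)]) simp
  ultimately have AW: "col (A * W) 0 = e \<cdot>\<^sub>v col W 0" by simp
  have col0: "A' $$ (i, 0) = (if i = 0 then e else 0)" if i: "i < ?n" for i
  proof -
    have "A' $$ (i,0) = (mat_adjoint W * (A * W)) $$ (i,0)"
      using A(1) W'(1) by (simp add: A'_def assoc_mult_mat[of _ ?n ?n _ ?n _ ?n])
    also have "\<dots> = row (mat_adjoint W) i \<bullet> col (A * W) 0"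
      using A(1) W'(1) i by simp
    also have "\<dots> = e * (row (mat_adjoint W) i \<bullet> col W 0)"
      unfolding AW using W'(1) i by simp
    also have "row (mat_adjoint W) i \<bullet> col W 0 = (mat_adjoint W * W) $$ (i,0)"
      using W'(1) i by simp
    finally show ?thesis using W'(3) i by simp
  qed
  have row0: "A' $$ (0, j) = (if j = 0 then e else 0)" if j: "j < ?n" for j
  proof -
    have "A' $$ (0,j) = mat_adjoint A' $$ (0,j)" using A' by simp
    also have "\<dots> = cnj (A' $$ (j, 0))" using A'(1) j by (subst adjoint_index) auto
    finally show ?thesis using col0[OF j] col0[of 0] \<open>A' $$ (0,j) = mat_adjoint A' $$ (0,j)\<close>
      by (cases "j = 0") auto
  qed
  have "cnj e = e"
  proof -
    have "mat_adjoint A' $$ (0,0) = cnj (A' $$ (0,0))" using A'(1) by (subst adjoint_index) auto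
    then show ?thesis using A'(2) col0[of 0] by simp
  qed
  then have e: "e = complex_of_real (Re e)" by (simp add: complex_cnj_cancel_iff complex_eq_iff)
  define D where "D = mat m m (\<lambda>(i,j). A' $$ (Suc i, Suc j))"
  have D: "D \<in> carrier_mat m m" by (simp add: D_def)
  have Dh: "hermitian_mat m D"
  proof -
    have "mat_adjoint D = D"
    proof (rule eq_matI)
      fix i j assume "i < dim_row D" "j < dim_col D"
      then have ij: "i < m" "j < m" using D by auto
      then have "mat_adjoint A' $$ (Suc i, Suc j) = cnj (A' $$ (Suc j, Suc i))"
        using A'(1) by (subst adjoint_index) auto
      then show "mat_adjoint D $$ (i, j) = D $$ (i, j)" using A'(2) ij by (simp add: D_def)
    qed (use D in auto)
    with D show ?thesis by (simp add: hermitian_mat_def)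
  qed
  obtain V d where V: "unitary_mat m V"
    and DV: "D = V * mat_diag m (\<lambda>i. complex_of_real (d i)) * mat_adjoint V"
    using Suc.IH[OF Dh] by blast
  note V' = unitary_matD[OF V]
  define V1 where "V1 = four_block_mat (1\<^sub>m 1) (0\<^sub>m 1 m) (0\<^sub>m m 1) V"
  define f where "f i = (case i of 0 \<Rightarrow> Re e | Suc i \<Rightarrow> d i)" for i
  let ?F = "mat_diag ?n (\<lambda>i. complex_of_real (f i))"
  let ?D = "mat_diag m (\<lambda>i. complex_of_real (d i))"
  have V1c: "V1 \<in> carrier_mat ?n ?n" using V'(1) by (auto simp: V1_def)
  have V1a: "mat_adjoint V1 = four_block_mat (1\<^sub>m 1) (0\<^sub>m 1 m) (0\<^sub>m m 1) (mat_adjoint V)"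
    unfolding V1_def using V'(1) by (subst adjoint_four_block[of _ 1 _ m]) auto
  have F: "?F = four_block_mat (e \<cdot>\<^sub>m 1\<^sub>m 1) (0\<^sub>m 1 m) (0\<^sub>m m 1) ?D"
    using e by (intro eq_matI) (auto simp: mat_diag_def f_def split: nat.splits)
  have A'b: "A' = four_block_mat (e \<cdot>\<^sub>m 1\<^sub>m 1) (0\<^sub>m 1 m) (0\<^sub>m m 1) D"
    using A'(1) D by (intro eq_matI) (auto simp: D_def col0 row0)
  have dc: "?D \<in> carrier_mat m m" by simp
  have "mat_adjoint V1 * V1 = four_block_mat (1\<^sub>m 1) (0\<^sub>m 1 m) (0\<^sub>m m 1) (1\<^sub>m m)"
    unfolding V1a unfolding V1_def using V'
    by (subst mult_four_block_mat[of _ 1 1 _ m _ m _ _ 1 _ m]) auto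
  also have "\<dots> = 1\<^sub>m ?n" by (intro eq_matI) auto
  finally have V1u: "unitary_mat ?n V1" using V1c unitary_matI by blast
  have "V1 * ?F = four_block_mat (e \<cdot>\<^sub>m 1\<^sub>m 1) (0\<^sub>m 1 m) (0\<^sub>m m 1) (V * ?D)"
    unfolding F unfolding V1_def using V'(1) dc
    by (subst mult_four_block_mat[of _ 1 1 _ m _ m _ _ 1 _ m]) (auto simp: left_mult_zero_mat[OF dc])
  then have "V1 * ?F * mat_adjoint V1 =
      four_block_mat (e \<cdot>\<^sub>m 1\<^sub>m 1) (0\<^sub>m 1 m) (0\<^sub>m m 1) (V * ?D * mat_adjoint V)"
    unfolding V1a using V'(1) dc right_mult_zero_mat[OF square_mult_carrier[OF V'(1) dc]]
      left_add_zero_mat[OF square_mult_carrier[OF square_mult_carrier[OF V'(1) dc] adjoint_carrier[OF V'(1)]]]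
    by (simp del: assoc_mult_mat, subst mult_four_block_mat[of _ 1 1 _ m _ m _ _ 1 _ m])
       (auto simp del: assoc_mult_mat)
  then have A'V: "A' = V1 * ?F * mat_adjoint V1" unfolding A'b DV by simp
  have "A = (W * mat_adjoint W) * A * (W * mat_adjoint W)" using W' A by simp
  also have "\<dots> = W * A' * mat_adjoint W"
    using A W'(1) by (simp add: A'_def assoc_mult_mat[of _ ?n ?n _ ?n _ ?n])
  also have "\<dots> = (W * V1) * ?F * mat_adjoint (W * V1)"
    unfolding A'V using W'(1) V1c
    by (simp add: adjoint_mult[of _ ?n ?n _ ?n] assoc_mult_mat[of _ ?n ?n _ ?n _ ?n])
  finally show ?case using unitary_mat_mult[OF W V1u] by blast
qed

subsection \<open>Functional calculus\<close>

lemma square_mult_vec_carrier [simp]: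
  "A \<in> carrier_mat n n \<Longrightarrow> v \<in> carrier_vec n \<Longrightarrow> A *\<^sub>v v \<in> carrier_vec n"
  by auto

lemma conj_diag_index:
  assumes "U \<in> carrier_mat n n" "i < n" "j < n"
  shows "(U * mat_diag n f * mat_adjoint U) $$ (i, j) = (\<Sum>k<n. U $$ (i,k) * f k * conjugate (U $$ (j,k)))"
  using assms by (subst mat_diag_mult_right[of _ n n])
    (auto simp: scalar_prod_def atLeast0LessThan intro!: sum.cong)

lemma unitary_cancel:
  assumes "unitary_mat n U" "A \<in> carrier_mat n n"
  shows "U * (mat_adjoint U * A) = A" "mat_adjoint U * (U * A) = A"
  using assms unitary_matD[OF assms(1)]
  by (simp_all add: assoc_mult_mat[of _ n n _ n _ n, symmetric] left_mult_one_mat[of _ n n]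
      del: assoc_mult_mat)

abbreviation udiag :: "nat \<Rightarrow> complex mat \<Rightarrow> (nat \<Rightarrow> real) \<Rightarrow> complex mat" where
  "udiag n U d \<equiv> U * mat_diag n (\<lambda>i. complex_of_real (d i)) * mat_adjoint U"

text \<open>In the two eigenbases the hypothesis reads \<open>d i * W(i,j) = W(i,j) * e j\<close>,
  so \<open>W(i,j)\<close> vanishes unless \<open>d i = e j\<close>, and then \<open>f\<close> takes
  the same value on both. This works for an arbitrary function \<open>f\<close>.\<close>

lemma intertwine_diag:
  fixes X :: "complex mat" and d e f :: "_ \<Rightarrow> real"
  assumes U: "unitary_mat n U" and V: "unitary_mat n V" and X: "X \<in> carrier_mat n n"
    and eq: "udiag n U d * X
           = X * udiag n V e"
  shows "(udiag n U (\<lambda>i. f (d i))) * X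
           = X * (udiag n V (\<lambda>i. f (e i)))"
proof -
  note U' = unitary_matD[OF U] and V' = unitary_matD[OF V]
  note assoc = assoc_mult_mat[of _ n n _ n _ n]
  note unit = left_mult_one_mat[of _ n n] right_mult_one_mat[of _ n n]
  define W where "W = mat_adjoint U * X * V"
  have W: "W \<in> carrier_mat n n" using U' V' X by (simp add: W_def)
  have XW: "X = U * W * mat_adjoint V"
    using U' V' X unitary_cancel[OF U] by (simp add: W_def assoc unit)
  have key: "(U * mat_diag n a * mat_adjoint U) * X = U * (mat_diag n a * W) * mat_adjoint V"
    "X * (V * mat_diag n a * mat_adjoint V) = U * (W * mat_diag n a) * mat_adjoint V" for a
    using U' V' W unitary_cancel[OF U] unitary_cancel[OF V]
    by (simp_all add: XW assoc)
  have "mat_diag n (\<lambda>i. complex_of_real (d i)) * W = W * mat_diag n (\<lambda>i. complex_of_real (e i))"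
  proof -
    have "mat_adjoint U * (U * (mat_diag n (\<lambda>i. complex_of_real (d i)) * W) * mat_adjoint V) * V =
      mat_adjoint U * (U * (W * mat_diag n (\<lambda>i. complex_of_real (e i))) * mat_adjoint V) * V"
      using eq unfolding key by simp
    then show ?thesis using U' V' W unitary_cancel[OF U] by (simp add: assoc unit)
  qed
  then have "complex_of_real (d i) * W $$ (i,j) = W $$ (i,j) * complex_of_real (e j)"
    if "i < n" "j < n" for i j
    using that W unfolding mat_diag_mult_left[OF W] mat_diag_mult_right[OF W]
    by (metis (mono_tags, lifting) index_mat(1) split_conv)
  then have "d i = e j \<or> W $$ (i,j) = 0" if "i < n" "j < n" for i j
    using that by (metis mult.commute mult_cancel_left of_real_eq_iff)
  then have "complex_of_real (f (d i)) * W $$ (i,j) = W $$ (i,j) * complex_of_real (f (e j))"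
    if "i < n" "j < n" for i j
    using that by fastforce
  then have "mat_diag n (\<lambda>i. complex_of_real (f (d i))) * W = W * mat_diag n (\<lambda>i. complex_of_real (f (e i)))"
    unfolding mat_diag_mult_left[OF W] mat_diag_mult_right[OF W] by (intro eq_matI) auto
  then show ?thesis unfolding key by simp
qed

text \<open>The choice operator may return a decomposition other than \<open>U\<close>,
  \<open>d\<close>. Both diagonalize the same matrix, so the identity intertwines them and
  \<open>intertwine_diag\<close> makes the two results equal.\<close>

lemma herm_fun_diag:
  assumes U: "unitary_mat n U"
    and A: "A = udiag n U d"
  shows "herm_fun f A = udiag n U (\<lambda>i. f (d i))"
proof -
  note U' = unitary_matD[OF U]
  have dim: "dim_row A = n" using A U'(1) by simp
  define P where "P C = (\<exists>U d. unitary_mat n U \<and>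
     A = udiag n U d \<and>
     C = udiag n U (\<lambda>i. f (d i)))" for C
  have "herm_fun f A = Eps P" by (simp add: herm_fun_def P_def[abs_def] dim)
  moreover have "P (udiag n U (\<lambda>i. f (d i)))"
    unfolding P_def using U A by blast
  ultimately have "P (herm_fun f A)" by (metis someI)
  then obtain V e where V: "unitary_mat n V"
    and AV: "A = udiag n V e"
    and h: "herm_fun f A = udiag n V (\<lambda>i. f (e i))"
    unfolding P_def by blast
  have Ac: "A \<in> carrier_mat n n" using A U'(1) by simp
  have hc: "herm_fun f A \<in> carrier_mat n n" using h unitary_matD(1)[OF V] by simp
  have "herm_fun f A * 1\<^sub>m n = 1\<^sub>m n * (udiag n U (\<lambda>i. f (d i)))"
    unfolding h
    by (rule intertwine_diag[OF V U]) (use Ac A AV in \<open>auto simp: left_mult_one_mat[of _ n n] right_mult_one_mat[of _ n n]\<close>)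
  then show ?thesis using hc U'(1) by (simp add: left_mult_one_mat[of _ n n] right_mult_one_mat[of _ n n])
qed

lemma hermitian_diag:
  assumes "unitary_mat n U"
  shows "hermitian_mat n (udiag n U d)"
  using unitary_matD[OF assms] by (intro hermitian_conj) (auto simp: hermitian_mat_def)

lemma herm_fun_intertwine:
  assumes A: "hermitian_mat n A" and B: "hermitian_mat n B" and X: "X \<in> carrier_mat n n"
    and "A * X = X * B"
  shows "herm_fun f A * X = X * herm_fun f B"
proof -
  obtain U d where U: "unitary_mat n U"
    and AU: "A = udiag n U d"
    using spectral_theorem[OF A] by blast
  obtain V e where V: "unitary_mat n V"
    and BV: "B = udiag n V e"
    using spectral_theorem[OF B] by blast
  show ?thesis
    unfolding herm_fun_diag[OF U AU] herm_fun_diag[OF V BV]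
    by (rule intertwine_diag[OF U V X]) (use assms(4) AU BV in simp)
qed

section \<open>Quadratic forms and positive semidefiniteness\<close>

definition qform :: "complex mat \<Rightarrow> complex vec \<Rightarrow> real" where
  "qform A v = Re ((A *\<^sub>v v) \<bullet>c v)"

lemma mat_diag_mult_vec:
  fixes w :: "complex vec"
  assumes "w \<in> carrier_vec n" "i < n"
  shows "(mat_diag n f *\<^sub>v w) $ i = f i * w $ i"
proof -
  have "(mat_diag n f *\<^sub>v w) $ i = (\<Sum>k<n. (if i = k then f k else 0) * w $ k)"
    using assms by (auto simp: mat_diag_def scalar_prod_def atLeast0LessThan intro!: sum.cong)
  also have "\<dots> = (\<Sum>k<n. if i = k then f k * w $ k else 0)"
    by (intro sum.cong) auto
  finally show ?thesis using assms by simp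
qed

lemma qform_diag:
  assumes U: "unitary_mat n U" and v: "v \<in> carrier_vec n"
  shows "qform (udiag n U d) v =
    (\<Sum>i<n. d i * (cmod ((mat_adjoint U *\<^sub>v v) $ i))\<^sup>2)"
proof -
  note U' = unitary_matD[OF U]
  define w where "w = mat_adjoint U *\<^sub>v v"
  let ?D = "mat_diag n (\<lambda>i. complex_of_real (d i))"
  have w: "w \<in> carrier_vec n" using U' v by (simp add: w_def)
  have "((U * ?D * mat_adjoint U) *\<^sub>v v) \<bullet>c v = (U *\<^sub>v (?D *\<^sub>v w)) \<bullet>c v"
    using U'(1) v by (simp add: w_def assoc_mult_mat_vec[of _ n n _ n])
  also have "\<dots> = (?D *\<^sub>v w) \<bullet>c w"
    unfolding w_def using U'(1) v by (subst cscalar_adjoint[of _ n n]) auto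
  also have "\<dots> = (\<Sum>i<n. (?D *\<^sub>v w) $ i * cnj (w $ i))"
    using w by (auto simp: scalar_prod_def[of _ "conjugate w"] atLeast0LessThan)
  also have "\<dots> = (\<Sum>i<n. complex_of_real (d i) * (w $ i * cnj (w $ i)))"
    by (intro sum.cong) (simp_all only: lessThan_iff mat_diag_mult_vec[OF w] mult.assoc)
  also have "\<dots> = complex_of_real (\<Sum>i<n. d i * (cmod (w $ i))\<^sup>2)"
    by (simp add: complex_norm_square[symmetric])
  finally show ?thesis by (simp add: qform_def w_def)
qed

lemma qform_diag_col:
  assumes U: "unitary_mat n U" and i: "i < n"
  shows "qform (udiag n U d) (col U i) = d i"
proof -
  note U' = unitary_matD[OF U]
  have "mat_adjoint U *\<^sub>v col U i = col (mat_adjoint U * U) i"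
    using U' i by (subst col_mult2[of _ n n _ n]) auto
  then have "(mat_adjoint U *\<^sub>v col U i) $ j = (if j = i then 1 else 0)" if "j < n" for j
    using U' i that by simp
  then have "d j * (cmod ((mat_adjoint U *\<^sub>v col U i) $ j))\<^sup>2 = (if j = i then d j else 0)" if "j < n" for j
    by (simp only: that) simp
  then have "qform (udiag n U d) (col U i) =
     (\<Sum>j<n. if j = i then d j else 0)"
    using U' i by (subst qform_diag[OF U]) (auto intro!: sum.cong simp del: index_mult_mat_vec)
  also have "\<dots> = d i" using i by simp
  finally show ?thesis .
qed

lemma psd_mat_alt:
  "psd_mat n A \<longleftrightarrow> hermitian_mat n A \<and> (\<forall>v\<in>carrier_vec n. 0 \<le> qform A v)"
  by (simp add: psd_mat_def qform_def)

lemma pd_mat_alt: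
  "pd_mat n A \<longleftrightarrow> hermitian_mat n A \<and> (\<forall>v\<in>carrier_vec n. v \<noteq> 0\<^sub>v n \<longrightarrow> 0 < qform A v)"
  by (simp add: pd_mat_def qform_def)

lemma psd_diag_iff:
  assumes U: "unitary_mat n U"
  shows "psd_mat n (udiag n U d) \<longleftrightarrow> (\<forall>i<n. 0 \<le> d i)"
proof
  assume "psd_mat n (udiag n U d)"
  then show "\<forall>i<n. 0 \<le> d i"
    using qform_diag_col[OF U] unitary_matD(1)[OF U] by (metis carrier_vecI col_dim carrier_matD(1) psd_mat_alt)
next
  assume "\<forall>i<n. 0 \<le> d i"
  then show "psd_mat n (udiag n U d)"
    using hermitian_diag[OF U] by (auto simp: psd_mat_alt qform_diag[OF U] intro!: sum_nonneg)
qed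

lemma psd_spectral:
  assumes "psd_mat n A"
  obtains U d where "unitary_mat n U" "\<forall>i<n. 0 \<le> d i"
    "A = udiag n U d"
  using assms spectral_theorem[of n A] psd_diag_iff by (metis psd_mat_def)

lemma psd_matD:
  assumes "psd_mat n A"
  shows "hermitian_mat n A" "A \<in> carrier_mat n n" "mat_adjoint A = A" "v \<in> carrier_vec n \<Longrightarrow> 0 \<le> qform A v"
  using assms by (auto simp: psd_mat_alt hermitian_mat_def)

lemma pd_imp_psd:
  assumes "pd_mat n A"
  shows "psd_mat n A"
proof -
  have "0 \<le> qform A v" if v: "v \<in> carrier_vec n" for v
  proof (cases "v = 0\<^sub>v n")
    case True
    with assms show ?thesis
      by (auto simp: pd_mat_alt qform_def hermitian_mat_def)
  qed (use assms v in \<open>auto simp: pd_mat_alt less_imp_le\<close>)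
  with assms show ?thesis by (auto simp: pd_mat_alt psd_mat_alt)
qed

section \<open>Powers of positive semidefinite matrices\<close>

lemma diag_conj_cong:
  assumes "\<And>i. i < n \<Longrightarrow> f i = g i"
  shows "U * mat_diag n f * mat_adjoint U = U * mat_diag n g * mat_adjoint U"
proof -
  have "mat_diag n f = mat_diag n g" using assms by (intro eq_matI) (auto simp: mat_diag_def)
  then show ?thesis by simp
qed

text \<open>Merges the two branches of \<open>psd_pow\<close>: since \<open>inverse 0 = 0\<close>
  and \<open>0 powr r = 0\<close>, the branch through \<open>gen_inv\<close> also gives
  \<open>d i powr r\<close>, on the kernel as well as on the support.\<close>

lemma psd_pow_diag:
  assumes U: "unitary_mat n U" and d: "\<forall>i<n. 0 \<le> d i"
    and A: "A = udiag n U d"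
  shows "psd_pow A r = udiag n U (\<lambda>i. d i powr r)"
proof (cases "r < 0")
  case True
  have inv: "gen_inv A = udiag n U (\<lambda>i. inverse (d i))"
    unfolding gen_inv_def by (rule herm_fun_diag[OF U A])
  have "psd_pow A r = herm_fun (\<lambda>x. x powr - r) (gen_inv A)" using True by (simp add: psd_pow_def)
  also have "\<dots> = udiag n U (\<lambda>i. inverse (d i) powr - r)"
    by (rule herm_fun_diag[OF U inv])
  also have "\<dots> = udiag n U (\<lambda>i. d i powr r)"
    by (rule diag_conj_cong) (use d in \<open>auto simp: powr_minus inverse_powr\<close>)
  finally show ?thesis .
qed (use herm_fun_diag[OF U A] in \<open>simp add: psd_pow_def\<close>)

lemma psd_pow_psd [simp]:
  assumes "psd_mat n A"
  shows "psd_mat n (psd_pow A r)"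
proof -
  obtain U d where U: "unitary_mat n U" and d: "\<forall>i<n. 0 \<le> d i"
    and A: "A = udiag n U d"
    using psd_spectral[OF assms] by blast
  show ?thesis unfolding psd_pow_diag[OF U d A] by (simp add: psd_diag_iff[OF U])
qed

lemma psd_pow_carrier [simp]: "psd_mat n A \<Longrightarrow> psd_pow A r \<in> carrier_mat n n"
  by (rule psd_matD(2)[OF psd_pow_psd])

lemma psd_pow_adjoint: "psd_mat n A \<Longrightarrow> mat_adjoint (psd_pow A r) = psd_pow A r"
  by (rule psd_matD(3)[OF psd_pow_psd])

lemma psd_pow_1:
  assumes "psd_mat n A"
  shows "psd_pow A 1 = A"
proof -
  obtain U d where U: "unitary_mat n U" and d: "\<forall>i<n. 0 \<le> d i"
    and A: "A = udiag n U d"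
    using psd_spectral[OF assms] by blast
  show ?thesis unfolding psd_pow_diag[OF U d A] by (subst A, rule diag_conj_cong) (use d in auto)
qed

lemma psd_pow_pow:
  assumes "psd_mat n A"
  shows "psd_pow (psd_pow A r) s = psd_pow A (r * s)"
proof -
  obtain U d where U: "unitary_mat n U" and d: "\<forall>i<n. 0 \<le> d i"
    and A: "A = udiag n U d"
    using psd_spectral[OF assms] by blast
  show ?thesis
    by (subst psd_pow_diag[OF U _ psd_pow_diag[OF U d A]])
       (simp_all add: powr_powr psd_pow_diag[OF U d A])
qed

lemma psd_pow_mult:
  assumes "psd_mat n A"
  shows "psd_pow A r * psd_pow A s = psd_pow A (r + s)"
proof -
  obtain U d where U: "unitary_mat n U" and d: "\<forall>i<n. 0 \<le> d i"
    and A: "A = udiag n U d"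
    using psd_spectral[OF assms] by blast
  have "psd_pow A r * psd_pow A s =
      U * (mat_diag n (\<lambda>i. complex_of_real (d i powr r)) * mat_diag n (\<lambda>i. complex_of_real (d i powr s))) * mat_adjoint U"
    unfolding psd_pow_diag[OF U d A] using unitary_matD(1)[OF U] unitary_cancel(2)[OF U]
    by (simp add: assoc_mult_mat[of _ n n _ n _ n] del: mat_diag_diag)
  also have "\<dots> = psd_pow A (r + s)"
    unfolding psd_pow_diag[OF U d A] by (simp add: powr_add)
  finally show ?thesis .
qed

lemma psd_pow_mult_left:
  assumes "psd_mat n A" "X \<in> carrier_mat n n"
  shows "psd_pow A r * (psd_pow A s * X) = psd_pow A (r + s) * X"
  using assms psd_pow_mult[OF assms(1)]
  by (simp add: assoc_mult_mat[of _ n n _ n _ n, symmetric] del: assoc_mult_mat)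

lemma supp_proj_eq:
  assumes "psd_mat n A"
  shows "supp_proj A = psd_pow A 0"
proof -
  obtain U d where U: "unitary_mat n U" and d: "\<forall>i<n. 0 \<le> d i"
    and A: "A = udiag n U d"
    using psd_spectral[OF assms] by blast
  show ?thesis unfolding psd_pow_diag[OF U d A] supp_proj_def herm_fun_diag[OF U A]
    by (rule diag_conj_cong) auto
qed

lemma psd_pow_intertwine:
  assumes "psd_mat n A" "psd_mat n B" "X \<in> carrier_mat n n" "A * X = X * B"
  shows "psd_pow A r * X = X * psd_pow B r"
proof -
  note [simp] = assms(1,2)
  have e: "psd_pow C r = herm_fun (\<lambda>x. x powr r) C" if "psd_mat n C" for C
  proof -
    obtain U d where U: "unitary_mat n U" and d: "\<forall>i<n. 0 \<le> d i"
      and C: "C = udiag n U d"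
      using psd_spectral[OF \<open>psd_mat n C\<close>] by blast
    show ?thesis unfolding psd_pow_diag[OF U d C] herm_fun_diag[OF U C] ..
  qed
  show ?thesis unfolding e[OF assms(1)] e[OF assms(2)]
    by (rule herm_fun_intertwine) (use assms psd_matD in auto)
qed

subsection \<open>The Loewner order and the Loewner-Heinz inequality\<close>

abbreviation rsmult :: "real \<Rightarrow> complex mat \<Rightarrow> complex mat" (infixl \<open>\<cdot>\<^sub>r\<close> 70) where
  "c \<cdot>\<^sub>r A \<equiv> complex_of_real c \<cdot>\<^sub>m A"

lemma one_smult_mat [simp]: "(1 :: complex) \<cdot>\<^sub>m A = A"
  by (intro eq_matI) auto

lemma smult_zero_vec [simp]: "(c :: complex) \<cdot>\<^sub>v 0\<^sub>v n = 0\<^sub>v n"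
  by (intro eq_vecI) auto

lemma mult_zero_vec [simp]: "(A :: complex mat) \<in> carrier_mat n n \<Longrightarrow> A *\<^sub>v 0\<^sub>v n = 0\<^sub>v n"
  by (intro eq_vecI) auto

lemma qform_conj:
  assumes "A \<in> carrier_mat n n" "X \<in> carrier_mat n n" "v \<in> carrier_vec n"
  shows "qform (X * A * mat_adjoint X) v = qform A (mat_adjoint X *\<^sub>v v)"
proof -
  have "(X * A * mat_adjoint X) *\<^sub>v v = X *\<^sub>v (A *\<^sub>v (mat_adjoint X *\<^sub>v v))"
    using assms by (simp add: assoc_mult_mat_vec[of _ n n _ n])
  then show ?thesis
    unfolding qform_def using assms by (simp add: cscalar_adjoint[of X n n])
qed

lemma qform_minus:
  assumes "A \<in> carrier_mat n n" "B \<in> carrier_mat n n" "v \<in> carrier_vec n"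
  shows "qform (A - B) v = qform A v - qform B v"
proof -
  have "(A - B) *\<^sub>v v = A *\<^sub>v v - B *\<^sub>v v"
    using assms by (intro minus_mult_distrib_mat_vec)
  then show ?thesis
    using assms by (simp add: qform_def minus_scalar_prod_distrib[of _ n])
qed

lemma qform_smult:
  assumes "A \<in> carrier_mat n n" "v \<in> carrier_vec n"
  shows "qform (c \<cdot>\<^sub>r A) v = c * qform A v"
proof -
  have "(c \<cdot>\<^sub>r A) *\<^sub>v v = complex_of_real c \<cdot>\<^sub>v (A *\<^sub>v v)"
    using assms by (intro eq_vecI) auto
  then show ?thesis using assms by (simp add: qform_def)
qed

lemma qform_one: "v \<in> carrier_vec n \<Longrightarrow> qform (1\<^sub>m n) v = Re (v \<bullet>c v)"
  by (simp add: qform_def)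

lemma hermitian_minus:
  "hermitian_mat n A \<Longrightarrow> hermitian_mat n B \<Longrightarrow> hermitian_mat n (A - B)"
  by (auto simp: hermitian_mat_def adjoint_minus[of _ n n])

lemma hermitian_smult:
  "hermitian_mat n A \<Longrightarrow> hermitian_mat n (c \<cdot>\<^sub>r A)"
  by (auto simp: hermitian_mat_def adjoint_smult)

lemma hermitian_one: "hermitian_mat n (1\<^sub>m n)"
  by (simp add: hermitian_mat_def)

lemma loewner_le_iff:
  "loewner_le n A B \<longleftrightarrow> hermitian_mat n A \<and> hermitian_mat n B \<and>
     (\<forall>v\<in>carrier_vec n. qform A v \<le> qform B v)"
proof (cases "hermitian_mat n A \<and> hermitian_mat n B")
  case True
  with hermitian_matD(1) have "A \<in> carrier_mat n n" "B \<in> carrier_mat n n" by auto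
  with True show ?thesis by (simp add: loewner_le_def psd_mat_alt hermitian_minus qform_minus)
qed (auto simp: loewner_le_def)

lemma loewner_leD:
  assumes "loewner_le n A B"
  shows "hermitian_mat n A" "hermitian_mat n B" "A \<in> carrier_mat n n" "B \<in> carrier_mat n n"
  using assms by (auto simp: loewner_le_def hermitian_mat_def)

lemma loewner_trans [trans]:
  "loewner_le n A B \<Longrightarrow> loewner_le n B C \<Longrightarrow> loewner_le n A C"
  by (auto simp: loewner_le_iff intro: order_trans)

lemma loewner_conj:
  assumes "loewner_le n A B" "X \<in> carrier_mat n n"
  shows "loewner_le n (X * A * mat_adjoint X) (X * B * mat_adjoint X)"
  using assms loewner_leD[OF assms(1)]
  by (auto simp: loewner_le_iff hermitian_conj qform_conj[of _ n])

lemma loewner_conj_pow: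
  assumes "loewner_le n A B" "psd_mat n C"
  shows "loewner_le n (psd_pow C r * A * psd_pow C r) (psd_pow C r * B * psd_pow C r)"
  using loewner_conj[OF assms(1), of "psd_pow C r"] assms(2) by (simp add: psd_pow_adjoint)

lemma loewner_smult:
  assumes "loewner_le n A B" "0 \<le> c"
  shows "loewner_le n (c \<cdot>\<^sub>r A) (c \<cdot>\<^sub>r B)"
  using assms loewner_leD[OF assms(1)]
  by (auto simp: loewner_le_iff hermitian_smult qform_smult[of _ n] mult_left_mono)

lemma psd_conj:
  "psd_mat n A \<Longrightarrow> X \<in> carrier_mat n n \<Longrightarrow> psd_mat n (X * A * mat_adjoint X)"
  by (auto simp: psd_mat_alt hermitian_conj qform_conj[of _ n] hermitian_matD(1))

lemma psd_one: "psd_mat n (1\<^sub>m n)"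
  unfolding psd_mat_alt
proof (intro conjI ballI hermitian_one)
  fix v :: "complex vec" assume v: "v \<in> carrier_vec n"
  show "0 \<le> qform (1\<^sub>m n) v" using csquare_eq_sum[OF v] by (simp add: qform_one[OF v] sum_nonneg)
qed

lemma psd_gram:
  assumes "X \<in> carrier_mat n n"
  shows "psd_mat n (X * mat_adjoint X)"
  using psd_conj[OF psd_one assms] assms by (simp add: right_mult_one_mat[of _ n n])

lemma psd_conj_pow [simp]:
  "psd_mat n A \<Longrightarrow> psd_mat n C \<Longrightarrow> psd_mat n (psd_pow C r * A * psd_pow C r)"
  using psd_conj[of n A "psd_pow C r"] by (simp add: psd_pow_adjoint)

lemma psd_smult: "psd_mat n A \<Longrightarrow> 0 \<le> c \<Longrightarrow> psd_mat n (c \<cdot>\<^sub>r A)"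
  by (auto simp: psd_mat_alt hermitian_smult qform_smult[of _ n] hermitian_matD(1))

lemma diag_conj_minus:
  assumes "unitary_mat n U"
  shows "udiag n U e -
         udiag n U d =
         udiag n U (\<lambda>i. e i - d i)"
  using unitary_matD(1)[OF assms]
  by (intro eq_matI)
     (simp_all add: conj_diag_index[of _ n] sum_subtractf[symmetric] algebra_simps del: index_mult_mat(1))

lemma diag_conj_smult:
  assumes "unitary_mat n U"
  shows "c \<cdot>\<^sub>r (udiag n U d) =
         udiag n U (\<lambda>i. c * d i)"
  using unitary_matD(1)[OF assms]
  by (intro eq_matI)
     (simp_all add: conj_diag_index[of _ n] sum_distrib_left mult_ac del: index_mult_mat(1))

lemma diag_conj_mult:
  assumes "unitary_mat n U"
  shows "(U * mat_diag n f * mat_adjoint U) * (U * mat_diag n g * mat_adjoint U) =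
         U * mat_diag n (\<lambda>i. f i * g i) * mat_adjoint U"
proof -
  have "(U * mat_diag n f * mat_adjoint U) * (U * mat_diag n g * mat_adjoint U) =
      U * (mat_diag n f * mat_diag n g) * mat_adjoint U"
    using unitary_matD(1)[OF assms] unitary_cancel(2)[OF assms]
    by (simp add: assoc_mult_mat[of _ n n _ n _ n] del: mat_diag_diag)
  then show ?thesis by simp
qed

lemma loewner_diag_iff:
  assumes "unitary_mat n U"
  shows "loewner_le n (udiag n U d)
           (udiag n U e) \<longleftrightarrow> (\<forall>i<n. d i \<le> e i)"
  unfolding loewner_le_def diag_conj_minus[OF assms] psd_diag_iff[OF assms]
  by (simp add: hermitian_diag[OF assms])

lemma one_eq_diag:
  assumes "unitary_mat n U"
  shows "c \<cdot>\<^sub>r 1\<^sub>m n = U * mat_diag n (\<lambda>i. complex_of_real c) * mat_adjoint U"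
proof -
  have "U * mat_diag n (\<lambda>i. complex_of_real 1) * mat_adjoint U = 1\<^sub>m n"
    using unitary_matD[OF assms] by (simp add: right_mult_one_mat[of _ n n])
  then show ?thesis using diag_conj_smult[OF assms, of c "\<lambda>i. 1"] by simp
qed

lemma loewner_diag_scalar_iff:
  assumes "unitary_mat n U"
  shows "loewner_le n (udiag n U d)
           (c \<cdot>\<^sub>r 1\<^sub>m n) \<longleftrightarrow> (\<forall>i<n. d i \<le> c)"
  unfolding one_eq_diag[OF assms] loewner_diag_iff[OF assms] ..

lemma loewner_antisym:
  assumes "loewner_le n A B" "loewner_le n B A"
  shows "A = B"
proof -
  note AB = loewner_leD[OF assms(1)]
  obtain U d where U: "unitary_mat n U"
    and D: "B - A = udiag n U d"
    using spectral_theorem[OF hermitian_minus[OF AB(2,1)]] by blast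
  have "A - B = (-1) \<cdot>\<^sub>r (B - A)" using AB by (intro eq_matI) auto
  also have "\<dots> = udiag n U (\<lambda>i. -1 * d i)"
    unfolding D diag_conj_smult[OF U] ..
  finally have D': "A - B = udiag n U (\<lambda>i. -1 * d i)" .
  have "\<forall>i<n. 0 \<le> d i" "\<forall>i<n. 0 \<le> -1 * d i"
    using assms psd_diag_iff[OF U] D D' unfolding loewner_le_def by metis+
  then have "B - A = U * mat_diag n (\<lambda>i. 0) * mat_adjoint U"
    unfolding D by (intro diag_conj_cong) force
  also have "\<dots> = 0\<^sub>m n n"
    using unitary_matD(1)[OF U]
    by (intro eq_matI) (simp_all add: conj_diag_index[of _ n] del: index_mult_mat(1))
  finally have z: "B - A = 0\<^sub>m n n" .
  show ?thesis
  proof (rule eq_matI)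
    fix i j assume ij: "i < dim_row B" "j < dim_col B"
    then have "(B - A) $$ (i,j) = 0" using z AB by simp
    then show "A $$ (i,j) = B $$ (i,j)" using ij AB by simp
  qed (use AB in auto)
qed

text \<open>The two products share their nonzero eigenvalues. Conjugating the hypothesis by
  \<open>mat_adjoint X\<close> gives \<open>N^2 \<le> c N\<close> for
  \<open>N = mat_adjoint X * X\<close>, and \<open>d^2 \<le> c d\<close> for an eigenvalue
  \<open>d > 0\<close> forces \<open>d \<le> c\<close>; for \<open>d = 0\<close> this is
  \<open>0 \<le> c\<close>.\<close>

lemma loewner_gram_swap:
  assumes X: "X \<in> carrier_mat n n" and c: "0 \<le> c"
    and le: "loewner_le n (X * mat_adjoint X) (c \<cdot>\<^sub>r 1\<^sub>m n)"
  shows "loewner_le n (mat_adjoint X * X) (c \<cdot>\<^sub>r 1\<^sub>m n)"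
proof -
  let ?N = "mat_adjoint X * X"
  have N: "psd_mat n ?N" using psd_gram[of "mat_adjoint X" n] X by simp
  obtain U d where U: "unitary_mat n U" and d: "\<forall>i<n. 0 \<le> d i"
    and ND: "?N = udiag n U d"
    using psd_spectral[OF N] by blast
  have "loewner_le n (mat_adjoint X * (X * mat_adjoint X) * X)
     (mat_adjoint X * (c \<cdot>\<^sub>r 1\<^sub>m n) * X)"
    using loewner_conj[OF le, of "mat_adjoint X"] X by simp
  also have "mat_adjoint X * (X * mat_adjoint X) * X = ?N * ?N"
    using X by (simp add: assoc_mult_mat[of _ n n _ n _ n])
  also have "mat_adjoint X * (c \<cdot>\<^sub>r 1\<^sub>m n) * X = c \<cdot>\<^sub>r ?N"
    using X by (simp add: mult_smult_distrib[of _ n n _ n] mult_smult_assoc_mat[of _ n n _ n] right_mult_one_mat[of _ n n])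
  finally have "loewner_le n (?N * ?N) (c \<cdot>\<^sub>r ?N)" .
  then have "\<forall>i<n. d i * d i \<le> c * d i"
    unfolding ND diag_conj_mult[OF U] diag_conj_smult[OF U] of_real_mult[symmetric] loewner_diag_iff[OF U] .
  then have "\<forall>i<n. d i \<le> c"
    using c d by (metis mult_le_cancel_right order_le_less linorder_not_le)
  then show ?thesis unfolding ND loewner_diag_scalar_iff[OF U] .
qed

text \<open>\<open>B * psd_pow A 0 = B\<close> is the working form of
  \<open>s(B) \<le> s(A)\<close>: being multiplicative, it passes to powers of \<open>B\<close> by
  splitting off one factor, and later to compounds. The version from the left follows by taking
  adjoints.\<close>

lemma supp_pow:
  assumes A: "psd_mat n A" and B: "psd_mat n B" "B * psd_pow A 0 = B"
  shows "psd_pow B r * psd_pow A 0 = psd_pow B r" "psd_pow A 0 * psd_pow B r = psd_pow B r"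
proof -
  have "psd_pow B r = psd_pow B (r - 1) * psd_pow B 1"
    by (simp only: psd_pow_mult[OF B(1)]) simp
  also have "psd_pow B 1 = B * psd_pow A 0" using B by (simp add: psd_pow_1)
  finally have e: "psd_pow B r = psd_pow B (r - 1) * (B * psd_pow A 0)" .
  have "psd_pow B r * psd_pow A 0 = psd_pow B (r - 1) * (B * psd_pow A 0)"
    using A B(1) by (subst e) (simp add: assoc_mult_mat[of _ n n _ n _ n] psd_pow_mult psd_matD(2))
  then show *: "psd_pow B r * psd_pow A 0 = psd_pow B r" using e by simp
  have "mat_adjoint (psd_pow B r * psd_pow A 0) = psd_pow A 0 * psd_pow B r"
    using A B by (simp add: adjoint_mult[of _ n n _ n] psd_pow_adjoint)
  then show "psd_pow A 0 * psd_pow B r = psd_pow B r"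
    using * B by (simp add: psd_pow_adjoint)
qed

lemma supp_le_one:
  assumes "psd_mat n A"
  shows "loewner_le n (psd_pow A 0) (1\<^sub>m n)"
proof -
  obtain U d where U: "unitary_mat n U" and d: "\<forall>i<n. 0 \<le> d i"
    and A: "A = udiag n U d"
    using psd_spectral[OF assms] by blast
  have "loewner_le n (psd_pow A 0) (1 \<cdot>\<^sub>r 1\<^sub>m n)"
    unfolding psd_pow_diag[OF U d A] loewner_diag_scalar_iff[OF U] by simp
  then show ?thesis by simp
qed

lemma gram_zero:
  fixes X :: "complex mat"
  assumes X: "X \<in> carrier_mat n n" and z: "mat_adjoint X * X = 0\<^sub>m n n"
  shows "X = 0\<^sub>m n n"
proof (rule eq_matI)
  fix i j assume "i < dim_row (0\<^sub>m n n :: complex mat)" "j < dim_col (0\<^sub>m n n :: complex mat)"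
  then have ij: "i < n" "j < n" by auto
  have "0 = (mat_adjoint X * X) $$ (j,j)" using z ij by simp
  also have "\<dots> = (\<Sum>k<n. X $$ (k,j) * cnj (X $$ (k,j)))"
    using X ij by (auto simp: scalar_prod_def atLeast0LessThan intro!: sum.cong)
  also have "\<dots> = complex_of_real (\<Sum>k<n. (cmod (X $$ (k,j)))\<^sup>2)"
    by (simp add: complex_norm_square[symmetric])
  finally have "(\<Sum>k<n. (cmod (X $$ (k,j)))\<^sup>2) = 0"
    by (metis of_real_eq_0_iff)
  then show "X $$ (i,j) = 0\<^sub>m n n $$ (i,j)"
    using ij by (simp add: sum_nonneg_eq_0_iff)
qed (use X in auto)

text \<open>\<open>X\<close> projects onto the kernel of \<open>A\<close>. Conjugation by it
  squeezes \<open>X * B * X\<close> between zero and \<open>X * A * X = 0\<close>. This is a Gram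
  matrix of \<open>psd_pow B (1/2) * X\<close>, which therefore vanishes, and with it
  \<open>B * X\<close>.\<close>

lemma loewner_supp:
  assumes A: "psd_mat n A" and B: "psd_mat n B" and le: "loewner_le n B A"
  shows "B * psd_pow A 0 = B"
proof -
  note [simp] = psd_matD(2)[OF A] psd_matD(2)[OF B]
  let ?E = "psd_pow A 0"
  define X where "X = 1\<^sub>m n - ?E"
  have Ec: "?E \<in> carrier_mat n n" using A by simp
  have X: "X \<in> carrier_mat n n" unfolding X_def by (rule minus_carrier_mat[OF Ec])
  have Xh: "mat_adjoint X = X" using A by (simp add: X_def adjoint_minus[of _ n n] psd_pow_adjoint)
  have "psd_pow A 1 * ?E = psd_pow A 1" by (simp only: psd_pow_mult[OF A]) simp
  then have AE: "A * ?E = A" using A by (simp add: psd_pow_1)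
  have "A * X = 0\<^sub>m n n"
    using A unfolding X_def by (subst mult_minus_distrib_mat[of _ n n _ n]) (auto simp: AE right_mult_one_mat[of _ n n])
  then have "X * A * X = 0\<^sub>m n n" using X by (simp add: assoc_mult_mat[of _ n n _ n _ n])
  then have le0: "loewner_le n (X * B * X) (0\<^sub>m n n)"
    using loewner_conj[OF le X] Xh by simp
  have "psd_mat n (X * B * X)" using psd_conj[OF B X] Xh by simp
  moreover have "X * B * X - 0\<^sub>m n n = X * B * X" using X by (intro eq_matI) auto
  ultimately have "loewner_le n (0\<^sub>m n n) (X * B * X)"
    using le0 by (simp add: loewner_le_def)
  from loewner_antisym[OF le0 this] have z: "X * B * X = 0\<^sub>m n n" .
  define Y where "Y = psd_pow B (1/2) * X"
  have BB: "psd_pow B (1/2) * psd_pow B (1/2) = B"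
    using psd_pow_mult[OF B, of "1/2" "1/2"] psd_pow_1[OF B] by simp
  have Y: "Y \<in> carrier_mat n n" using X B by (simp add: Y_def)
  have "mat_adjoint Y * Y = X * (psd_pow B (1/2) * psd_pow B (1/2)) * X"
    using X B by (simp add: Y_def adjoint_mult[of _ n n _ n] Xh psd_pow_adjoint assoc_mult_mat[of _ n n _ n _ n])
  then have "mat_adjoint Y * Y = 0\<^sub>m n n" using z BB by simp
  then have "Y = 0\<^sub>m n n" by (rule gram_zero[OF Y])
  moreover have "B * X = psd_pow B (1/2) * Y"
    unfolding Y_def using X B by (subst BB[symmetric]) (simp add: assoc_mult_mat[of _ n n _ n _ n])
  ultimately have "B * X = 0\<^sub>m n n" using right_mult_zero_mat[OF psd_pow_carrier[OF B]] by simp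
  moreover have "B * X = B - B * ?E"
    using A unfolding X_def by (subst mult_minus_distrib_mat[of _ n n _ n]) (auto simp: right_mult_one_mat[of _ n n])
  ultimately have e: "B - B * ?E = 0\<^sub>m n n" by simp
  show ?thesis
  proof (rule eq_matI)
    fix i j assume ij: "i < dim_row B" "j < dim_col B"
    then have ij: "i < n" "j < n" using carrier_matD[OF psd_matD(2)[OF B]] by auto
    then have "(B - B * ?E) $$ (i,j) = 0" using e by simp
    moreover have "(B - B * ?E) $$ (i,j) = B $$ (i,j) - (B * ?E) $$ (i,j)"
      using ij carrier_matD[OF square_mult_carrier[OF psd_matD(2)[OF B] Ec]] by (intro index_minus_mat) auto
    ultimately show "(B * ?E) $$ (i,j) = B $$ (i,j)" by simp
  qed (use carrier_matD[OF psd_matD(2)[OF B]] carrier_matD[OF Ec] in auto)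
qed


text \<open>The variable is the exponent. Even for singular \<open>A\<close> there is no jump at
  exponent 0: a zero eigenvalue contributes \<open>0 powr r = 0\<close> for every \<open>r\<close>,
  and \<open>psd_pow A 0\<close> is the support projection.\<close>

lemma continuous_on_qform_pow:
  assumes A: "psd_mat n A" and v: "v \<in> carrier_vec n"
  shows "continuous_on UNIV (\<lambda>r. qform (psd_pow A r) v)"
proof -
  obtain U d where U: "unitary_mat n U" and d: "\<forall>i<n. 0 \<le> d i"
    and AD: "A = udiag n U d"
    using psd_spectral[OF A] by blast
  have "continuous_on UNIV (\<lambda>r. d i powr r)" for i
  proof (cases "d i = 0")
    case False
    then show ?thesis by (intro continuous_intros) auto
  qed simp
  then show ?thesis
    unfolding psd_pow_diag[OF U d AD] qform_diag[OF U v] by (intro continuous_on_sum continuous_on_mult continuous_on_const)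
qed

lemma qform_gram:
  fixes X :: "complex mat"
  assumes X: "X \<in> carrier_mat n n" and v: "v \<in> carrier_vec n"
  shows "qform (mat_adjoint X * X) v = Re ((X *\<^sub>v v) \<bullet>c (X *\<^sub>v v))"
proof -
  have "qform (mat_adjoint X * X) v = Re ((mat_adjoint X *\<^sub>v (X *\<^sub>v v)) \<bullet>c v)"
    using X v by (simp add: qform_def assoc_mult_mat_vec[of _ n n _ n])
  also have "\<dots> = Re ((X *\<^sub>v v) \<bullet>c (X *\<^sub>v v))"
    using X v by (subst cscalar_adjoint[of _ n n]) auto
  finally show ?thesis .
qed

text \<open>If \<open>r\<close> were missing, closedness would give nearest members
  \<open>a < r < b\<close> on the two sides. Their midpoint belongs to \<open>T\<close> and is
  nearer to \<open>r\<close> than one of them on its own side, contradicting the choice of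
  \<open>a\<close> or \<open>b\<close>.\<close>

lemma closed_midpoint_set:
  fixes T :: "real set"
  assumes cl: "closed T" and ends: "0 \<in> T" "1 \<in> T"
    and mid: "\<And>r s. r \<in> T \<Longrightarrow> s \<in> T \<Longrightarrow> (r + s) / 2 \<in> T"
    and r: "0 \<le> r" "r \<le> 1"
  shows "r \<in> T"
proof (rule ccontr)
  assume "r \<notin> T"
  define a where "a = Sup (T \<inter> {0..r})"
  define b where "b = Inf (T \<inter> {r..1})"
  have "T \<inter> {0..r} \<noteq> {}" "T \<inter> {r..1} \<noteq> {}" using ends r by auto
  moreover have bd: "bdd_above (T \<inter> {0..r})" "bdd_below (T \<inter> {r..1})"
    by (auto intro: bdd_aboveI[of _ r] bdd_belowI[of _ r])
  moreover have "closed (T \<inter> {0..r})" "closed (T \<inter> {r..1})" using cl by auto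
  ultimately have "a \<in> T \<inter> {0..r}" "b \<in> T \<inter> {r..1}"
    unfolding a_def b_def using closed_contains_Sup closed_contains_Inf by metis+
  with \<open>r \<notin> T\<close> have ab: "a \<in> T" "b \<in> T" "0 \<le> a" "a < r" "r < b" "b \<le> 1"
    by (auto simp: less_le)
  let ?m = "(a + b) / 2"
  have m: "?m \<in> T" using mid ab by blast
  show False
  proof (cases "?m \<le> r")
    case True
    then have "?m \<in> T \<inter> {0..r}" using m ab r by auto
    from cSup_upper[OF this bd(1)] have "?m \<le> a" unfolding a_def[symmetric] .
    then show False using ab by simp
  next
    case False
    then have "?m \<in> T \<inter> {r..1}" using m ab r by auto
    from cInf_lower[OF this bd(2)] have "b \<le> ?m" unfolding b_def[symmetric] .
    then show False using ab by simp
  qed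
qed

text \<open>If the largest eigenvalue \<open>\<mu>\<close> of \<open>N = A\<^sup>-\<^sup>m\<^sup>/\<^sup>2 B\<^sup>m A\<^sup>-\<^sup>m\<^sup>/\<^sup>2\<close> (with \<open>m\<close> the midpoint) exceeded \<open>1\<close>,
  it would also be an eigenvalue of the product of the contractions \<open>A\<^sup>-\<^sup>r\<^sup>/\<^sup>2 B\<^sup>r\<^sup>/\<^sup>2\<close> and
  \<open>B\<^sup>s\<^sup>/\<^sup>2 A\<^sup>-\<^sup>s\<^sup>/\<^sup>2\<close>.\<close>

lemma loewner_pow_midpoint:
  assumes A: "psd_mat n A" and B: "psd_mat n B" and supp: "B * psd_pow A 0 = B"
    and r: "loewner_le n (psd_pow B r) (psd_pow A r)"
    and s: "loewner_le n (psd_pow B s) (psd_pow A s)"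
  shows "loewner_le n (psd_pow B ((r + s) / 2)) (psd_pow A ((r + s) / 2))"
proof -
  define m where "m = (r + s) / 2"
  note [simp] = A B
  note assoc = assoc_mult_mat[of _ n n _ n _ n]
  note adj = adjoint_mult[of _ n n _ n] psd_pow_adjoint[of n]
  note pow = psd_pow_mult[of n] psd_pow_mult_left[of n]
  note supps = supp_pow[OF A B supp]
  have contr: "loewner_le n (psd_pow A (- t / 2) * psd_pow B t * psd_pow A (- t / 2)) (1 \<cdot>\<^sub>r 1\<^sub>m n)"
    if "loewner_le n (psd_pow B t) (psd_pow A t)" for t
  proof -
    have "loewner_le n (psd_pow A (- t / 2) * psd_pow B t * psd_pow A (- t / 2))
       (psd_pow A (- t / 2) * psd_pow A t * psd_pow A (- t / 2))"
      by (rule loewner_conj_pow[OF that A])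
    also have "psd_pow A (- t / 2) * psd_pow A t * psd_pow A (- t / 2) = psd_pow A 0"
      by (simp add: pow)
    also have "loewner_le n (psd_pow A 0) (1\<^sub>m n)" by (rule supp_le_one[OF A])
    finally show ?thesis by simp
  qed
  define Y where "Y = psd_pow A (- r / 2) * psd_pow B (r / 2)"
  define Y' where "Y' = psd_pow B (s / 2) * psd_pow A (- s / 2)"
  have Yc [simp]: "Y \<in> carrier_mat n n" "Y' \<in> carrier_mat n n" by (simp_all add: Y_def Y'_def)
  have "Y * mat_adjoint Y = psd_pow A (- r / 2) * psd_pow B r * psd_pow A (- r / 2)"
    by (simp add: Y_def adj assoc pow)
  \<comment> \<open>The swap is needed because the length of \<open>Y x\<close> is governed by
    \<open>mat_adjoint Y * Y\<close>, while the hypothesis bounds the other product.\<close>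
  then have "loewner_le n (mat_adjoint Y * Y) (1 \<cdot>\<^sub>r 1\<^sub>m n)"
    using contr[OF r] by (intro loewner_gram_swap) simp_all
  then have Yle: "Re ((Y *\<^sub>v x) \<bullet>c (Y *\<^sub>v x)) \<le> Re (x \<bullet>c x)" if "x \<in> carrier_vec n" for x
    using that by (simp add: loewner_le_iff qform_gram[of _ n] qform_one)
  have "mat_adjoint Y' * Y' = psd_pow A (- s / 2) * psd_pow B s * psd_pow A (- s / 2)"
    by (simp add: Y'_def adj assoc pow)
  then have "loewner_le n (mat_adjoint Y' * Y') (1 \<cdot>\<^sub>r 1\<^sub>m n)"
    using contr[OF s] by simp
  then have Y'le: "Re ((Y' *\<^sub>v x) \<bullet>c (Y' *\<^sub>v x)) \<le> Re (x \<bullet>c x)" if "x \<in> carrier_vec n" for x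
    using that by (simp add: loewner_le_iff qform_gram[of _ n] qform_one)
  define N where "N = psd_pow A (- m / 2) * psd_pow B m * psd_pow A (- m / 2)"
  have N: "psd_mat n N" by (simp add: N_def)
  note [simp] = psd_matD(2)[OF N]
  obtain U \<mu> where U: "unitary_mat n U" and \<mu>: "\<forall>i<n. 0 \<le> \<mu> i"
    and NU: "N = udiag n U \<mu>"
    using psd_spectral[OF N] by blast
  note U' = unitary_matD[OF U]
  \<comment> \<open>\<open>Y * Y'\<close> is \<open>A^(-r/2) B^m A^(-s/2)\<close>. The exponent
    (s-r)/4 balances both outer powers to -m/2, so \<open>S\<close> carries eigenvectors of
    \<open>N\<close> to eigenvectors of \<open>Y * Y'\<close> as long as they are not
    annihilated.\<close>
  define S where "S = psd_pow A ((s - r) / 4)"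
  have Sc [simp]: "S \<in> carrier_mat n n" by (simp add: S_def)
  have YYS: "Y * (Y' * S) = S * N"
  proof -
    have e: "(s - r) / 4 - s / 2 = - (m / 2)" "r / 2 + s / 2 = m" "(s - r) / 4 - m / 2 = - (r / 2)"
      by (simp_all add: m_def field_simps)
    show ?thesis by (simp add: Y_def Y'_def S_def N_def assoc pow e)
  qed
  \<comment> \<open>\<open>S\<close> may be singular, so \<open>S v\<close> could vanish for an
    eigenvector \<open>v\<close>. Recovering \<open>N\<close> from \<open>S * N\<close> by the
    opposite power excludes this when the eigenvalue is nonzero.\<close>
  have SS: "psd_pow A (- (s - r) / 4) * (S * N) = N"
  proof -
    have e: "(r - s) / 4 + ((s - r) / 4 - m / 2) = - (m / 2)" by (simp add: field_simps)
    show ?thesis by (simp add: S_def N_def assoc pow e)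
  qed
  have "\<mu> i \<le> 1" if i: "i < n" for i
  proof (rule ccontr)
    assume "\<not> \<mu> i \<le> 1"
    then have gt: "\<mu> i > 1" by simp
    define v where "v = col U i"
    have v: "v \<in> carrier_vec n" using U' i by (simp add: v_def)
    have Nv: "N *\<^sub>v v = complex_of_real (\<mu> i) \<cdot>\<^sub>v v"
    proof -
      have "N * U = U * mat_diag n (\<lambda>i. complex_of_real (\<mu> i))"
        using U' by (simp add: NU assoc right_mult_one_mat[of _ n n])
      then have "N *\<^sub>v v = col (U * mat_diag n (\<lambda>i. complex_of_real (\<mu> i))) i"
        using U' i unfolding v_def by (subst col_mult2[of _ n n _ n, symmetric]) auto
      also have "\<dots> = complex_of_real (\<mu> i) \<cdot>\<^sub>v v"
        unfolding mat_diag_mult_right[OF U'(1)] using U' i by (intro eq_vecI) (auto simp: v_def)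
      finally show ?thesis .
    qed
    define w where "w = S *\<^sub>v v"
    have w: "w \<in> carrier_vec n" using v by (simp add: w_def)
    have "Y *\<^sub>v (Y' *\<^sub>v w) = (Y * (Y' * S)) *\<^sub>v v"
      using v by (simp add: w_def assoc_mult_mat_vec[of _ n n _ n])
    also have "\<dots> = S *\<^sub>v (N *\<^sub>v v)" unfolding YYS using v by (simp add: assoc_mult_mat_vec[of _ n n _ n])
    also have "\<dots> = complex_of_real (\<mu> i) \<cdot>\<^sub>v w" using v by (simp add: Nv w_def mult_mat_vec[of _ n n])
    finally have e: "Y *\<^sub>v (Y' *\<^sub>v w) = complex_of_real (\<mu> i) \<cdot>\<^sub>v w" .
    have "Re ((complex_of_real (\<mu> i) \<cdot>\<^sub>v w) \<bullet>c (complex_of_real (\<mu> i) \<cdot>\<^sub>v w)) \<le> Re (w \<bullet>c w)"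
      unfolding e[symmetric] using Yle[of "Y' *\<^sub>v w"] Y'le[OF w] w by simp
    then have le: "(\<mu> i)\<^sup>2 * Re (w \<bullet>c w) \<le> Re (w \<bullet>c w)"
      using w by (simp add: conjugate_smult_vec power2_eq_square mult.assoc)
    have "w = 0\<^sub>v n"
    proof (rule ccontr)
      assume "w \<noteq> 0\<^sub>v n"
      from csquare_pos(1)[OF w this] le have "(\<mu> i)\<^sup>2 \<le> 1" by simp
      with gt show False by (simp add: power2_le_iff_abs_le abs_square_le_1)
    qed
    then have "(S * N) *\<^sub>v v = 0\<^sub>v n"
      using v by (simp add: w_def Nv assoc_mult_mat_vec[of _ n n _ n] mult_mat_vec[of _ n n])
    then have "N *\<^sub>v v = 0\<^sub>v n"
      using v by (subst SS[symmetric]) (simp add: assoc_mult_mat_vec[of _ n n _ n])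
    then have "complex_of_real (\<mu> i) \<cdot>\<^sub>v v = 0\<^sub>v n" using Nv by simp
    moreover have "qform (1\<^sub>m n) (complex_of_real (\<mu> i) \<cdot>\<^sub>v v) = (\<mu> i)\<^sup>2 * qform (1\<^sub>m n) v"
      using v by (simp add: qform_one conjugate_smult_vec power2_eq_square mult.assoc)
    ultimately have "(\<mu> i)\<^sup>2 * qform (1\<^sub>m n) v = 0"
      by (simp add: qform_one)
    moreover have "qform (1\<^sub>m n) v = 1"
      using qform_diag_col[OF U i, of "\<lambda>_. 1"] one_eq_diag[OF U, of 1] by (simp add: v_def)
    ultimately show False using gt by simp
  qed
  then have "loewner_le n N (1 \<cdot>\<^sub>r 1\<^sub>m n)"
    unfolding NU loewner_diag_scalar_iff[OF U] by blast
  then have "loewner_le n (psd_pow A (m / 2) * N * psd_pow A (m / 2))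
     (psd_pow A (m / 2) * 1\<^sub>m n * psd_pow A (m / 2))"
    using loewner_conj_pow[of n N "1\<^sub>m n" A "m / 2"] by simp
  moreover have "psd_pow A (m / 2) * N * psd_pow A (m / 2) = psd_pow B m"
    by (simp add: N_def assoc pow supps)
  moreover have "psd_pow A (m / 2) * 1\<^sub>m n * psd_pow A (m / 2) = psd_pow A m"
    by (simp add: pow right_mult_one_mat[of _ n n])
  ultimately show ?thesis by (simp add: m_def)
qed

text \<open>The exponents for which the inequality holds form a closed set that contains 0 and 1 and
  is stable under midpoints. At 0 the inequality compares the support projections, which
  \<open>loewner_supp\<close> puts in order.\<close>

theorem loewner_heinz:
  assumes A: "psd_mat n A" and B: "psd_mat n B" and le: "loewner_le n B A"
    and r: "0 \<le> r" "r \<le> 1"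
  shows "loewner_le n (psd_pow B r) (psd_pow A r)"
proof -
  have supp: "B * psd_pow A 0 = B" by (rule loewner_supp[OF A B le])
  let ?T = "{r. \<forall>v\<in>carrier_vec n. qform (psd_pow B r) v \<le> qform (psd_pow A r) v}"
  have iff: "loewner_le n (psd_pow B t) (psd_pow A t) \<longleftrightarrow> t \<in> ?T" for t
    using psd_matD(1)[OF psd_pow_psd[OF A]] psd_matD(1)[OF psd_pow_psd[OF B]] by (simp add: loewner_le_iff)
  have "?T = (\<Inter>v\<in>carrier_vec n. {r. qform (psd_pow B r) v \<le> qform (psd_pow A r) v})" by auto
  moreover have "closed \<dots>"
    using continuous_on_qform_pow[OF A] continuous_on_qform_pow[OF B] by (intro closed_INT ballI closed_Collect_le) auto
  ultimately have "closed ?T" by simp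
  moreover have "0 \<in> ?T"
  proof -
    have "loewner_le n (psd_pow A 0 * psd_pow B 0 * psd_pow A 0) (psd_pow A 0 * 1\<^sub>m n * psd_pow A 0)"
      by (rule loewner_conj_pow[OF supp_le_one[OF B] A])
    then have "loewner_le n (psd_pow B 0) (psd_pow A 0)"
      using A B by (simp add: supp_pow[OF A B supp] psd_pow_mult right_mult_one_mat[of _ n n])
    then show ?thesis using iff by blast
  qed
  moreover have "1 \<in> ?T" using le A B iff[of 1] by (simp add: psd_pow_1)
  moreover have "(a + b) / 2 \<in> ?T" if "a \<in> ?T" "b \<in> ?T" for a b
    using loewner_pow_midpoint[OF A B supp] that iff by blast
  ultimately have "r \<in> ?T" using r by (intro closed_midpoint_set[of ?T r])
  then show ?thesis using iff by blast
qed

subsection \<open>Inequalities between the two means\<close>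

lemma psd_pow_smult:
  assumes A: "psd_mat n A" and c: "0 \<le> c"
  shows "psd_pow (c \<cdot>\<^sub>r A) r = (c powr r) \<cdot>\<^sub>r psd_pow A r"
proof -
  obtain U d where U: "unitary_mat n U" and d: "\<forall>i<n. 0 \<le> d i"
    and AD: "A = udiag n U d"
    using psd_spectral[OF A] by blast
  have cA: "c \<cdot>\<^sub>r A = udiag n U (\<lambda>i. c * d i)"
    unfolding AD diag_conj_smult[OF U] ..
  have cd: "\<forall>i<n. 0 \<le> c * d i" using c d by simp
  show ?thesis
    unfolding psd_pow_diag[OF U cd cA] psd_pow_diag[OF U d AD] diag_conj_smult[OF U]
    by (rule diag_conj_cong) (use c d in \<open>simp add: powr_mult\<close>)
qed

lemma loewner_heinz_scaled:
  assumes A: "psd_mat n A" and B: "psd_mat n B" and le: "loewner_le n B (c \<cdot>\<^sub>r A)"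
    and c: "0 \<le> c" and r: "0 \<le> r" "r \<le> 1"
  shows "loewner_le n (psd_pow B r) ((c powr r) \<cdot>\<^sub>r psd_pow A r)"
  using loewner_heinz[OF psd_smult[OF A c] B le r] psd_pow_smult[OF A c] by simp

lemma loewner_conj_pow_scaled:
  assumes "loewner_le n A (c \<cdot>\<^sub>r psd_pow C s)" "psd_mat n C"
  shows "loewner_le n (psd_pow C r * A * psd_pow C r) (c \<cdot>\<^sub>r psd_pow C (s + 2 * r))"
proof -
  have "psd_pow C r * (c \<cdot>\<^sub>r psd_pow C s) * psd_pow C r = c \<cdot>\<^sub>r psd_pow C (s + 2 * r)"
    using assms(2) by (simp add: mult_smult_distrib[of _ n n _ n] mult_smult_assoc_mat[of _ n n _ n]
        psd_pow_mult[of n] algebra_simps)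
  then show ?thesis using loewner_conj_pow[OF assms(1,2), of r] by simp
qed

text \<open>With \<open>X = M^(-1/2) T^(1/2)\<close> the two sides bound
  \<open>X * mat_adjoint X\<close> and \<open>mat_adjoint X * X\<close>, which
  \<open>loewner_gram_swap\<close> exchanges. The support condition gives
  \<open>M^(1/2) M^(-1/2) T = T\<close>, by which \<open>T\<close> is recovered from
  \<open>X\<close>. It plays the part of order reversal under inversion for matrices that may be
  singular.\<close>

lemma loewner_dual:
  assumes T: "psd_mat n T" and M: "psd_mat n M" and supp: "T * psd_pow M 0 = T" and c: "0 \<le> c"
  shows "loewner_le n T (c \<cdot>\<^sub>r M) \<longleftrightarrow>
    loewner_le n (psd_pow T (1/2) * psd_pow M (-1) * psd_pow T (1/2)) (c \<cdot>\<^sub>r 1\<^sub>m n)"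
proof -
  note [simp] = T M psd_matD(2)[OF T] psd_matD(2)[OF M]
  note assoc = assoc_mult_mat[of _ n n _ n _ n]
  note adj = adjoint_mult[of _ n n _ n] psd_pow_adjoint[of n]
  note pow = psd_pow_mult[of n] psd_pow_mult_left[of n]
  have TT: "psd_pow T (1/2) * psd_pow T (1/2) = T"
    using psd_pow_mult[OF T, of "1/2" "1/2"] psd_pow_1[OF T] by simp
  have TT': "psd_pow T (1/2) * (psd_pow T (1/2) * X) = T * X" if "X \<in> carrier_mat n n" for X
    using that TT by (simp add: assoc[symmetric] del: assoc_mult_mat)
  define X where "X = psd_pow M (-1/2) * psd_pow T (1/2)"
  have X: "X \<in> carrier_mat n n" by (simp add: X_def)
  have XX: "X * mat_adjoint X = psd_pow M (-1/2) * T * psd_pow M (-1/2)"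
    by (simp add: X_def adj assoc TT')
  have XX': "mat_adjoint X * X = psd_pow T (1/2) * psd_pow M (-1) * psd_pow T (1/2)"
    by (simp add: X_def adj assoc pow)
  have supp': "psd_pow M 0 * T = T"
    using supp_pow(2)[OF M T supp, of 1] by (simp add: psd_pow_1[OF T])
  have "loewner_le n (X * mat_adjoint X) (c \<cdot>\<^sub>r 1\<^sub>m n)"
    if "loewner_le n T (c \<cdot>\<^sub>r M)"
  proof -
    have "loewner_le n (psd_pow M (-1/2) * T * psd_pow M (-1/2)) (c \<cdot>\<^sub>r psd_pow M (1 + 2 * (-1/2)))"
      by (rule loewner_conj_pow_scaled) (use that in \<open>simp_all add: psd_pow_1[OF M]\<close>)
    also have "loewner_le n (c \<cdot>\<^sub>r psd_pow M (1 + 2 * (-1/2))) (c \<cdot>\<^sub>r 1\<^sub>m n)"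
      using loewner_smult[OF supp_le_one[OF M] c] by simp
    finally show ?thesis unfolding XX .
  qed
  moreover have "loewner_le n T (c \<cdot>\<^sub>r M)"
    if "loewner_le n (X * mat_adjoint X) (c \<cdot>\<^sub>r 1\<^sub>m n)"
  proof -
    have "loewner_le n (psd_pow M (1/2) * (X * mat_adjoint X) * psd_pow M (1/2))
        (psd_pow M (1/2) * (c \<cdot>\<^sub>r 1\<^sub>m n) * psd_pow M (1/2))"
      by (rule loewner_conj_pow[OF that M])
    moreover have "psd_pow M (1/2) * (X * mat_adjoint X) * psd_pow M (1/2) = T"
      unfolding XX by (simp add: assoc pow supp supp')
    moreover have "psd_pow M (1/2) * (c \<cdot>\<^sub>r 1\<^sub>m n) * psd_pow M (1/2) = c \<cdot>\<^sub>r M"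
      by (simp add: mult_smult_distrib[of _ n n _ n] mult_smult_assoc_mat[of _ n n _ n] pow
          right_mult_one_mat[of _ n n] psd_pow_1[OF M])
    ultimately show ?thesis by simp
  qed
  moreover have "loewner_le n (X * mat_adjoint X) (c \<cdot>\<^sub>r 1\<^sub>m n) \<longleftrightarrow>
      loewner_le n (mat_adjoint X * X) (c \<cdot>\<^sub>r 1\<^sub>m n)"
    using loewner_gram_swap[OF X c] loewner_gram_swap[of "mat_adjoint X" n, OF _ c] X by auto
  ultimately show ?thesis unfolding XX' by blast
qed

text \<open>\<open>X\<close> intertwines \<open>X * mat_adjoint X\<close> with
  \<open>mat_adjoint X * X\<close>, hence also their powers; one further factor
  \<open>X * mat_adjoint X\<close> raises the exponent by 1. This shift leads out of the range [0,1]
  of Loewner-Heinz.\<close>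

lemma psd_pow_gram:
  assumes X: "X \<in> carrier_mat n n"
  shows "psd_pow (X * mat_adjoint X) (b + 1) = X * psd_pow (mat_adjoint X * X) b * mat_adjoint X"
proof -
  have M: "psd_mat n (X * mat_adjoint X)" and N: "psd_mat n (mat_adjoint X * X)"
    using psd_gram[OF X] psd_gram[of "mat_adjoint X" n] X by simp_all
  have "X * psd_pow (mat_adjoint X * X) b = psd_pow (X * mat_adjoint X) b * X"
    by (rule psd_pow_intertwine[OF M N X, symmetric]) (use X in \<open>simp add: assoc_mult_mat[of _ n n _ n _ n]\<close>)
  then have "X * psd_pow (mat_adjoint X * X) b * mat_adjoint X =
      psd_pow (X * mat_adjoint X) b * psd_pow (X * mat_adjoint X) 1"
    using X M by (simp add: assoc_mult_mat[of _ n n _ n _ n] psd_pow_1[OF M])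
  then show ?thesis by (simp add: psd_pow_mult[OF M])
qed

text \<open>With \<open>X = C\<^sup>-\<^sup>1\<^sup>/\<^sup>2 K\<^sup>1\<^sup>/\<^sup>2\<close>, \<open>V = X X\<^sup>*\<close> and \<open>W = X\<^sup>* X\<close>, the bounds
  \<open>V\<^sup>x \<le> C\<^sup>-\<^sup>x\<^sup>/\<^sup>g\<close> and \<open>W\<^sup>x \<le> K\<^sup>-\<^sup>x\<^sup>/\<^sup>(\<^sup>g\<^sup>-\<^sup>1\<^sup>)\<close> follow for \<open>x \<le> 1\<close> from the Loewner-Heinz inequality, and
  \<open>V\<^sup>x = X W\<^sup>x\<^sup>-\<^sup>1 X\<^sup>*\<close>, \<open>W\<^sup>x = X\<^sup>* V\<^sup>x\<^sup>-\<^sup>1 X\<close> carry them from \<open>x - 1\<close> to \<open>x\<close>. All auxiliary exponents of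
  \<open>K\<close> stay in \<open>[0, 2]\<close>, where the hypothesis controls them.\<close>

lemma furuta_type:
  fixes g :: real
  assumes C: "psd_mat n C" and K: "psd_mat n K" and g: "2 \<le> g"
    and le: "loewner_le n (psd_pow K 2) (psd_pow C (2 * (g - 1) / g))"
  shows "loewner_le n (psd_pow (psd_pow C (-1/2) * K * psd_pow C (-1/2)) g) (psd_pow C (-1))"
proof -
  note [simp] = C K psd_matD(2)[OF C] psd_matD(2)[OF K]
  note assoc = assoc_mult_mat[of _ n n _ n _ n]
  note adj = adjoint_mult[of _ n n _ n] psd_pow_adjoint[of n]
  note pow = psd_pow_mult[of n] psd_pow_mult_left[of n]
  have supp2: "psd_pow K 2 * psd_pow C 0 = psd_pow K 2"
    using loewner_supp[OF _ _ le] by (simp add: psd_pow_pow[OF C])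
  have suppK: "psd_pow K r * psd_pow C 0 = psd_pow K r" "psd_pow C 0 * psd_pow K r = psd_pow K r" for r
    using supp_pow[OF C _ supp2, of "r / 2"] by (simp_all add: psd_pow_pow[OF K])
  have star: "loewner_le n (psd_pow K y) (psd_pow C (y * (g - 1) / g))" if "0 \<le> y" "y \<le> 2" for y
  proof -
    have e: "2 * (g - 1) / g * (y / 2) = y * (g - 1) / g" "2 * (y / 2) = y" using g by (simp_all add: field_simps)
    have "loewner_le n (psd_pow (psd_pow K 2) (y / 2)) (psd_pow (psd_pow C (2 * (g - 1) / g)) (y / 2))"
      using that by (intro loewner_heinz[OF _ _ le]) auto
    then show ?thesis by (simp only: psd_pow_pow[OF K] psd_pow_pow[OF C] e)
  qed
  \<comment> \<open>The inverse form of \<open>star\<close>: \<open>loewner_dual\<close> bounds the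
    negative power of \<open>C\<close> between two factors \<open>K^(y/2)\<close>, and conjugation
    by \<open>K^(z - y/2)\<close> adjusts the outer exponents.\<close>
  have star2: "loewner_le n (psd_pow K z * psd_pow C (- (y * (g - 1) / g)) * psd_pow K z) (psd_pow K (2 * z - y))"
    if "0 \<le> y" "y \<le> 2" for y z
  proof -
    have "loewner_le n (psd_pow K (y / 2) * psd_pow C (- (y * (g - 1) / g)) * psd_pow K (y / 2)) (1\<^sub>m n)"
      using loewner_dual[of n "psd_pow K y" "psd_pow C (y * (g - 1) / g)" 1] star[OF that]
      by (simp add: psd_pow_pow[of n] suppK)
    from loewner_conj_pow[OF this K, of "z - y / 2"]
    show ?thesis by (simp add: assoc pow left_mult_one_mat[of _ n n] right_mult_one_mat[of _ n n])
  qed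
  define X where "X = psd_pow C (-1/2) * psd_pow K (1/2)"
  define V where "V = X * mat_adjoint X"
  define W where "W = mat_adjoint X * X"
  have X [simp]: "X \<in> carrier_mat n n" by (simp add: X_def)
  have Xa: "mat_adjoint X = psd_pow K (1/2) * psd_pow C (-1/2)" by (simp add: X_def adj)
  have V [simp]: "psd_mat n V" and W [simp]: "psd_mat n W"
    using psd_gram[OF X] psd_gram[of "mat_adjoint X" n] by (simp_all add: V_def W_def)
  have K1: "psd_pow K (1/2) * psd_pow K (1/2) = K"
    using psd_pow_mult[OF K, of "1/2" "1/2"] psd_pow_1[OF K] by simp
  have K1': "psd_pow K (1/2) * (psd_pow K (1/2) * Y) = K * Y" if "Y \<in> carrier_mat n n" for Y
    using that K1 by (simp add: assoc[symmetric] del: assoc_mult_mat)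
  have VV: "V = psd_pow C (-1/2) * K * psd_pow C (-1/2)"
    by (simp add: V_def Xa) (simp add: X_def assoc K1')
  have WW: "W = psd_pow K (1/2) * psd_pow C (-1) * psd_pow K (1/2)"
    by (simp add: W_def Xa) (simp add: X_def assoc pow)
  have XKX: "X * psd_pow K t * mat_adjoint X = psd_pow C (-1/2) * psd_pow K (1 + t) * psd_pow C (-1/2)" for t
  proof -
    have e: "1/2 + t + 1/2 = 1 + t" by simp
    show ?thesis unfolding Xa unfolding X_def by (simp only: assoc psd_pow_carrier C K square_mult_carrier pow e)
  qed
  have XCX: "mat_adjoint X * psd_pow C t * X = psd_pow K (1/2) * psd_pow C (- 1 + t) * psd_pow K (1/2)" for t
  proof -
    have e: "- 1/2 + t + - 1/2 = - 1 + t" by simp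
    show ?thesis unfolding Xa unfolding X_def by (simp only: assoc psd_pow_carrier C K square_mult_carrier pow e)
  qed
  have Vstep: "psd_pow V x = X * psd_pow W (x - 1) * mat_adjoint X" for x
    using psd_pow_gram[OF X, of "x - 1"] by (simp add: V_def W_def)
  have Wstep: "psd_pow W x = mat_adjoint X * psd_pow V (x - 1) * X" for x
    using psd_pow_gram[of "mat_adjoint X" n "x - 1"] by (simp add: V_def W_def)
  have Vup: "loewner_le n (psd_pow V x) (psd_pow C (- x / g))"
    if "0 \<le> x" "x \<le> g" "loewner_le n (psd_pow W (x - 1)) (psd_pow K (- (x - 1) / (g - 1)))" for x
  proof -
    \<comment> \<open>Conjugating \<open>K^(-(x-1)/(g-1))\<close> by \<open>X\<close> leaves the
      inner power \<open>K^y\<close>. For 0 \<le> x \<le> g the exponent lies between 0 and g/(g-1),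
      which is at most 2 because g \<ge> 2.\<close>
    define y where "y = (g - x) / (g - 1)"
    have y: "0 \<le> y" "y \<le> 2" using g that by (auto simp: y_def field_simps)
    have ey: "1 + - (x - 1) / (g - 1) = y" "y * (g - 1) / g - 1 = - x / g" using g by (auto simp: y_def field_simps)
    have "loewner_le n (psd_pow V x) (X * psd_pow K (- (x - 1) / (g - 1)) * mat_adjoint X)"
      unfolding Vstep by (rule loewner_conj[OF that(3) X])
    also have "X * psd_pow K (- (x - 1) / (g - 1)) * mat_adjoint X =
        psd_pow C (-1/2) * psd_pow K (1 + - (x - 1) / (g - 1)) * psd_pow C (-1/2)"
      by (rule XKX)
    also have "\<dots> = psd_pow C (-1/2) * psd_pow K y * psd_pow C (-1/2)" by (simp only: ey)
    also have "loewner_le n \<dots> (psd_pow C (-1/2) * psd_pow C (y * (g - 1) / g) * psd_pow C (-1/2))"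
      by (rule loewner_conj_pow[OF star[OF y] C])
    also have "psd_pow C (-1/2) * psd_pow C (y * (g - 1) / g) * psd_pow C (-1/2) = psd_pow C (y * (g - 1) / g - 1)"
      by (simp add: assoc pow)
    finally show ?thesis by (simp only: ey)
  qed
  have Wup: "loewner_le n (psd_pow W x) (psd_pow K (- x / (g - 1)))"
    if "0 \<le> x" "x \<le> g - 1" "loewner_le n (psd_pow V (x - 1)) (psd_pow C (- (x - 1) / g))" for x
  proof -
    \<comment> \<open>Here \<open>y \<le> 2\<close> means exactly \<open>x \<le> g - 1\<close>, so
      this shift reaches only g - 1 for \<open>W\<close>, one less than for
      \<open>V\<close>.\<close>
    define y where "y = (g + x - 1) / (g - 1)"
    have y: "0 \<le> y" "y \<le> 2" using g that by (auto simp: y_def field_simps)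
    have ey: "- 1 + - (x - 1) / g = - (y * (g - 1) / g)" "2 * (1 / 2) - y = - x / (g - 1)"
      using g by (auto simp: y_def field_simps)
    have "loewner_le n (psd_pow W x) (mat_adjoint X * psd_pow C (- (x - 1) / g) * X)"
      unfolding Wstep using loewner_conj[OF that(3), of "mat_adjoint X"] by simp
    also have "mat_adjoint X * psd_pow C (- (x - 1) / g) * X =
        psd_pow K (1/2) * psd_pow C (- 1 + - (x - 1) / g) * psd_pow K (1/2)"
      by (rule XCX)
    also have "\<dots> = psd_pow K (1/2) * psd_pow C (- (y * (g - 1) / g)) * psd_pow K (1/2)" by (simp only: ey)
    also have "loewner_le n \<dots> (psd_pow K (2 * (1/2) - y))"
      by (rule star2[OF y])
    finally show ?thesis by (simp only: ey)
  qed
  have V1: "loewner_le n (psd_pow V 1) (psd_pow C (- 1 / g))"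
  proof -
    have "loewner_le n V (psd_pow C (-1/2) * psd_pow C (1 * (g - 1) / g) * psd_pow C (-1/2))"
      using loewner_conj_pow[OF star[of 1] C, of "-1/2"] by (simp add: VV psd_pow_1[OF K])
    also have "psd_pow C (-1/2) * psd_pow C (1 * (g - 1) / g) * psd_pow C (-1/2) = psd_pow C ((g - 1) / g - 1)"
      by (simp add: assoc pow)
    also have "(g - 1) / g - 1 = - 1 / g" using g by (simp add: field_simps)
    finally show ?thesis by (simp add: psd_pow_1[OF V])
  qed
  have W1: "loewner_le n (psd_pow W 1) (psd_pow K (- 1 / (g - 1)))"
  proof -
    define y where "y = g / (g - 1)"
    have y: "0 \<le> y" "y \<le> 2" using g by (auto simp: y_def field_simps)
    have ey: "y * (g - 1) / g = 1" "1 - y = - 1 / (g - 1)" using g by (auto simp: y_def field_simps)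
    show ?thesis using star2[OF y, of "1/2"] by (simp add: ey WW[symmetric] psd_pow_1[OF W])
  qed
  have both: "loewner_le n (psd_pow V x) (psd_pow C (- x / g)) \<and>
      loewner_le n (psd_pow W x) (psd_pow K (- x / (g - 1)))"
    if "0 \<le> x" "x \<le> g - 1" "x \<le> real m + 1" for x m
    using that
  proof (induction m arbitrary: x)
    case 0
    then show ?case
      using loewner_heinz[OF _ _ V1, of x] loewner_heinz[OF _ _ W1, of x]
      by (simp add: psd_pow_pow[of n])
  next
    case (Suc m)
    show ?case
    proof (cases "x \<le> 1")
      case True
      then show ?thesis
        using loewner_heinz[OF _ _ V1, of x] loewner_heinz[OF _ _ W1, of x] Suc.prems
        by (simp add: psd_pow_pow[of n])
    next
      case False
      have "loewner_le n (psd_pow V (x - 1)) (psd_pow C (- (x - 1) / g)) \<and>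
          loewner_le n (psd_pow W (x - 1)) (psd_pow K (- (x - 1) / (g - 1)))"
        using Suc.prems False by (intro Suc.IH) auto
      then show ?thesis using Vup[of x] Wup[of x] Suc.prems by simp
    qed
  qed
  obtain m where "g - 1 \<le> real m" using real_arch_simple by blast
  \<comment> \<open>One shift is taken outside the joint induction, whose range ends at g - 1
    because of \<open>W\<close>: \<open>Vup\<close> at \<open>x = g\<close> turns this bound into
    \<open>V^g \<le> C^(-1)\<close>.\<close>
  then have "loewner_le n (psd_pow W (g - 1)) (psd_pow K (- (g - 1) / (g - 1)))"
    using both[of "g - 1" m] g by simp
  from Vup[OF _ _ this] g show ?thesis by (simp add: VV)
qed

section \<open>The two means and their cores\<close>

definition sandwich :: "real \<Rightarrow> complex mat \<Rightarrow> complex mat \<Rightarrow> complex mat" where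
  "sandwich p A B = psd_pow A (p/2) * psd_pow B p * psd_pow A (p/2)"

text \<open>The mean before its outer power 1/p. \<open>G\<close> is the geometric mean of
  \<open>A^(-p)\<close> and \<open>B^p\<close>, written out with
  \<open>(A^(-p))^(-1/2) = A^(p/2)\<close>. The outer power is monotone on eigenvalues and returns
  only in \<open>log_maj_psd_pow\<close>.\<close>

definition SG_core :: "real \<Rightarrow> real \<Rightarrow> complex mat \<Rightarrow> complex mat \<Rightarrow> complex mat" where
  "SG_core \<alpha> p A B =
     (let G = psd_pow A (-p/2) * psd_pow (sandwich p A B) (1/2) * psd_pow A (-p/2)
      in psd_pow G \<alpha> * psd_pow A p * psd_pow G \<alpha>)"

definition SG_tilde_core :: "real \<Rightarrow> real \<Rightarrow> complex mat \<Rightarrow> complex mat \<Rightarrow> complex mat" where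
  "SG_tilde_core \<alpha> p A B =
     (let G = psd_pow A (-p/2) * psd_pow (sandwich p A B) \<alpha> * psd_pow A (-p/2)
      in psd_pow G (1/2) * psd_pow A (2 * (1 - \<alpha>) * p) * psd_pow G (1/2))"

lemma geom_mean_eq:
  assumes "psd_mat n A"
  shows "geom_mean a (psd_pow A (-p)) (psd_pow B p) =
    psd_pow A (-p/2) * psd_pow (sandwich p A B) a * psd_pow A (-p/2)"
  by (simp add: geom_mean_def sandwich_def psd_pow_pow[OF assms])

lemma SG_eq: "psd_mat n A \<Longrightarrow> SG \<alpha> p A B = psd_pow (SG_core \<alpha> p A B) (1/p)"
  by (simp add: SG_def SG_core_def geom_mean_eq Let_def)

lemma SG_tilde_eq: "psd_mat n A \<Longrightarrow> SG_tilde \<alpha> p A B = psd_pow (SG_tilde_core \<alpha> p A B) (1/p)"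
  by (simp add: SG_tilde_def SG_tilde_core_def geom_mean_eq Let_def)

lemma sandwich_psd [simp]: "psd_mat n A \<Longrightarrow> psd_mat n B \<Longrightarrow> psd_mat n (sandwich p A B)"
  by (simp add: sandwich_def)

lemma SG_core_psd: "psd_mat n A \<Longrightarrow> psd_mat n B \<Longrightarrow> psd_mat n (SG_core \<alpha> p A B)"
  by (simp add: SG_core_def Let_def)

lemma SG_tilde_core_psd: "psd_mat n A \<Longrightarrow> psd_mat n B \<Longrightarrow> psd_mat n (SG_tilde_core \<alpha> p A B)"
  by (simp add: SG_tilde_core_def Let_def)

lemma mult_supp:
  assumes "psd_mat n A" "X \<in> carrier_mat n n"
  shows "X * psd_pow A r * psd_pow A 0 = X * psd_pow A r"
  using assms by (simp add: assoc_mult_mat[of _ n n _ n _ n] psd_pow_mult[of n])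

text \<open>An instance of \<open>loewner_dual\<close> with \<open>T = G^(2\<alpha>)\<close> and
  \<open>M = A^(-p)\<close>, since \<open>SG_core\<close> is \<open>T^(1/2) M^(-1) T^(1/2)\<close>.
  The outer factors of \<open>G\<close> provide the support condition.\<close>

lemma SG_core_le_iff:
  fixes p :: real
  assumes A: "psd_mat n A" and B: "psd_mat n B" and c: "0 \<le> c"
  defines "G \<equiv> psd_pow A (-p/2) * psd_pow (sandwich p A B) (1/2) * psd_pow A (-p/2)"
  shows "loewner_le n (SG_core \<alpha> p A B) (c \<cdot>\<^sub>r 1\<^sub>m n) \<longleftrightarrow>
     loewner_le n (psd_pow G (2 * \<alpha>)) (c \<cdot>\<^sub>r psd_pow A (- p))"
proof -
  have G: "psd_mat n G" using A B by (simp add: G_def)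
  have "G * psd_pow A 0 = G" unfolding G_def by (rule mult_supp[OF A]) (use A B in simp)
  from supp_pow(1)[OF A G this] have "psd_pow G (2 * \<alpha>) * psd_pow (psd_pow A (- p)) 0 = psd_pow G (2 * \<alpha>)"
    by (simp add: psd_pow_pow[OF A])
  from loewner_dual[OF _ _ this c] have "loewner_le n (psd_pow G (2 * \<alpha>)) (c \<cdot>\<^sub>r psd_pow A (- p)) \<longleftrightarrow>
     loewner_le n (psd_pow G \<alpha> * psd_pow A p * psd_pow G \<alpha>) (c \<cdot>\<^sub>r 1\<^sub>m n)"
    using A G by (simp add: psd_pow_pow[of n])
  moreover have "SG_core \<alpha> p A B = psd_pow G \<alpha> * psd_pow A p * psd_pow G \<alpha>"
    by (simp only: SG_core_def G_def Let_def)
  ultimately show ?thesis by simp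
qed

text \<open>\<open>loewner_dual\<close> with \<open>T = G\<close> and
  \<open>M = A^(2(\<alpha>-1)q)\<close> yields a bound on \<open>G\<close>. Conjugation by
  \<open>A^(q/2)\<close> strips the outer factors of \<open>G\<close> and adds q to the exponent on
  the right.\<close>

lemma SG_tilde_core_le_iff:
  assumes A: "psd_mat n A" and B: "psd_mat n B" and c: "0 \<le> c"
  shows "loewner_le n (SG_tilde_core \<alpha> q A B) (c \<cdot>\<^sub>r 1\<^sub>m n) \<longleftrightarrow>
     loewner_le n (psd_pow (sandwich q A B) \<alpha>) (c \<cdot>\<^sub>r psd_pow A ((2 * \<alpha> - 1) * q))"
proof -
  define Z where "Z = sandwich q A B"
  define G where "G = psd_pow A (-q/2) * psd_pow Z \<alpha> * psd_pow A (-q/2)"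
  have Z: "psd_mat n Z" using A B by (simp add: Z_def)
  have G: "psd_mat n G" using A Z by (simp add: G_def)
  have "Z * psd_pow A 0 = Z" unfolding Z_def sandwich_def by (rule mult_supp[OF A]) (use A B in simp)
  note suppZ = supp_pow[OF A Z this]
  have "G * psd_pow A 0 = G" unfolding G_def by (rule mult_supp[OF A]) (use A Z in simp)
  then have supp: "G * psd_pow (psd_pow A (2 * (\<alpha> - 1) * q)) 0 = G" by (simp add: psd_pow_pow[OF A])
  have e: "2 * (1 - \<alpha>) * q = 2 * (\<alpha> - 1) * q * - 1" by (simp add: algebra_simps)
  have "SG_tilde_core \<alpha> q A B = psd_pow G (1/2) * psd_pow (psd_pow A (2 * (\<alpha> - 1) * q)) (- 1) * psd_pow G (1/2)"
    by (simp only: SG_tilde_core_def G_def Z_def Let_def psd_pow_pow[OF A] e)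
  then have "loewner_le n (SG_tilde_core \<alpha> q A B) (c \<cdot>\<^sub>r 1\<^sub>m n) \<longleftrightarrow>
     loewner_le n G (c \<cdot>\<^sub>r psd_pow A (2 * (\<alpha> - 1) * q))"
    using loewner_dual[OF G psd_pow_psd[OF A] supp c] by simp
  also have "\<dots> \<longleftrightarrow> loewner_le n (psd_pow Z \<alpha>) (c \<cdot>\<^sub>r psd_pow A ((2 * \<alpha> - 1) * q))"
  proof
    assume "loewner_le n G (c \<cdot>\<^sub>r psd_pow A (2 * (\<alpha> - 1) * q))"
    from loewner_conj_pow_scaled[OF this A, of "q/2"]
    have "loewner_le n (psd_pow A (q/2) * G * psd_pow A (q/2)) (c \<cdot>\<^sub>r psd_pow A ((2 * \<alpha> - 1) * q))"
      by (simp add: algebra_simps)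
    moreover have "psd_pow A (q/2) * G * psd_pow A (q/2) = psd_pow Z \<alpha>"
      using A Z by (simp add: G_def assoc_mult_mat[of _ n n _ n _ n] psd_pow_mult[of n] psd_pow_mult_left[of n] suppZ)
    ultimately show "loewner_le n (psd_pow Z \<alpha>) (c \<cdot>\<^sub>r psd_pow A ((2 * \<alpha> - 1) * q))" by simp
  next
    assume "loewner_le n (psd_pow Z \<alpha>) (c \<cdot>\<^sub>r psd_pow A ((2 * \<alpha> - 1) * q))"
    from loewner_conj_pow_scaled[OF this A, of "-q/2"]
    show "loewner_le n G (c \<cdot>\<^sub>r psd_pow A (2 * (\<alpha> - 1) * q))"
      by (simp add: G_def algebra_simps)
  qed
  finally show ?thesis unfolding Z_def .
qed


lemma smult_smult_times: "k \<cdot>\<^sub>m (l \<cdot>\<^sub>m A) = (k * l) \<cdot>\<^sub>m (A :: complex mat)"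
  by (intro eq_matI) auto

lemma loewner_smult_scaled:
  "loewner_le n A (c \<cdot>\<^sub>r B) \<Longrightarrow> 0 \<le> k \<Longrightarrow>
   loewner_le n (k \<cdot>\<^sub>r A) ((k * c) \<cdot>\<^sub>r B)"
  using loewner_smult[of n A "c \<cdot>\<^sub>r B" k] by (simp add: smult_smult_times)

lemma loewner_smult_trans:
  assumes "loewner_le n A (c \<cdot>\<^sub>r B)" "loewner_le n B (d \<cdot>\<^sub>r D)" "0 \<le> c"
  shows "loewner_le n A ((c * d) \<cdot>\<^sub>r D)"
  using assms(1) loewner_smult_scaled[OF assms(2,3)] by (rule loewner_trans)

lemma sandwich_conj:
  assumes A: "psd_mat n A" and B: "psd_mat n B" and supp: "B * psd_pow A 0 = B"
  shows "psd_pow A (- p / 2) * sandwich p A B * psd_pow A (- p / 2) = psd_pow B p"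
  using A B supp_pow[OF A B supp]
  by (simp add: sandwich_def assoc_mult_mat[of _ n n _ n _ n] psd_pow_mult[of n] psd_pow_mult_left[of n])

text \<open>The bound yields \<open>B^p \<le> c^p G^(2-2\<alpha>)\<close>, by completing
  \<open>G^\<alpha> A^p G^\<alpha>\<close> to \<open>G A^p G = B^p\<close>, and
  \<open>G^(2\<alpha>) \<le> c^p A^(-p)\<close>. Eliminating \<open>G\<close> gives
  \<open>B^q \<le> c^(q/\<alpha>) A^(-(1-\<alpha>)q/\<alpha>)\<close>; conjugation by
  \<open>A^(q/2)\<close> and the power \<alpha> turn this into the criterion for
  \<open>SG_tilde_core\<close>.\<close>

lemma SG_core_le_imp_SG_tilde_core_le:
  assumes A: "psd_mat n A" and B: "psd_mat n B" and supp: "B * psd_pow A 0 = B"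
    and \<alpha>: "0 < \<alpha>" "\<alpha> < 1" and pq: "0 < p" "0 < q" "q \<le> p" "q * (1 - \<alpha>) \<le> p * \<alpha>" and c: "0 < c"
    and le: "loewner_le n (SG_core \<alpha> p A B) ((c powr p) \<cdot>\<^sub>r 1\<^sub>m n)"
  shows "loewner_le n (SG_tilde_core \<alpha> q A B) ((c powr q) \<cdot>\<^sub>r 1\<^sub>m n)"
proof -
  note [simp] = A B
  note assoc = assoc_mult_mat[of _ n n _ n _ n]
  note pow = psd_pow_mult[of n] psd_pow_mult_left[of n]
  define Z where "Z = sandwich p A B"
  define G where "G = psd_pow A (-p/2) * psd_pow Z (1/2) * psd_pow A (-p/2)"
  have Z [simp]: "psd_mat n Z" and G [simp]: "psd_mat n G" by (simp_all add: Z_def G_def)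
  note [simp] = psd_matD(2)[OF G]
  have "Z * psd_pow A 0 = Z" unfolding Z_def sandwich_def by (rule mult_supp[OF A]) (use A B in simp)
  note suppZ = supp_pow[OF A Z this]
  have ZZ: "psd_pow Z (1/2) * (psd_pow Z (1/2) * X) = Z * X" if "X \<in> carrier_mat n n" for X
    using psd_pow_mult_left[OF Z that, of "1/2" "1/2"] by (simp add: psd_pow_1[OF Z])
  have suppZ': "psd_pow A 0 * (psd_pow Z r * X) = psd_pow Z r * X" if "X \<in> carrier_mat n n" for X r
    using that suppZ(2) by (simp add: assoc[symmetric] del: assoc_mult_mat)
  have "G * psd_pow A p * G = psd_pow A (- p / 2) * Z * psd_pow A (- p / 2)"
    by (simp add: G_def assoc psd_matD(2)[OF Z] psd_pow_mult_left[OF A] suppZ' ZZ)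
  then have GAG: "G * psd_pow A p * G = psd_pow B p"
    unfolding Z_def sandwich_conj[OF A B supp] .
  have G1: "psd_pow G (1 - \<alpha>) * psd_pow G \<alpha> = G" "psd_pow G \<alpha> * psd_pow G (1 - \<alpha>) = G"
    by (simp_all add: pow psd_pow_1[OF G])
  have core: "SG_core \<alpha> p A B = psd_pow G \<alpha> * psd_pow A p * psd_pow G \<alpha>"
    by (simp only: SG_core_def G_def Z_def Let_def)
  have "loewner_le n (psd_pow G (1 - \<alpha>) * SG_core \<alpha> p A B * psd_pow G (1 - \<alpha>))
      (psd_pow G (1 - \<alpha>) * ((c powr p) \<cdot>\<^sub>r 1\<^sub>m n) * psd_pow G (1 - \<alpha>))"
    by (rule loewner_conj_pow[OF le G])
  moreover have "psd_pow G (1 - \<alpha>) * SG_core \<alpha> p A B * psd_pow G (1 - \<alpha>) = psd_pow B p"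
  proof -
    have "psd_pow G (1 - \<alpha>) * SG_core \<alpha> p A B * psd_pow G (1 - \<alpha>) =
       (psd_pow G (1 - \<alpha>) * psd_pow G \<alpha>) * psd_pow A p * (psd_pow G \<alpha> * psd_pow G (1 - \<alpha>))"
      unfolding core by (simp add: assoc del: psd_pow_mult)
    then show ?thesis unfolding G1 GAG .
  qed
  moreover have "psd_pow G (1 - \<alpha>) * ((c powr p) \<cdot>\<^sub>r 1\<^sub>m n) * psd_pow G (1 - \<alpha>) =
      (c powr p) \<cdot>\<^sub>r psd_pow G (2 - 2 * \<alpha>)"
    by (simp add: mult_smult_distrib[of _ n n _ n] mult_smult_assoc_mat[of _ n n _ n] pow
          right_mult_one_mat[of _ n n])
  ultimately have "loewner_le n (psd_pow B p) ((c powr p) \<cdot>\<^sub>r psd_pow G (2 - 2 * \<alpha>))"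
    by simp
  from loewner_heinz_scaled[OF _ _ this, of "q / p"]
  have 1: "loewner_le n (psd_pow B q) ((c powr q) \<cdot>\<^sub>r psd_pow G ((2 - 2 * \<alpha>) * (q / p)))"
    using pq by (simp add: psd_pow_pow[of n] powr_powr)
  \<comment> \<open>The exponent that turns \<open>G^(2\<alpha>)\<close> into the power of
    \<open>G\<close> in the preceding bound; \<open>t \<le> 1\<close> is the hypothesis
    \<open>q * (1 - \<alpha>) \<le> p * \<alpha>\<close>.\<close>
  define t where "t = (1 - \<alpha>) * q / (\<alpha> * p)"
  have t: "0 \<le> t" "t \<le> 1" using \<alpha> pq by (auto simp: t_def field_simps)
  have et: "2 * \<alpha> * t = (2 - 2 * \<alpha>) * (q / p)" "p * t = (1 - \<alpha>) * q / \<alpha>" "- p * t = - ((1 - \<alpha>) * q / \<alpha>)"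
    using \<alpha> pq by (auto simp: t_def field_simps)
  have "loewner_le n (psd_pow G (2 * \<alpha>)) ((c powr p) \<cdot>\<^sub>r psd_pow A (- p))"
    using le by (subst (asm) SG_core_le_iff[OF A B]) (simp_all add: G_def Z_def)
  from loewner_heinz_scaled[OF _ _ this _ t]
  have 2: "loewner_le n (psd_pow G ((2 - 2 * \<alpha>) * (q / p)))
      ((c powr ((1 - \<alpha>) * q / \<alpha>)) \<cdot>\<^sub>r psd_pow A (- ((1 - \<alpha>) * q / \<alpha>)))"
    by (simp only: psd_pow_pow[OF A] psd_pow_pow[OF G] powr_powr et) simp
  have ec: "c powr q * c powr ((1 - \<alpha>) * q / \<alpha>) = c powr (q / \<alpha>)"
    using c \<alpha> by (simp add: powr_add[symmetric] field_simps)
  from loewner_smult_trans[OF 1 2]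
  have "loewner_le n (psd_pow B q) ((c powr (q / \<alpha>)) \<cdot>\<^sub>r psd_pow A (- ((1 - \<alpha>) * q / \<alpha>)))"
    unfolding ec by simp
  from loewner_conj_pow_scaled[OF this A, of "q / 2"]
  have 3: "loewner_le n (sandwich q A B) ((c powr (q / \<alpha>)) \<cdot>\<^sub>r psd_pow A (- ((1 - \<alpha>) * q / \<alpha>) + 2 * (q / 2)))"
    unfolding sandwich_def .
  have ee: "(- ((1 - \<alpha>) * q / \<alpha>) + 2 * (q / 2)) * \<alpha> = (2 * \<alpha> - 1) * q" "q / \<alpha> * \<alpha> = q"
    using \<alpha> by (auto simp: field_simps)
  have "loewner_le n (psd_pow (sandwich q A B) \<alpha>)
      (((c powr (q / \<alpha>)) powr \<alpha>) \<cdot>\<^sub>r psd_pow (psd_pow A (- ((1 - \<alpha>) * q / \<alpha>) + 2 * (q / 2))) \<alpha>)"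
    using \<alpha> by (intro loewner_heinz_scaled[OF _ _ 3]) auto
  then have "loewner_le n (psd_pow (sandwich q A B) \<alpha>)
      ((c powr q) \<cdot>\<^sub>r psd_pow A ((2 * \<alpha> - 1) * q))"
    by (simp only: psd_pow_pow[OF A] powr_powr ee)
  then show ?thesis by (subst SG_tilde_core_le_iff[OF A B]) simp_all
qed

text \<open>The powers 1/\<alpha> and p/q, both at most 1, and conjugations by powers of
  \<open>A\<close> lead to \<open>Z_p \<le> c^(p/\<alpha>) A^((2\<alpha>-1)p/\<alpha>)\<close>. With
  \<open>C = A^p\<close>, \<open>g = 2\<alpha>\<close> and a multiple of \<open>Z_p^(1/2)\<close> as
  \<open>K\<close>, this is the hypothesis of \<open>furuta_type\<close>, whose conclusion is the
  criterion for \<open>SG_core\<close>.\<close>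

lemma SG_tilde_core_le_imp_SG_core_le:
  assumes A: "psd_mat n A" and B: "psd_mat n B" and supp: "B * psd_pow A 0 = B"
    and \<alpha>: "1 < \<alpha>" and pq: "0 < p" "p \<le> q" and c: "0 < c"
    and le: "loewner_le n (SG_tilde_core \<alpha> q A B) ((c powr q) \<cdot>\<^sub>r 1\<^sub>m n)"
  shows "loewner_le n (SG_core \<alpha> p A B) ((c powr p) \<cdot>\<^sub>r 1\<^sub>m n)"
proof -
  note [simp] = A B
  note assoc = assoc_mult_mat[of _ n n _ n _ n]
  note pow = psd_pow_mult[of n] psd_pow_mult_left[of n]
  have q: "0 < q" using pq by simp
  have "loewner_le n (psd_pow (sandwich q A B) \<alpha>) ((c powr q) \<cdot>\<^sub>r psd_pow A ((2 * \<alpha> - 1) * q))"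
    using le by (subst (asm) SG_tilde_core_le_iff[OF A B]) simp_all
  from loewner_heinz_scaled[OF _ _ this, of "1 / \<alpha>"]
  have "loewner_le n (sandwich q A B) ((c powr (q / \<alpha>)) \<cdot>\<^sub>r psd_pow A ((2 * \<alpha> - 1) * q / \<alpha>))"
    using \<alpha> by (simp add: psd_pow_pow[of n] powr_powr psd_pow_1[of n])
  from loewner_conj_pow_scaled[OF this A, of "- q / 2"]
  have 1: "loewner_le n (psd_pow B q) ((c powr (q / \<alpha>)) \<cdot>\<^sub>r psd_pow A ((2 * \<alpha> - 1) * q / \<alpha> + 2 * (- q / 2)))"
    unfolding sandwich_conj[OF A B supp] .
  have "loewner_le n (psd_pow (psd_pow B q) (p / q)) (((c powr (q / \<alpha>)) powr (p / q)) \<cdot>\<^sub>r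
      psd_pow (psd_pow A ((2 * \<alpha> - 1) * q / \<alpha> + 2 * (- q / 2))) (p / q))"
    using pq q by (intro loewner_heinz_scaled[OF _ _ 1]) auto
  moreover have "((2 * \<alpha> - 1) * q / \<alpha> + 2 * (- q / 2)) * (p / q) = (2 * \<alpha> - 1) * p / \<alpha> - p" "q / \<alpha> * (p / q) = p / \<alpha>"
      "q * (p / q) = p"
    using \<alpha> q by (auto simp: field_simps)
  ultimately have 2: "loewner_le n (psd_pow B p) ((c powr (p / \<alpha>)) \<cdot>\<^sub>r psd_pow A ((2 * \<alpha> - 1) * p / \<alpha> - p))"
    by (simp only: psd_pow_pow[OF A] psd_pow_pow[OF B] powr_powr)
  define Z where "Z = sandwich p A B"
  define G where "G = psd_pow A (-p/2) * psd_pow Z (1/2) * psd_pow A (-p/2)"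
  have Z [simp]: "psd_mat n Z" and G [simp]: "psd_mat n G" by (simp_all add: Z_def G_def)
  have 3: "loewner_le n Z ((c powr (p / \<alpha>)) \<cdot>\<^sub>r psd_pow A ((2 * \<alpha> - 1) * p / \<alpha>))"
    using loewner_conj_pow_scaled[OF 2 A, of "p / 2"] by (simp add: Z_def sandwich_def)
  \<comment> \<open>\<open>furuta_type\<close> carries no constant, so \<open>Z_p^(1/2)\<close> is
    rescaled: \<open>s^2 c^(p/\<alpha>) = 1\<close> removes the constant from its hypothesis, and
    \<open>s^(2\<alpha>) c^p = 1\<close> restores \<open>c^p\<close> in its conclusion.\<close>
  define s where "s = c powr (- p / (2 * \<alpha>))"
  define K where "K = s \<cdot>\<^sub>r psd_pow Z (1/2)"
  have s: "0 < s" using c by (simp add: s_def)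
  have K [simp]: "psd_mat n K" using s by (simp add: K_def psd_smult)
  have s2: "s powr 2 * c powr (p / \<alpha>) = 1" "s powr (2 * \<alpha>) * c powr p = 1" "c powr p * s powr (2 * \<alpha>) = 1"
    using c \<alpha> by (simp_all add: s_def powr_powr powr_add[symmetric])
  have K2: "psd_pow K 2 = (s powr 2) \<cdot>\<^sub>r Z"
    using s by (simp add: K_def psd_pow_smult[of n] psd_pow_pow[of n] psd_pow_1[of n] del: powr_numeral)
  have e: "p * (2 * (2 * \<alpha> - 1) / (2 * \<alpha>)) = (2 * \<alpha> - 1) * p / \<alpha>" using \<alpha> by (simp add: field_simps)
  have "loewner_le n ((s powr 2) \<cdot>\<^sub>r Z)
      ((s powr 2 * c powr (p / \<alpha>)) \<cdot>\<^sub>r psd_pow A ((2 * \<alpha> - 1) * p / \<alpha>))"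
    by (rule loewner_smult_scaled[OF 3]) simp
  then have "loewner_le n (psd_pow K 2) (psd_pow (psd_pow A p) (2 * (2 * \<alpha> - 1) / (2 * \<alpha>)))"
    unfolding K2 s2 psd_pow_pow[OF A] e by simp
  from furuta_type[OF psd_pow_psd[OF A] K _ this]
  have "loewner_le n (psd_pow (psd_pow A (- p / 2) * K * psd_pow A (- p / 2)) (2 * \<alpha>)) (psd_pow A (- p))"
    using \<alpha> by (simp add: psd_pow_pow[OF A])
  moreover have "psd_pow A (- p / 2) * K * psd_pow A (- p / 2) = s \<cdot>\<^sub>r G"
    by (simp add: K_def G_def mult_smult_distrib[of _ n n _ n] mult_smult_assoc_mat[of _ n n _ n])
  ultimately have "loewner_le n ((s powr (2 * \<alpha>)) \<cdot>\<^sub>r psd_pow G (2 * \<alpha>)) (1 \<cdot>\<^sub>r psd_pow A (- p))"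
    using s by (simp add: psd_pow_smult[OF G])
  from loewner_smult_scaled[OF this, of "c powr p"]
  have "loewner_le n (psd_pow G (2 * \<alpha>)) ((c powr p) \<cdot>\<^sub>r psd_pow A (- p))"
    by (simp only: smult_smult_times of_real_mult[symmetric] s2) simp
  then show ?thesis
    by (subst SG_core_le_iff[OF A B]) (simp_all add: G_def Z_def)
qed

subsection \<open>Compound matrices\<close>

definition ksub :: "nat \<Rightarrow> nat \<Rightarrow> nat set set" where
  "ksub n k = {S. S \<subseteq> {0..<n} \<and> card S = k}"

definition enum :: "nat set \<Rightarrow> nat \<Rightarrow> nat" where
  "enum S i = sorted_list_of_set S ! i"

definition minor :: "nat \<Rightarrow> complex mat \<Rightarrow> nat set \<Rightarrow> nat set \<Rightarrow> complex" where
  "minor k A S T = det (mat k k (\<lambda>(i,j). A $$ (enum S i, enum T j)))"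

lemma finite_ksub [simp]: "finite (ksub n k)"
  unfolding ksub_def by (rule finite_subset[of _ "Pow {0..<n}"]) auto

lemma enum_bij:
  assumes "S \<in> ksub n k"
  shows "bij_betw (enum S) {0..<k} S"
proof -
  have fin: "finite S" and card: "card S = k" using assms finite_subset by (auto simp: ksub_def)
  have "bij_betw (\<lambda>i. sorted_list_of_set S ! i) {..<length (sorted_list_of_set S)} (set (sorted_list_of_set S))"
    by (rule bij_betw_nth) auto
  then show ?thesis using fin card by (simp add: enum_def[abs_def] atLeast0LessThan)
qed

lemma enum_less: "S \<in> ksub n k \<Longrightarrow> i < k \<Longrightarrow> enum S i < n"
  using enum_bij[of S n k] by (fastforce simp: ksub_def bij_betw_def)

text \<open>Makes the first \<open>k\<close> indices extremal: for decreasing nonnegative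
  \<open>d\<close>, each \<open>d (enum S i)\<close> is at most \<open>d i\<close>, so no
  \<open>k\<close>-subset has a larger product than the first \<open>k\<close> entries.\<close>

lemma enum_ge:
  assumes "S \<in> ksub n k" "i < k"
  shows "i \<le> enum S i"
proof -
  have fin: "finite S" and card: "card S = k" using assms finite_subset by (auto simp: ksub_def)
  have "sorted_wrt (<) (sorted_list_of_set S)" by simp
  from sorted_wrt_less_idx[OF this, of i] show ?thesis using assms(2) fin card by (simp add: enum_def)
qed

text \<open>Rows of \<open>A * B\<close> are combinations of rows of \<open>B\<close>, so
  multilinearity expands the minor over all row selections \<open>f\<close>. Selections with a
  repeated row contribute 0. The injective ones are grouped by their image \<open>R\<close>; each is
  \<open>enum R\<close> after a permutation, and the signs assemble the minor of
  \<open>A\<close>.\<close>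

theorem cauchy_binet:
  assumes A: "A \<in> carrier_mat n n" and B: "B \<in> carrier_mat n n"
    and S: "S \<in> ksub n k" and T: "T \<in> ksub n k"
  shows "minor k (A * B) S T = (\<Sum>R\<in>ksub n k. minor k A S R * minor k B R T)"
proof -
  \<comment> \<open>The index set of \<open>det_linear_rows_sum\<close>: functions on all naturals,
    equal to the identity from \<open>k\<close> on. The map \<open>h\<close> below keeps to this
    convention, which is also that of \<open>permutes\<close>.\<close>
  define F where "F = {f. (\<forall>i\<in>{0..<k}. f i \<in> {0..<n}) \<and> (\<forall>i. i \<notin> {0..<k} \<longrightarrow> f i = i)}"
  define b where "b l = vec k (\<lambda>j. B $$ (l, enum T j))" for l
  define a where "a i l = A $$ (enum S i, l) \<cdot>\<^sub>v b l" for i l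
  define g where "g f = (\<Prod>i\<in>{0..<k}. A $$ (enum S i, f i)) * det (mat\<^sub>r k k (\<lambda>i. b (f i)))" for f
  have bc: "b l \<in> carrier_vec k" for l by (simp add: b_def)
  have ac: "a \<in> {0..<k} \<rightarrow> {0..<n} \<rightarrow> carrier_vec k" using bc by (auto simp: a_def)
  have finF: "finite F"
  proof (rule finite_subset)
    show "F \<subseteq> (\<lambda>h i. if i < k then h i else i) ` ({0..<k} \<rightarrow>\<^sub>E {0..<n})"
    proof
      fix f assume f: "f \<in> F"
      then have "f = (\<lambda>i. if i < k then (restrict f {0..<k}) i else i)" by (auto simp: F_def)
      moreover have "restrict f {0..<k} \<in> {0..<k} \<rightarrow>\<^sub>E {0..<n}" using f by (auto simp: F_def)
      ultimately show "f \<in> (\<lambda>h i. if i < k then h i else i) ` ({0..<k} \<rightarrow>\<^sub>E {0..<n})" by blast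
    qed
  qed (auto intro: finite_PiE)
  have "mat k k (\<lambda>(i,j). (A * B) $$ (enum S i, enum T j)) =
      mat\<^sub>r k k (\<lambda>i. finsum_vec TYPE(complex) k (a i) {0..<n})"
  proof (rule eq_matI)
    fix i j assume "i < dim_row (mat\<^sub>r k k (\<lambda>i. finsum_vec TYPE(complex) k (a i) {0..<n}))"
      "j < dim_col (mat\<^sub>r k k (\<lambda>i. finsum_vec TYPE(complex) k (a i) {0..<n}))"
    then have ij: "i < k" "j < k" by auto
    have aic: "a i \<in> {0..<n} \<rightarrow> carrier_vec k" using ac ij by auto
    have "(A * B) $$ (enum S i, enum T j) = (\<Sum>l\<in>{0..<n}. A $$ (enum S i, l) * B $$ (l, enum T j))"
      using A B enum_less[OF S ij(1)] enum_less[OF T ij(2)] by (auto simp: scalar_prod_def intro!: sum.cong)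
    also have "\<dots> = (\<Sum>l\<in>{0..<n}. a i l $ j)" using ij by (simp add: a_def b_def)
    also have "\<dots> = finsum_vec TYPE(complex) k (a i) {0..<n} $ j"
      using ij aic by (subst index_finsum_vec) auto
    finally show "mat k k (\<lambda>(i,j). (A * B) $$ (enum S i, enum T j)) $$ (i,j) =
      mat\<^sub>r k k (\<lambda>i. finsum_vec TYPE(complex) k (a i) {0..<n}) $$ (i,j)" using ij by simp
  qed auto
  then have "minor k (A * B) S T = (\<Sum>f\<in>F. det (mat\<^sub>r k k (\<lambda>i. a i (f i))))"
    unfolding minor_def F_def using det_linear_rows_sum[OF _ ac] by simp
  also have "\<dots> = (\<Sum>f\<in>F. g f)"
    unfolding a_def g_def by (intro sum.cong refl det_rows_mul) (use bc in auto)
  also have "\<dots> = (\<Sum>f\<in>{f\<in>F. inj_on f {0..<k}}. g f)"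
  proof (rule sum.mono_neutral_right[OF finF], goal_cases)
    case 2
    show ?case
    proof
      fix f assume "f \<in> F - {f\<in>F. inj_on f {0..<k}}"
      then obtain i j where ij: "i < k" "j < k" "i \<noteq> j" "f i = f j" by (auto simp: inj_on_def)
      have "det (mat\<^sub>r k k (\<lambda>i. b (f i))) = 0"
        by (rule det_identical_rows[OF _ ij(3,1,2)]) (use ij bc in auto)
      then show "g f = 0" by (simp add: g_def)
    qed
  qed auto
  also have "\<dots> = (\<Sum>R\<in>ksub n k. \<Sum>f\<in>{f\<in>{f\<in>F. inj_on f {0..<k}}. f ` {0..<k} = R}. g f)"
    by (rule sum.group[symmetric, OF finite_subset[OF _ finF]]) (auto simp: F_def ksub_def card_image)
  also have "\<dots> = (\<Sum>R\<in>ksub n k. minor k A S R * minor k B R T)"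
  proof (rule sum.cong[OF refl])
    fix R assume R: "R \<in> ksub n k"
    note bijR = enum_bij[OF R]
    define h where "h \<pi> i = (if i < k then enum R (\<pi> i) else i)" for \<pi> i
    have bij: "bij_betw h {\<pi>. \<pi> permutes {0..<k}} {f\<in>{f\<in>F. inj_on f {0..<k}}. f ` {0..<k} = R}"
    proof (rule bij_betw_byWitness[where f' = "\<lambda>f i. if i < k then inv_into {0..<k} (enum R) (f i) else i"])
      show "\<forall>\<pi>\<in>{\<pi>. \<pi> permutes {0..<k}}. (\<lambda>i. if i < k then inv_into {0..<k} (enum R) (h \<pi> i) else i) = \<pi>"
      proof
        fix \<pi> assume "\<pi> \<in> {\<pi>. \<pi> permutes {0..<k}}"
        then have \<pi>: "\<pi> permutes {0..<k}" by simp
        show "(\<lambda>i. if i < k then inv_into {0..<k} (enum R) (h \<pi> i) else i) = \<pi>"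
        proof
          fix i
          show "(if i < k then inv_into {0..<k} (enum R) (h \<pi> i) else i) = \<pi> i"
            using permutes_in_image[OF \<pi>, of i] permutes_not_in[OF \<pi>, of i] bijR
            by (auto simp: h_def bij_betw_def inv_into_f_f)
        qed
      qed
    next
      show "\<forall>f\<in>{f\<in>{f\<in>F. inj_on f {0..<k}}. f ` {0..<k} = R}.
          h (\<lambda>i. if i < k then inv_into {0..<k} (enum R) (f i) else i) = f"
      proof
        fix f assume f: "f \<in> {f\<in>{f\<in>F. inj_on f {0..<k}}. f ` {0..<k} = R}"
        show "h (\<lambda>i. if i < k then inv_into {0..<k} (enum R) (f i) else i) = f"
        proof
          fix i
          show "h (\<lambda>i. if i < k then inv_into {0..<k} (enum R) (f i) else i) i = f i"
            using f bijR by (auto simp: h_def F_def bij_betw_def intro!: f_inv_into_f)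
        qed
      qed
    next
      show "h ` {\<pi>. \<pi> permutes {0..<k}} \<subseteq> {f\<in>{f\<in>F. inj_on f {0..<k}}. f ` {0..<k} = R}"
      proof
        fix f assume "f \<in> h ` {\<pi>. \<pi> permutes {0..<k}}"
        then obtain \<pi> where \<pi>: "\<pi> permutes {0..<k}" and f: "f = h \<pi>" by auto
        have "bij_betw (enum R \<circ> \<pi>) {0..<k} R"
          using bij_betw_trans[OF permutes_imp_bij[OF \<pi>] bijR] .
        then have "bij_betw f {0..<k} R"
          by (rule bij_betw_cong[THEN iffD1, rotated]) (auto simp: f h_def)
        then show "f \<in> {f\<in>{f\<in>F. inj_on f {0..<k}}. f ` {0..<k} = R}"
          using R by (fastforce simp: f h_def F_def bij_betw_def ksub_def)
      qed
    next
      show "(\<lambda>f i. if i < k then inv_into {0..<k} (enum R) (f i) else i) `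
          {f\<in>{f\<in>F. inj_on f {0..<k}}. f ` {0..<k} = R} \<subseteq> {\<pi>. \<pi> permutes {0..<k}}"
      proof
        fix \<pi> assume "\<pi> \<in> (\<lambda>f i. if i < k then inv_into {0..<k} (enum R) (f i) else i) `
          {f\<in>{f\<in>F. inj_on f {0..<k}}. f ` {0..<k} = R}"
        then obtain f where \<pi>: "\<pi> = (\<lambda>i. if i < k then inv_into {0..<k} (enum R) (f i) else i)"
          and f: "inj_on f {0..<k}" "f ` {0..<k} = R" by auto
        have "bij_betw f {0..<k} R" using f by (simp add: bij_betw_def)
        from bij_betw_trans[OF this bij_betw_inv_into[OF bijR]]
        have "bij_betw \<pi> {0..<k} {0..<k}"
          by (rule bij_betw_cong[THEN iffD1, rotated]) (auto simp: \<pi>)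
        then have "\<pi> permutes {0..<k}" by (rule bij_imp_permutes) (auto simp: \<pi>)
        then show "\<pi> \<in> {\<pi>. \<pi> permutes {0..<k}}" by simp
      qed
    qed
    let ?A = "mat k k (\<lambda>(i,j). A $$ (enum S i, enum R j))"
    let ?B = "mat k k (\<lambda>(i,j). B $$ (enum R i, enum T j))"
    have "(\<Sum>f\<in>{f\<in>{f\<in>F. inj_on f {0..<k}}. f ` {0..<k} = R}. g f) = (\<Sum>\<pi>\<in>{\<pi>. \<pi> permutes {0..<k}}. g (h \<pi>))"
      by (rule sum.reindex_bij_betw[OF bij, symmetric])
    also have "\<dots> = (\<Sum>\<pi>\<in>{\<pi>. \<pi> permutes {0..<k}}. signof \<pi> * (\<Prod>i = 0..<k. ?A $$ (i, \<pi> i)) * det ?B)"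
    proof (rule sum.cong[OF refl])
      fix \<pi> assume "\<pi> \<in> {\<pi>. \<pi> permutes {0..<k}}"
      then have \<pi>: "\<pi> permutes {0..<k}" by simp
      have \<pi>k: "\<pi> i < k" if "i < k" for i using permutes_in_image[OF \<pi>, of i] that by simp
      have "mat\<^sub>r k k (\<lambda>i. b (h \<pi> i)) = mat k k (\<lambda>(i,j). ?B $$ (\<pi> i, j))"
        by (rule eq_matI) (auto simp: b_def h_def \<pi>k)
      then have "det (mat\<^sub>r k k (\<lambda>i. b (h \<pi> i))) = signof \<pi> * det ?B"
        using det_permute_rows[of ?B k, OF _ \<pi>] by simp
      moreover have "(\<Prod>i\<in>{0..<k}. A $$ (enum S i, h \<pi> i)) = (\<Prod>i = 0..<k. ?A $$ (i, \<pi> i))"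
        by (rule prod.cong) (auto simp: h_def \<pi>k)
      ultimately show "g (h \<pi>) = signof \<pi> * (\<Prod>i = 0..<k. ?A $$ (i, \<pi> i)) * det ?B"
        by (simp add: g_def)
    qed
    also have "\<dots> = det ?A * det ?B"
      by (subst (2) det_def'[of _ k]) (auto simp: sum_distrib_right)
    finally show "(\<Sum>f\<in>{f\<in>{f\<in>F. inj_on f {0..<k}}. f ` {0..<k} = R}. g f) = minor k A S R * minor k B R T"
      by (simp add: minor_def)
  qed
  finally show ?thesis .
qed

text \<open>Any enumeration may order the rows and columns of a compound: another choice only
  conjugates it by a permutation matrix.\<close>

definition ksub_list :: "nat \<Rightarrow> nat \<Rightarrow> nat set list" where
  "ksub_list n k = (SOME xs. set xs = ksub n k \<and> distinct xs)"

lemma ksub_list: "set (ksub_list n k) = ksub n k" "distinct (ksub_list n k)"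
  using someI_ex[OF finite_distinct_list[OF finite_ksub, of n k]] by (simp_all add: ksub_list_def)

abbreviation ksub_num :: "nat \<Rightarrow> nat \<Rightarrow> nat" where
  "ksub_num n k \<equiv> length (ksub_list n k)"

lemma ksub_list_nth: "a < ksub_num n k \<Longrightarrow> ksub_list n k ! a \<in> ksub n k"
  using ksub_list(1) nth_mem by blast

definition compound :: "nat \<Rightarrow> nat \<Rightarrow> complex mat \<Rightarrow> complex mat" where
  "compound n k A = mat (ksub_num n k) (ksub_num n k)
     (\<lambda>(a,b). minor k A (ksub_list n k ! a) (ksub_list n k ! b))"

lemma compound_carrier [simp]: "compound n k A \<in> carrier_mat (ksub_num n k) (ksub_num n k)"
  by (simp add: compound_def)

lemma compound_mult:
  assumes "A \<in> carrier_mat n n" "B \<in> carrier_mat n n"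
  shows "compound n k (A * B) = compound n k A * compound n k B"
proof (rule eq_matI)
  fix a b assume "a < dim_row (compound n k A * compound n k B)" "b < dim_col (compound n k A * compound n k B)"
  then have ab: "a < ksub_num n k" "b < ksub_num n k" by (auto simp: compound_def)
  let ?L = "ksub_list n k"
  have "compound n k (A * B) $$ (a, b) = (\<Sum>R\<in>ksub n k. minor k A (?L ! a) R * minor k B R (?L ! b))"
    using ab cauchy_binet[OF assms ksub_list_nth[OF ab(1)] ksub_list_nth[OF ab(2)]] by (simp add: compound_def)
  also have "\<dots> = (\<Sum>c\<in>{..<ksub_num n k}. minor k A (?L ! a) (?L ! c) * minor k B (?L ! c) (?L ! b))"
    by (rule sum.reindex_bij_betw[symmetric]) (use bij_betw_nth[OF ksub_list(2) refl ksub_list(1)[symmetric]] in simp)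
  also have "\<dots> = (compound n k A * compound n k B) $$ (a, b)"
    using ab by (auto simp: compound_def scalar_prod_def atLeast0LessThan intro!: sum.cong)
  finally show "compound n k (A * B) $$ (a, b) = (compound n k A * compound n k B) $$ (a, b)" .
qed (auto simp: compound_def)

text \<open>For distinct sets of equal size some \<open>s\<close> lies in \<open>S\<close> but not
  in \<open>T\<close>, and its row in the submatrix is zero. For \<open>S = T\<close> the submatrix
  is itself diagonal.\<close>

lemma minor_diag:
  assumes S: "S \<in> ksub n k" and T: "T \<in> ksub n k"
  shows "minor k (mat_diag n f) S T = (if S = T then \<Prod>i\<in>S. f i else 0)"
proof (cases "S = T")
  case False
  have fin: "finite S" "finite T" "card S = k" "card T = k" using S T finite_subset by (auto simp: ksub_def)
  then obtain s where s: "s \<in> S" "s \<notin> T"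
    using False by (metis card_subset_eq subsetI)
  obtain i where i: "i < k" "enum S i = s"
    using enum_bij[OF S] s(1) unfolding bij_betw_def by (metis atLeastLessThan_iff imageE)
  let ?M = "mat k k (\<lambda>(i,j). mat_diag n f $$ (enum S i, enum T j))"
  have "row (mat k k (\<lambda>(i,j). mat_diag n f $$ (enum S i, enum T j))) i = 0\<^sub>v k"
  proof (rule eq_vecI)
    fix j assume "j < dim_vec (0\<^sub>v k :: complex vec)"
    then have j: "j < k" by simp
    then have "enum T j \<noteq> s" using s(2) enum_bij[OF T] by (auto simp: bij_betw_def)
    then show "row (mat k k (\<lambda>(i,j). mat_diag n f $$ (enum S i, enum T j))) i $ j = 0\<^sub>v k $ j"
      using i j enum_less[OF S i(1)] enum_less[OF T j] by (simp add: mat_diag_def)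
  qed simp
  then have "?M = mat\<^sub>r k k (\<lambda>l. if l = i then 0\<^sub>v k else row ?M l)"
    by (intro eq_rowI) auto
  then have "minor k (mat_diag n f) S T = 0"
    unfolding minor_def using det_row_0[OF i(1), of "row ?M"] by (metis (no_types, lifting) Pi_I dim_col_mat(1) row_carrier_vec row_carrier dim_row_mat(1) atLeastLessThan_iff mat_carrier)
  then show ?thesis using False by simp
next
  case True
  let ?M = "mat k k (\<lambda>(i,j). mat_diag n f $$ (enum S i, enum T j))"
  have inj: "inj_on (enum S) {0..<k}" using enum_bij[OF S] by (simp add: bij_betw_def)
  have M: "?M = mat_diag k (\<lambda>i. f (enum S i))"
    using inj True by (intro eq_matI) (auto simp: mat_diag_def enum_less[OF T] inj_on_def)
  have "minor k (mat_diag n f) S T = prod_list (diag_mat (mat_diag k (\<lambda>i. f (enum S i))))"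
    unfolding minor_def M by (rule det_upper_triangular[of _ k]) (auto simp: mat_diag_def)
  also have "\<dots> = (\<Prod>i\<in>{0..<k}. f (enum S i))"
    unfolding prod_list_diag_prod by (auto simp: mat_diag_def intro!: prod.cong)
  also have "\<dots> = (\<Prod>i\<in>S. f i)" by (rule prod.reindex_bij_betw[OF enum_bij[OF S]])
  finally show ?thesis using True by simp
qed

lemma compound_diag:
  "compound n k (mat_diag n f) = mat_diag (ksub_num n k) (\<lambda>a. \<Prod>i\<in>ksub_list n k ! a. f i)"
  using ksub_list(2)
  by (intro eq_matI) (auto simp: compound_def mat_diag_def[of "ksub_num n k"] minor_diag[OF ksub_list_nth ksub_list_nth] nth_eq_iff_index_eq)

lemma compound_one: "compound n k (1\<^sub>m n) = 1\<^sub>m (ksub_num n k)"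
  using compound_diag[of n k "\<lambda>_. 1"] by simp

lemma det_adjoint:
  fixes A :: "complex mat"
  assumes "A \<in> carrier_mat n n"
  shows "det (mat_adjoint A) = cnj (det A)"
proof -
  interpret cnj: comm_ring_hom cnj by unfold_locales auto
  have "mat_adjoint A = transpose_mat (map_mat cnj A)" by (intro eq_matI) auto
  then show ?thesis using assms by (simp add: det_transpose[of _ n])
qed

lemma compound_adjoint:
  assumes "A \<in> carrier_mat n n"
  shows "compound n k (mat_adjoint A) = mat_adjoint (compound n k A)"
proof (rule eq_matI)
  fix a b assume "a < dim_row (mat_adjoint (compound n k A))" "b < dim_col (mat_adjoint (compound n k A))"
  then have ab: "a < ksub_num n k" "b < ksub_num n k" by (auto simp: compound_def)
  let ?S = "ksub_list n k ! a" and ?T = "ksub_list n k ! b"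
  have "mat k k (\<lambda>(i,j). mat_adjoint A $$ (enum ?S i, enum ?T j)) =
      mat_adjoint (mat k k (\<lambda>(i,j). A $$ (enum ?T i, enum ?S j)))"
    using assms enum_less[OF ksub_list_nth[OF ab(1)]] enum_less[OF ksub_list_nth[OF ab(2)]]
    by (intro eq_matI) auto
  then have "minor k (mat_adjoint A) ?S ?T = cnj (minor k A ?T ?S)"
    unfolding minor_def by (simp add: det_adjoint[of _ k])
  then show "compound n k (mat_adjoint A) $$ (a, b) = mat_adjoint (compound n k A) $$ (a, b)"
    using ab by (simp add: compound_def)
qed (auto simp: compound_def)

lemma compound_unitary:
  assumes "unitary_mat n U"
  shows "unitary_mat (ksub_num n k) (compound n k U)"
proof (rule unitary_matI)
  note U = unitary_matD[OF assms]
  show "mat_adjoint (compound n k U) * compound n k U = 1\<^sub>m (ksub_num n k)"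
    using U by (simp add: compound_adjoint[symmetric] compound_mult[symmetric] compound_one)
qed simp

lemma compound_diag_conj:
  assumes "unitary_mat n U"
  shows "compound n k (udiag n U d) =
    compound n k U * mat_diag (ksub_num n k) (\<lambda>a. complex_of_real (\<Prod>i\<in>ksub_list n k ! a. d i)) *
    mat_adjoint (compound n k U)"
  using unitary_matD(1)[OF assms]
  by (simp add: compound_mult compound_adjoint compound_diag)

lemma prod_ksub_nonneg:
  fixes d :: "nat \<Rightarrow> real"
  assumes "\<forall>i<n. 0 \<le> d i"
  shows "\<forall>a<ksub_num n k. 0 \<le> (\<Prod>i\<in>ksub_list n k ! a. d i)"
  using assms ksub_list_nth[of _ n k] by (fastforce simp: ksub_def intro!: prod_nonneg)

lemma compound_psd:
  assumes "psd_mat n A"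
  shows "psd_mat (ksub_num n k) (compound n k A)"
proof -
  obtain U d where U: "unitary_mat n U" and d: "\<forall>i<n. 0 \<le> d i"
    and A: "A = udiag n U d"
    using psd_spectral[OF assms] by blast
  show ?thesis
    unfolding A compound_diag_conj[OF U] psd_diag_iff[OF compound_unitary[OF U]] by (rule prod_ksub_nonneg[OF d])
qed

text \<open>The compound of a diagonalization is again a diagonalization, with the products of
  \<open>d\<close> over \<open>k\<close>-subsets as eigenvalues, and \<open>powr\<close> distributes
  over these products, zero factors included.\<close>

lemma compound_psd_pow:
  assumes "psd_mat n A"
  shows "compound n k (psd_pow A r) = psd_pow (compound n k A) r"
proof -
  obtain U d where U: "unitary_mat n U" and d: "\<forall>i<n. 0 \<le> d i"
    and A: "A = udiag n U d"
    using psd_spectral[OF assms] by blast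
  show ?thesis
    unfolding psd_pow_diag[OF U d A] compound_diag_conj[OF U]
      psd_pow_diag[OF compound_unitary[OF U] prod_ksub_nonneg[OF d] compound_diag_conj[OF U, of k d, folded A]]
  proof (rule diag_conj_cong)
    fix a assume "a < ksub_num n k"
    then have "i < n" if "i \<in> ksub_list n k ! a" for i
      using ksub_list_nth that by (fastforce simp: ksub_def)
    then show "complex_of_real (\<Prod>i\<in>ksub_list n k ! a. d i powr r) = complex_of_real ((\<Prod>i\<in>ksub_list n k ! a. d i) powr r)"
      using d by (simp add: prod_powr_distrib)
  qed
qed

lemma compound_sandwich:
  assumes "psd_mat n A" "psd_mat n B"
  shows "compound n k (sandwich p A B) = sandwich p (compound n k A) (compound n k B)"
  using assms by (simp add: sandwich_def compound_mult compound_psd_pow)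

lemma compound_SG_core:
  assumes "psd_mat n A" "psd_mat n B"
  shows "compound n k (SG_core \<alpha> p A B) = SG_core \<alpha> p (compound n k A) (compound n k B)"
  using assms by (simp add: SG_core_def Let_def compound_mult compound_psd_pow compound_sandwich)

lemma compound_SG_tilde_core:
  assumes "psd_mat n A" "psd_mat n B"
  shows "compound n k (SG_tilde_core \<alpha> p A B) = SG_tilde_core \<alpha> p (compound n k A) (compound n k B)"
  using assms by (simp add: SG_tilde_core_def Let_def compound_mult compound_psd_pow compound_sandwich)

subsection \<open>Log-majorization\<close>

lemma diag_mat_mat_diag: "diag_mat (mat_diag n f) = map f [0..<n]"
  by (auto simp: diag_mat_def mat_diag_def intro!: map_cong)

lemma proots_linear_list: "proots (\<Prod>a\<leftarrow>xs. [:- a, 1:]) = mset (xs :: complex list)"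
proof (induction xs)
  case (Cons x xs)
  have "(\<Prod>a\<leftarrow>xs. [:- a, 1:]) \<noteq> (0 :: complex poly)" by (auto simp: prod_list_zero_iff)
  with Cons show ?case by (simp add: proots_mult del: mult_pCons_left)
qed simp

lemma char_poly_diag_conj:
  assumes "unitary_mat n U"
  shows "char_poly (U * mat_diag n f * mat_adjoint U) = (\<Prod>a\<leftarrow>map f [0..<n]. [:- a, 1:])"
proof -
  note U = unitary_matD[OF assms]
  have "similar_mat_wit (U * mat_diag n f * mat_adjoint U) (mat_diag n f) U (mat_adjoint U)"
    by (rule similar_mat_witI[of _ _ n]) (use U in auto)
  then have "char_poly (U * mat_diag n f * mat_adjoint U) = char_poly (mat_diag n f)"
    by (intro char_poly_similar) (auto simp: similar_mat_def)
  also have "\<dots> = (\<Prod>a\<leftarrow>diag_mat (mat_diag n f). [:- a, 1:])"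
    by (rule char_poly_upper_triangular[of _ n]) (auto simp: mat_diag_def)
  finally show ?thesis by (simp add: diag_mat_mat_diag)
qed

lemma eigvals_desc_diag_conj:
  assumes "unitary_mat n U"
  shows "eigvals_desc (udiag n U d) = rev (sort (map d [0..<n]))"
proof -
  have "image_mset Re (proots (char_poly (udiag n U d))) = mset (map d [0..<n])"
    unfolding char_poly_diag_conj[OF assms] proots_linear_list by (simp add: multiset.map_comp comp_def flip: mset_map)
  then show ?thesis by (simp only: eigvals_desc_def sorted_list_of_multiset_mset)
qed

lemma eigvals_desc_diag_conj_sorted:
  assumes "unitary_mat n U" and mono: "\<And>i j. i \<le> j \<Longrightarrow> j < n \<Longrightarrow> d j \<le> d i"
  shows "eigvals_desc (udiag n U d) = map d [0..<n]"
proof -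
  have "sorted (rev (map d [0..<n]))"
    by (auto simp: sorted_iff_nth_mono_less rev_nth intro!: mono)
  then have "sort (rev (map d [0..<n])) = rev (map d [0..<n])" by (rule sorted_sort_id)
  moreover have "sort (map d [0..<n]) = sort (rev (map d [0..<n]))"
    by (rule properties_for_sort) auto
  ultimately show ?thesis unfolding eigvals_desc_diag_conj[OF assms(1)] by simp
qed

text \<open>The columns of \<open>V\<close> are rearranged along a permutation that sorts the
  eigenvalues; this only reorders the sum that expresses an entry of \<open>A\<close>.\<close>

lemma psd_spectral_sorted:
  assumes "psd_mat n A"
  obtains U d where "unitary_mat n U" "\<forall>i<n. 0 \<le> d i" "\<And>i j. i \<le> j \<Longrightarrow> j < n \<Longrightarrow> d j \<le> d i"
    "A = udiag n U d"
proof -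
  obtain V e where V: "unitary_mat n V" and e: "\<forall>i<n. 0 \<le> e i"
    and A: "A = udiag n V e"
    using psd_spectral[OF assms] by blast
  note V' = unitary_matD[OF V]
  define xs where "xs = rev (sort (map e [0..<n]))"
  have "mset xs = mset (map e [0..<n])" by (simp add: xs_def)
  then obtain \<pi> where \<pi>: "\<pi> permutes {..<n}" and xs: "permute_list \<pi> (map e [0..<n]) = xs"
    using mset_eq_permutation[of xs "map e [0..<n]"] by auto
  have \<pi>n: "\<pi> i < n" if "i < n" for i using permutes_in_image[OF \<pi>, of i] that by simp
  have inj: "\<pi> i = \<pi> j \<longleftrightarrow> i = j" for i j using permutes_inj[OF \<pi>] by (auto dest: injD)
  define d where "d i = e (\<pi> i)" for i
  have len: "length xs = n" by (simp add: xs_def)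
  have xsd: "xs ! i = d i" if "i < n" for i
    using that \<pi>n[OF that] permute_list_nth[of \<pi> "map e [0..<n]" i] \<pi> xs by (simp add: d_def)
  have mono: "d j \<le> d i" if "i \<le> j" "j < n" for i j
  proof -
    have "sorted (rev xs)" by (simp add: xs_def)
    then have "xs ! j \<le> xs ! i" using that len by (simp add: sorted_rev_iff_nth_mono)
    then show ?thesis using that xsd by simp
  qed
  define U where "U = mat n n (\<lambda>(i,j). V $$ (i, \<pi> j))"
  have Uc: "U \<in> carrier_mat n n" by (simp add: U_def)
  have "mat_adjoint U * U = 1\<^sub>m n"
  proof (rule eq_matI)
    fix i j assume "i < dim_row (1\<^sub>m n :: complex mat)" "j < dim_col (1\<^sub>m n :: complex mat)"
    then have ij: "i < n" "j < n" by auto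
    have "(mat_adjoint U * U) $$ (i,j) = (mat_adjoint V * V) $$ (\<pi> i, \<pi> j)"
      using ij V'(1) \<pi>n by (auto simp: U_def scalar_prod_def intro!: sum.cong)
    then show "(mat_adjoint U * U) $$ (i,j) = 1\<^sub>m n $$ (i,j)" using ij \<pi>n V'(3) inj by simp
  qed (use Uc in auto)
  with Uc have U: "unitary_mat n U" by (rule unitary_matI)
  have "A = udiag n U d"
  proof (rule eq_matI)
    fix i j assume "i < dim_row (udiag n U d)"
      "j < dim_col (udiag n U d)"
    then have ij: "i < n" "j < n" using Uc by auto
    have "A $$ (i,j) = (\<Sum>k<n. V $$ (i,k) * complex_of_real (e k) * conjugate (V $$ (j,k)))"
      unfolding A using conj_diag_index[OF V'(1) ij] .
    also have "\<dots> = (\<Sum>k<n. V $$ (i,\<pi> k) * complex_of_real (e (\<pi> k)) * conjugate (V $$ (j,\<pi> k)))"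
      by (rule sum.reindex_bij_betw[OF permutes_imp_bij[OF \<pi>], symmetric])
    also have "\<dots> = (udiag n U d) $$ (i,j)"
      unfolding conj_diag_index[OF Uc ij] by (intro sum.cong) (use ij in \<open>auto simp: U_def d_def\<close>)
    finally show "A $$ (i,j) = (udiag n U d) $$ (i,j)" .
  qed (use A V' Uc in auto)
  moreover have "\<forall>i<n. 0 \<le> d i" using e \<pi>n by (simp add: d_def)
  ultimately show thesis using that U mono by blast
qed

lemma eigvals_desc_psd_pow:
  assumes "psd_mat n A" "0 \<le> r" "i < n"
  shows "eigvals_desc (psd_pow A r) ! i = (eigvals_desc A ! i) powr r"
proof -
  obtain U d where U: "unitary_mat n U" and d: "\<forall>i<n. 0 \<le> d i"
    and mono: "\<And>i j. i \<le> j \<Longrightarrow> j < n \<Longrightarrow> d j \<le> d i"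
    and A: "A = udiag n U d"
    using psd_spectral_sorted[OF assms(1)] by blast
  have "eigvals_desc (psd_pow A r) = map (\<lambda>i. d i powr r) [0..<n]"
    unfolding psd_pow_diag[OF U d A]
    by (rule eigvals_desc_diag_conj_sorted[OF U]) (use mono d assms in \<open>auto intro!: powr_mono2\<close>)
  moreover have "eigvals_desc A = map d [0..<n]"
    unfolding A by (rule eigvals_desc_diag_conj_sorted[OF U mono])
  ultimately show ?thesis using assms(3) by simp
qed

lemma eigvals_desc_nonneg:
  assumes "psd_mat n A" "i < n"
  shows "0 \<le> eigvals_desc A ! i"
proof -
  obtain U d where U: "unitary_mat n U" and d: "\<forall>i<n. 0 \<le> d i"
    and mono: "\<And>i j. i \<le> j \<Longrightarrow> j < n \<Longrightarrow> d j \<le> d i"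
    and A: "A = udiag n U d"
    using psd_spectral_sorted[OF assms(1)] by blast
  have "eigvals_desc A = map d [0..<n]"
    unfolding A by (rule eigvals_desc_diag_conj_sorted[OF U mono])
  then show ?thesis using d assms(2) by simp
qed

text \<open>The eigenvalues of the compound are the products of \<open>k\<close> eigenvalues of
  \<open>X\<close>, the largest being formed by the \<open>k\<close> largest. A partial product in
  \<open>log_maj\<close> thus becomes a Loewner bound, to which the inequalities between cores
  apply.\<close>

lemma compound_le_iff:
  assumes X: "psd_mat n X" and k: "k \<le> n"
  shows "loewner_le (ksub_num n k) (compound n k X) (c \<cdot>\<^sub>r 1\<^sub>m (ksub_num n k)) \<longleftrightarrow>
    (\<Prod>i<k. eigvals_desc X ! i) \<le> c"
proof -
  obtain U d where U: "unitary_mat n U" and d: "\<forall>i<n. 0 \<le> d i"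
    and mono: "\<And>i j. i \<le> j \<Longrightarrow> j < n \<Longrightarrow> d j \<le> d i"
    and XU: "X = udiag n U d"
    using psd_spectral_sorted[OF X] by blast
  have "eigvals_desc X = map d [0..<n]"
    unfolding XU by (rule eigvals_desc_diag_conj_sorted[OF U mono])
  then have ev: "(\<Prod>i<k. eigvals_desc X ! i) = (\<Prod>i<k. d i)"
    using k by (intro prod.cong) auto
  have "loewner_le (ksub_num n k) (compound n k X) (c \<cdot>\<^sub>r 1\<^sub>m (ksub_num n k)) \<longleftrightarrow>
      (\<forall>a<ksub_num n k. (\<Prod>i\<in>ksub_list n k ! a. d i) \<le> c)"
    unfolding XU compound_diag_conj[OF U] loewner_diag_scalar_iff[OF compound_unitary[OF U]] ..
  also have "\<dots> \<longleftrightarrow> (\<forall>S\<in>ksub n k. (\<Prod>i\<in>S. d i) \<le> c)"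
    using ksub_list(1)[of n k] by (metis in_set_conv_nth)
  also have "\<dots> \<longleftrightarrow> (\<Prod>i<k. d i) \<le> c"
  proof
    assume "\<forall>S\<in>ksub n k. (\<Prod>i\<in>S. d i) \<le> c"
    moreover have "{..<k} \<in> ksub n k" using k by (auto simp: ksub_def)
    ultimately show "(\<Prod>i<k. d i) \<le> c" by blast
  next
    assume c: "(\<Prod>i<k. d i) \<le> c"
    show "\<forall>S\<in>ksub n k. (\<Prod>i\<in>S. d i) \<le> c"
    proof
      fix S assume S: "S \<in> ksub n k"
      have "(\<Prod>i\<in>S. d i) = (\<Prod>i\<in>{0..<k}. d (enum S i))"
        by (rule prod.reindex_bij_betw[OF enum_bij[OF S], symmetric])
      also have "\<dots> \<le> (\<Prod>i\<in>{0..<k}. d i)"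
        by (rule prod_mono) (use d mono enum_less[OF S] enum_ge[OF S] in auto)
      also have "\<dots> \<le> c" using c by (simp add: atLeast0LessThan)
      finally show "(\<Prod>i\<in>S. d i) \<le> c" .
    qed
  qed
  finally show ?thesis unfolding ev .
qed

section \<open>Determinants, and log-majorization from threshold implications\<close>

lemma det_diag_conj:
  assumes "unitary_mat n U"
  shows "det (U * mat_diag n f * mat_adjoint U) = (\<Prod>i<n. f i)"
proof -
  note U = unitary_matD[OF assms]
  have "det (U * mat_diag n f * mat_adjoint U) = det (mat_diag n f) * det (U * mat_adjoint U)"
    using U(1) by (simp add: det_mult[of _ n] del: U(2) assoc_mult_mat)
  also have "det (mat_diag n f) = prod_list (diag_mat (mat_diag n f))"
    by (rule det_upper_triangular[of _ n]) (auto simp: mat_diag_def)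
  finally show ?thesis using U(2) unfolding prod_list_diag_prod
    by (auto simp: mat_diag_def atLeast0LessThan intro!: prod.cong)
qed

lemma det_psd_pow:
  assumes "psd_mat n A"
  shows "det (psd_pow A r) = complex_of_real (Re (det A) powr r)" "0 \<le> Re (det A)"
    "det A = complex_of_real (Re (det A))"
proof -
  obtain U d where U: "unitary_mat n U" and d: "\<forall>i<n. 0 \<le> d i"
    and A: "A = udiag n U d"
    using psd_spectral[OF assms] by blast
  have dA: "det A = complex_of_real (\<Prod>i<n. d i)" unfolding A det_diag_conj[OF U] by simp
  show "det (psd_pow A r) = complex_of_real (Re (det A) powr r)"
    unfolding psd_pow_diag[OF U d A] det_diag_conj[OF U] dA
    by (simp only: Re_complex_of_real prod_powr_distrib flip: of_real_prod)
  show "0 \<le> Re (det A)" unfolding dA Re_complex_of_real using d by (auto intro: prod_nonneg)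
  show "det A = complex_of_real (Re (det A))" unfolding dA by (simp only: Re_complex_of_real)
qed

lemma prod_eigvals_desc:
  assumes "psd_mat n A"
  shows "(\<Prod>i<n. eigvals_desc A ! i) = Re (det A)"
proof -
  obtain U d where U: "unitary_mat n U"
    and mono: "\<And>i j. i \<le> j \<Longrightarrow> j < n \<Longrightarrow> d j \<le> d i"
    and A: "A = udiag n U d"
    using psd_spectral_sorted[OF assms(1)] by blast
  have "eigvals_desc A = map d [0..<n]"
    unfolding A by (rule eigvals_desc_diag_conj_sorted[OF U mono])
  then have "(\<Prod>i<n. eigvals_desc A ! i) = (\<Prod>i<n. d i)" by (intro prod.cong) auto
  moreover have "det A = complex_of_real (\<Prod>i<n. d i)" unfolding A det_diag_conj[OF U] by simp
  ultimately show ?thesis by (simp only: Re_complex_of_real)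
qed

text \<open>Supplies the equality for \<open>k = n\<close>. With \<open>a\<close> and
  \<open>b\<close> the determinants of \<open>A\<close> and \<open>B\<close>, both sides are
  \<open>a^(1-\<alpha>) b^\<alpha>\<close> if these are positive; if one of them vanishes, both
  sides are 0 because \<open>0 powr r = 0\<close>.\<close>

lemma det_SG_core_eq:
  assumes A: "psd_mat n A" and B: "psd_mat n B" and p: "0 < p" "0 < q"
  shows "Re (det (SG_core \<alpha> p A B)) powr (1/p) = Re (det (SG_tilde_core \<alpha> q A B)) powr (1/q)"
proof -
  define a where "a = Re (det A)"
  define b where "b = Re (det B)"
  note [simp] = A B det_mult[of _ n]
  have pow: "det (psd_pow X r) = complex_of_real (x powr r)"
    if "psd_mat n X" "det X = complex_of_real x" for X r x
    using det_psd_pow(1)[OF that(1), of r] that(2) by simp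
  have dA: "det A = complex_of_real a" and dB: "det B = complex_of_real b" and ab: "0 \<le> a" "0 \<le> b"
    using det_psd_pow(2,3)[OF A] det_psd_pow(2,3)[OF B] by (simp_all add: a_def b_def)
  have sw: "det (sandwich r A B) = complex_of_real (a powr (r/2) * b powr r * a powr (r/2))" for r
    by (simp add: sandwich_def pow[OF A dA] pow[OF B dB])
  let ?G = "\<lambda>r s. psd_pow A (-r/2) * psd_pow (sandwich r A B) s * psd_pow A (-r/2)"
  have G: "det (?G r s) = complex_of_real (a powr (-r/2) * (a powr (r/2) * b powr r * a powr (r/2)) powr s * a powr (-r/2))" for r s
    using pow[OF sandwich_psd[OF A B] sw] by (simp add: pow[OF A dA])
  have Gp: "psd_mat n (?G r s)" for r s by simp
  define g where "g r s = a powr (-r/2) * (a powr (r/2) * b powr r * a powr (r/2)) powr s * a powr (-r/2)" for r s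
  have 1: "Re (det (SG_core \<alpha> p A B)) = g p (1/2) powr \<alpha> * a powr p * g p (1/2) powr \<alpha>"
    unfolding SG_core_def Let_def using pow[OF Gp G, of p "1/2" \<alpha>]
    by (simp add: g_def pow[OF A dA] del: of_real_mult flip: of_real_mult)
  have 2: "Re (det (SG_tilde_core \<alpha> q A B)) = g q \<alpha> powr (1/2) * a powr (2 * (1 - \<alpha>) * q) * g q \<alpha> powr (1/2)"
    unfolding SG_tilde_core_def Let_def using pow[OF Gp G, of q \<alpha> "1/2"]
    by (simp add: g_def pow[OF A dA] del: of_real_mult flip: of_real_mult)
  show ?thesis
  proof (cases "a = 0 \<or> b = 0")
    case True
    then show ?thesis unfolding 1 2 by (auto simp: g_def)
  next
    case False
    then have pos: "0 < a" "0 < b" using ab by auto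
    have g: "g r s = a powr (r * s - r) * b powr (r * s)" for r s
      using pos by (simp add: g_def powr_mult powr_powr powr_add[symmetric] powr_diff[symmetric] algebra_simps)
    have e: "Re (det (SG_core \<alpha> p A B)) = (a powr (1 - \<alpha>) * b powr \<alpha>) powr p"
      "Re (det (SG_tilde_core \<alpha> q A B)) = (a powr (1 - \<alpha>) * b powr \<alpha>) powr q"
      unfolding 1 2 g using pos
      by (simp_all add: powr_def ln_mult exp_add[symmetric] field_simps)
    show ?thesis unfolding e using p pos by (simp add: powr_powr)
  qed
qed

text \<open>Testing the implication at \<open>c = y powr (1/q)\<close>, with \<open>y\<close> the
  partial product for \<open>Y\<close>, gives the inequality of partial products, since the outer
  powers commute with products. As \<open>c\<close> must be positive, \<open>y = 0\<close> is a
  separate case.\<close>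

lemma log_maj_psd_pow:
  assumes X: "psd_mat n X" and Y: "psd_mat n Y" and pq: "0 < p" "0 < q"
    and le: "\<And>k c. k \<le> n \<Longrightarrow> 0 < c \<Longrightarrow> 
      loewner_le (ksub_num n k) (compound n k Y) ((c powr q) \<cdot>\<^sub>r 1\<^sub>m (ksub_num n k)) \<Longrightarrow>
      loewner_le (ksub_num n k) (compound n k X) ((c powr p) \<cdot>\<^sub>r 1\<^sub>m (ksub_num n k))"
    and det: "Re (det X) powr (1/p) = Re (det Y) powr (1/q)"
  shows "log_maj n (psd_pow X (1/p)) (psd_pow Y (1/q))"
  unfolding log_maj_def
proof (intro conjI ballI)
  have ev: "(\<Prod>i<k. eigvals_desc (psd_pow Z (1/r)) ! i) = (\<Prod>i<k. eigvals_desc Z ! i) powr (1/r)"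
    if "psd_mat n Z" "0 < r" "k \<le> n" for Z r k
    using that by (simp add: eigvals_desc_psd_pow[OF that(1)] prod_powr_distrib)
  show "(\<Prod>i<n. eigvals_desc (psd_pow X (1/p)) ! i) = (\<Prod>i<n. eigvals_desc (psd_pow Y (1/q)) ! i)"
    unfolding ev[OF X pq(1) order_refl] ev[OF Y pq(2) order_refl] prod_eigvals_desc[OF X] prod_eigvals_desc[OF Y]
    by (rule det)
  fix k assume "k \<in> {1..n}"
  then have k: "k \<le> n" by simp
  define x where "x = (\<Prod>i<k. eigvals_desc X ! i)"
  define y where "y = (\<Prod>i<k. eigvals_desc Y ! i)"
  have xy: "0 \<le> x" "0 \<le> y" unfolding x_def y_def
    using k eigvals_desc_nonneg[OF X] eigvals_desc_nonneg[OF Y] by (auto intro!: prod_nonneg)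
  have imp: "x \<le> c powr p" if "0 < c" "y \<le> c powr q" for c
    using le[OF k that(1)] that(2) unfolding compound_le_iff[OF X k] compound_le_iff[OF Y k] x_def y_def .
  have "x powr (1/p) \<le> y powr (1/q)"
  proof (cases "y = 0")
    case True
    have "x = 0"
    proof (rule ccontr)
      assume "x \<noteq> 0"
      then have "0 < x" using xy by simp
      \<comment> \<open>With \<open>y = 0\<close> every positive \<open>c\<close> is admissible; the
        one with \<open>c^p = x/2\<close> forces \<open>x \<le> x/2\<close>.\<close>
      then have "x \<le> ((x/2) powr (1/p)) powr p" using True by (intro imp) auto
      also have "\<dots> = x / 2" using pq \<open>0 < x\<close> by (simp add: powr_powr)
      finally show False using \<open>0 < x\<close> by simp
    qed
    then show ?thesis by simp
  next
    case False
    then have y: "0 < y" using xy by simp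
    then have "x \<le> (y powr (1/q)) powr p" using pq by (intro imp) (auto simp: powr_powr)
    then have "x powr (1/p) \<le> ((y powr (1/q)) powr p) powr (1/p)" using xy pq by (intro powr_mono2) auto
    then show ?thesis using pq y by (simp add: powr_powr)
  qed
  then show "(\<Prod>i<k. eigvals_desc (psd_pow X (1/p)) ! i) \<le> (\<Prod>i<k. eigvals_desc (psd_pow Y (1/q)) ! i)"
    using ev[OF X pq(1) k] ev[OF Y pq(2) k] by (simp add: x_def y_def)
qed

lemma mult_supp_of_supp_proj_le:
  assumes A: "psd_mat n A" and B: "psd_mat n B"
    and le: "loewner_le n (supp_proj B) (supp_proj A)"
  shows "B * psd_pow A 0 = B"
proof -
  have "psd_pow B 0 * psd_pow A 0 = psd_pow B 0"
    using loewner_supp[OF psd_pow_psd[OF A] psd_pow_psd[OF B] le[unfolded supp_proj_eq[OF A] supp_proj_eq[OF B]]]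
    by (simp add: psd_pow_pow[OF A])
  moreover have "B * psd_pow B 0 = B"
    using psd_pow_mult[OF B, of 1 0] by (simp add: psd_pow_1[OF B])
  ultimately show ?thesis
    using A B psd_matD(2)[OF B] by (metis assoc_mult_mat psd_pow_carrier)
qed

lemma compound_supp:
  assumes A: "psd_mat n A" and B: "psd_mat n B" and supp: "B * psd_pow A 0 = B"
  shows "compound n k B * psd_pow (compound n k A) 0 = compound n k B"
proof -
  have "compound n k (B * psd_pow A 0) = compound n k B" by (simp only: supp)
  then show ?thesis
    using A psd_matD(2)[OF B] by (simp add: compound_mult compound_psd_pow)
qed

lemma log_maj_SG_SG_tilde:
  assumes A: "psd_mat n A" and B: "psd_mat n B" and le: "loewner_le n (supp_proj B) (supp_proj A)"
    and \<alpha>: "1 < \<alpha>" and pq: "0 < p" "0 < q" "p \<le> q"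
  shows "log_maj n (SG \<alpha> p A B) (SG_tilde \<alpha> q A B)"
  unfolding SG_eq[OF A] SG_tilde_eq[OF A]
proof (rule log_maj_psd_pow[OF SG_core_psd[OF A B] SG_tilde_core_psd[OF A B] pq(1,2)])
  note supp = compound_supp[OF A B mult_supp_of_supp_proj_le[OF A B le]]
  show "loewner_le (ksub_num n k) (compound n k (SG_core \<alpha> p A B)) ((c powr p) \<cdot>\<^sub>r 1\<^sub>m (ksub_num n k))"
    if "0 < c" "loewner_le (ksub_num n k) (compound n k (SG_tilde_core \<alpha> q A B)) ((c powr q) \<cdot>\<^sub>r 1\<^sub>m (ksub_num n k))" for k c
    using SG_tilde_core_le_imp_SG_core_le[OF compound_psd[OF A] compound_psd[OF B] supp \<alpha> pq(1,3) that(1)] that(2)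
    unfolding compound_SG_core[OF A B] compound_SG_tilde_core[OF A B] by blast
qed (rule det_SG_core_eq[OF A B pq(1,2)])

lemma log_maj_SG_tilde_SG:
  assumes A: "psd_mat n A" and B: "psd_mat n B" and le: "loewner_le n (supp_proj B) (supp_proj A)"
    and \<alpha>: "0 < \<alpha>" "\<alpha> < 1" and pq: "0 < p" "0 < q" "q \<le> p" "q * (1 - \<alpha>) \<le> p * \<alpha>"
  shows "log_maj n (SG_tilde \<alpha> q A B) (SG \<alpha> p A B)"
  unfolding SG_eq[OF A] SG_tilde_eq[OF A]
proof (rule log_maj_psd_pow[OF SG_tilde_core_psd[OF A B] SG_core_psd[OF A B] pq(2,1)])
  note supp = compound_supp[OF A B mult_supp_of_supp_proj_le[OF A B le]]
  show "loewner_le (ksub_num n k) (compound n k (SG_tilde_core \<alpha> q A B)) ((c powr q) \<cdot>\<^sub>r 1\<^sub>m (ksub_num n k))"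
    if "0 < c" "loewner_le (ksub_num n k) (compound n k (SG_core \<alpha> p A B)) ((c powr p) \<cdot>\<^sub>r 1\<^sub>m (ksub_num n k))" for k c
    using SG_core_le_imp_SG_tilde_core_le[OF compound_psd[OF A] compound_psd[OF B] supp \<alpha> pq that(1)] that(2)
    unfolding compound_SG_core[OF A B] compound_SG_tilde_core[OF A B] by blast
qed (rule det_SG_core_eq[OF A B pq(1,2), symmetric])

subsection \<open>Rank one limits of two by two matrices\<close>

lemma det_2x2:
  assumes "A \<in> carrier_mat 2 2"
  shows "det (A :: complex mat) = A $$ (0,0) * A $$ (1,1) - A $$ (0,1) * A $$ (1,0)"
proof -
  have "det A = (\<Sum>j<2. A $$ (0,j) * cofactor A 0 j)"
    by (rule laplace_expansion_row[OF assms]) simp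
  moreover have "mat_delete A 0 j \<in> carrier_mat 1 1" for j using assms by (auto simp: mat_delete_def)
  ultimately show ?thesis
    using assms by (simp add: numeral_2_eq_2 cofactor_def det_single mat_delete_def)
qed

lemma mult_index_2x2:
  assumes "A \<in> carrier_mat 2 2" "B \<in> carrier_mat 2 2" "i < 2" "j < 2"
  shows "(A * B) $$ (i, j) = A $$ (i,0) * B $$ (0,j) + A $$ (i,1) * (B $$ (1,j) :: complex)"
  using assms by (simp add: scalar_prod_def numeral_2_eq_2)

definition trace2 :: "complex mat \<Rightarrow> real" where
  "trace2 A = Re (A $$ (0,0) + A $$ (1,1))"

lemma unitary_col_norm:
  assumes "unitary_mat n U" "k < n"
  shows "(\<Sum>i<n. U $$ (i,k) * cnj (U $$ (i,k))) = 1"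
proof -
  note U = unitary_matD[OF assms(1)]
  have "(mat_adjoint U * U) $$ (k,k) = (\<Sum>i<n. U $$ (i,k) * cnj (U $$ (i,k)))"
    using U(1) assms(2) by (auto simp: scalar_prod_def atLeast0LessThan mult.commute intro!: sum.cong)
  then show ?thesis using U(3) assms(2) by simp
qed

lemma trace2_diag_conj:
  assumes U: "unitary_mat 2 U"
  shows "trace2 (udiag 2 U d) = d 0 + d 1"
proof -
  note U' = unitary_matD[OF U]
  let ?A = "udiag 2 U d"
  have "?A $$ (0,0) + ?A $$ (1,1) = (\<Sum>i<2. \<Sum>k<2. U $$ (i,k) * complex_of_real (d k) * cnj (U $$ (i,k)))"
    using conj_diag_index[OF U'(1)] by (simp add: numeral_2_eq_2)
  also have "\<dots> = (\<Sum>k<2. \<Sum>i<2. U $$ (i,k) * complex_of_real (d k) * cnj (U $$ (i,k)))"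
    by (rule sum.swap)
  also have "\<dots> = (\<Sum>k<2. complex_of_real (d k) * (\<Sum>i<2. U $$ (i,k) * cnj (U $$ (i,k))))"
    by (simp add: sum_distrib_left mult_ac)
  also have "\<dots> = (\<Sum>k<2. complex_of_real (d k))"
    by (intro sum.cong refl) (simp add: unitary_col_norm[OF U])
  finally show ?thesis by (simp add: trace2_def numeral_2_eq_2)
qed

lemma unitary_entry_le:
  assumes "unitary_mat n U" "i < n" "k < n"
  shows "cmod (U $$ (i,k)) \<le> 1"
proof -
  have "complex_of_real (\<Sum>i<n. (cmod (U $$ (i,k)))\<^sup>2) = 1"
    using unitary_col_norm[OF assms(1,3)] by (simp add: complex_norm_square[symmetric])
  then have "(\<Sum>i<n. (cmod (U $$ (i,k)))\<^sup>2) = 1" by (metis of_real_eq_1_iff)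
  moreover have "(cmod (U $$ (i,k)))\<^sup>2 \<le> (\<Sum>i<n. (cmod (U $$ (i,k)))\<^sup>2)"
    by (rule member_le_sum) (use assms in auto)
  ultimately have "(cmod (U $$ (i,k)))\<^sup>2 \<le> 1\<^sup>2" by simp
  then show ?thesis by (rule power2_le_imp_le) simp
qed

text \<open>\<open>l\<close> and \<open>m\<close> are the eigenvalues, read off from trace and
  determinant, and \<open>Z^r - l^(r-1) Z\<close> is \<open>m^r - l^(r-1) m\<close> times a rank one
  projection, whose entries are at most 1 in modulus. This describes \<open>Z^r\<close> near a rank
  one limit without any control of eigenvectors.\<close>

lemma psd_pow_2x2_approx:
  fixes r :: real
  assumes Z: "psd_mat 2 Z" and ij: "i < 2" "j < 2"
  defines "s \<equiv> sqrt ((trace2 Z)\<^sup>2 - 4 * Re (det Z))"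
  defines "l \<equiv> (trace2 Z + s) / 2" and "m \<equiv> (trace2 Z - s) / 2"
  shows "cmod (psd_pow Z r $$ (i,j) - complex_of_real (l powr (r - 1)) * Z $$ (i,j)) \<le>
      \<bar>m powr r - l powr (r - 1) * m\<bar>" and "0 \<le> m"
proof -
  obtain U d where U: "unitary_mat 2 U" and d: "\<forall>i<2. 0 \<le> d i"
    and mono: "\<And>i j. i \<le> j \<Longrightarrow> j < 2 \<Longrightarrow> d j \<le> d i"
    and ZU: "Z = udiag 2 U d"
    using psd_spectral_sorted[OF Z] by blast
  note U' = unitary_matD[OF U]
  have dd: "0 \<le> d 0" "0 \<le> d 1" "d 1 \<le> d 0" using d mono[of 0 1] by auto
  have t: "trace2 Z = d 0 + d 1" unfolding ZU by (rule trace2_diag_conj[OF U])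
  have "Re (det Z) = d 0 * d 1" unfolding ZU det_diag_conj[OF U] by (simp add: numeral_2_eq_2)
  then have "(trace2 Z)\<^sup>2 - 4 * Re (det Z) = (d 0 - d 1)\<^sup>2" by (simp add: t power2_eq_square algebra_simps)
  then have s: "s = d 0 - d 1" using dd by (simp add: s_def)
  then have lm: "l = d 0" "m = d 1" by (simp_all add: l_def m_def t)
  show "0 \<le> m" using dd lm by simp
  have z: "Z $$ (i,j) = (\<Sum>k<2. U $$ (i,k) * complex_of_real (d k) * cnj (U $$ (j,k)))"
    unfolding ZU using conj_diag_index[OF U'(1) ij] by simp
  have zr: "psd_pow Z r $$ (i,j) = (\<Sum>k<2. U $$ (i,k) * complex_of_real (d k powr r) * cnj (U $$ (j,k)))"
    unfolding psd_pow_diag[OF U d ZU] using conj_diag_index[OF U'(1) ij] by simp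
  have d0: "d 0 powr (r - 1) * d 0 = d 0 powr r"
    using dd by (cases "d 0 = 0") (auto simp: powr_diff)
  have "psd_pow Z r $$ (i,j) - complex_of_real (l powr (r - 1)) * Z $$ (i,j) =
     U $$ (i,0) * cnj (U $$ (j,0)) * complex_of_real (d 0 powr r - d 0 powr (r - 1) * d 0) +
     U $$ (i,1) * cnj (U $$ (j,1)) * complex_of_real (d 1 powr r - d 0 powr (r - 1) * d 1)"
    unfolding z zr lm by (simp add: numeral_2_eq_2 algebra_simps)
  also have "\<dots> = U $$ (i,1) * cnj (U $$ (j,1)) * complex_of_real (m powr r - l powr (r - 1) * m)"
    unfolding d0 lm by simp
  finally have "cmod (psd_pow Z r $$ (i,j) - complex_of_real (l powr (r - 1)) * Z $$ (i,j)) =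
      cmod (U $$ (i,1)) * cmod (U $$ (j,1)) * \<bar>m powr r - l powr (r - 1) * m\<bar>"
    by (simp only: norm_mult norm_of_real complex_mod_cnj)
  also have "\<dots> \<le> 1 * 1 * \<bar>m powr r - l powr (r - 1) * m\<bar>"
    using unitary_entry_le[OF U] ij by (intro mult_right_mono mult_mono) auto
  finally show "cmod (psd_pow Z r $$ (i,j) - complex_of_real (l powr (r - 1)) * Z $$ (i,j)) \<le>
      \<bar>m powr r - l powr (r - 1) * m\<bar>" by simp
qed

section \<open>Limits at rank one matrices\<close>

definition mtends :: "(real \<Rightarrow> complex mat) \<Rightarrow> complex mat \<Rightarrow> bool" where
  "mtends M L \<longleftrightarrow> L \<in> carrier_mat 2 2 \<and> (\<forall>e. M e \<in> carrier_mat 2 2) \<and>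
     (\<forall>i<2. \<forall>j<2. ((\<lambda>e. M e $$ (i,j)) \<longlongrightarrow> L $$ (i,j)) (at_right 0))"

lemma mtends_const: "A \<in> carrier_mat 2 2 \<Longrightarrow> mtends (\<lambda>e. A) A"
  by (simp add: mtends_def)

lemma mtends_mult:
  assumes "mtends M L" "mtends N K"
  shows "mtends (\<lambda>e. M e * N e) (L * K)"
  using assms unfolding mtends_def by (auto simp: mult_index_2x2 intro!: tendsto_intros)

lemma mtends_trace2:
  assumes "mtends M L"
  shows "((\<lambda>e. trace2 (M e)) \<longlongrightarrow> trace2 L) (at_right 0)"
  using assms unfolding mtends_def trace2_def by (intro tendsto_intros) auto

lemma mtends_det:
  assumes "mtends M L"
  shows "((\<lambda>e. Re (det (M e))) \<longlongrightarrow> Re (det L)) (at_right 0)"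
  using assms unfolding mtends_def by (auto simp: det_2x2 intro!: tendsto_intros)

definition outer :: "(nat \<Rightarrow> real) \<Rightarrow> complex mat" where
  "outer v = mat 2 2 (\<lambda>(i,j). complex_of_real (v i * v j))"

abbreviation real_diag :: "(nat \<Rightarrow> real) \<Rightarrow> complex mat" where
  "real_diag a \<equiv> mat_diag 2 (\<lambda>i. complex_of_real (a i))"

lemma outer_carrier [simp]: "outer v \<in> carrier_mat 2 2"
  by (simp add: outer_def)

lemma less_2: "i < 2 \<longleftrightarrow> i = 0 \<or> i = Suc 0" for i :: nat
  by auto

lemma smult_outer_index:
  "i < 2 \<Longrightarrow> j < 2 \<Longrightarrow> (c \<cdot>\<^sub>r outer v) $$ (i,j) = complex_of_real (c * v i * v j)"
  by (simp add: outer_def mult.assoc)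

definition real_mat2 :: "(nat \<Rightarrow> nat \<Rightarrow> real) \<Rightarrow> complex mat" where
  "real_mat2 f = mat 2 2 (\<lambda>(i,j). complex_of_real (f i j))"

lemma real_mat2_mult:
  "real_mat2 f * real_mat2 g = real_mat2 (\<lambda>i j. f i 0 * g 0 j + f i 1 * g 1 j)"
  by (rule eq_matI) (auto simp: real_mat2_def mult_index_2x2 simp del: index_mult_mat(1))

lemma real_mat2_eqI:
  assumes "f 0 0 = g 0 0" "f 0 1 = g 0 1" "f 1 0 = g 1 0" "f 1 1 = g 1 1"
  shows "real_mat2 f = real_mat2 g"
  using assms by (intro eq_matI) (auto simp: real_mat2_def less_2)

lemma smult_outer_real_mat2:
  "c \<cdot>\<^sub>r outer v = real_mat2 (\<lambda>i j. c * v i * v j)"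
  by (rule eq_matI) (auto simp: real_mat2_def outer_def)

lemma outer_real_mat2: "outer v = real_mat2 (\<lambda>i j. v i * v j)"
  by (rule eq_matI) (auto simp: real_mat2_def outer_def)

lemma real_diag_real_mat2: "real_diag a = real_mat2 (\<lambda>i j. if i = j then a j else 0)"
  by (rule eq_matI) (auto simp: real_mat2_def mat_diag_def)

lemma real_diag_outer_real_diag:
  "real_diag a * (c \<cdot>\<^sub>r outer v) * real_diag a = c \<cdot>\<^sub>r outer (\<lambda>i. a i * v i)"
  unfolding smult_outer_real_mat2 real_diag_real_mat2 real_mat2_mult by (rule real_mat2_eqI) simp_all

lemma outer_real_diag_outer:
  "(c \<cdot>\<^sub>r outer v) * real_diag a * (c \<cdot>\<^sub>r outer v) =
   (c\<^sup>2 * (a 0 * (v 0)\<^sup>2 + a 1 * (v 1)\<^sup>2)) \<cdot>\<^sub>r outer v"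
  unfolding smult_outer_real_mat2 real_diag_real_mat2 real_mat2_mult
  by (rule real_mat2_eqI) (simp_all add: power2_eq_square algebra_simps)

lemma outer_outer_outer:
  "outer v * (c \<cdot>\<^sub>r outer u) * outer v =
   (c * (u 0 * v 0 + u 1 * v 1)\<^sup>2) \<cdot>\<^sub>r outer v"
  unfolding smult_outer_real_mat2 unfolding outer_real_mat2 real_mat2_mult
  by (rule real_mat2_eqI) (simp_all add: power2_eq_square algebra_simps)

lemma trace2_smult_outer:
  "trace2 (c \<cdot>\<^sub>r outer v) = c * ((v 0)\<^sup>2 + (v 1)\<^sup>2)"
  by (simp add: trace2_def smult_outer_index power2_eq_square algebra_simps del: index_smult_mat(1))

lemma det_smult_outer: "det (c \<cdot>\<^sub>r outer v) = 0"
  by (subst det_2x2) (simp_all add: smult_outer_index mult_ac del: index_smult_mat(1) det_smult)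

text \<open>The smaller eigenvalue tends to 0, so for \<open>r > 0\<close> the error in
  \<open>psd_pow_2x2_approx\<close> vanishes and \<open>Z^r\<close> behaves like
  \<open>l^(r-1) Z\<close>. The larger one tends to \<open>t\<close>, the nonzero eigenvalue of the
  limit.\<close>

lemma mtends_psd_pow:
  assumes psd: "\<And>e. psd_mat 2 (Z e)" and lim: "mtends Z (c \<cdot>\<^sub>r outer v)"
    and t: "t = c * ((v 0)\<^sup>2 + (v 1)\<^sup>2)" "0 < t" and r: "0 < r"
  shows "mtends (\<lambda>e. psd_pow (Z e) r) ((t powr (r - 1) * c) \<cdot>\<^sub>r outer v)"
proof -
  define s where "s e = sqrt ((trace2 (Z e))\<^sup>2 - 4 * Re (det (Z e)))" for e
  define l where "l e = (trace2 (Z e) + s e) / 2" for e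
  define m where "m e = (trace2 (Z e) - s e) / 2" for e
  have tr: "((\<lambda>e. trace2 (Z e)) \<longlongrightarrow> t) (at_right 0)"
    using mtends_trace2[OF lim] by (simp add: trace2_smult_outer t)
  have dt: "((\<lambda>e. Re (det (Z e))) \<longlongrightarrow> 0) (at_right 0)"
    using mtends_det[OF lim] by (simp only: det_smult_outer) simp
  have "(s \<longlongrightarrow> sqrt (t\<^sup>2 - 4 * 0)) (at_right 0)"
    unfolding s_def by (intro tendsto_intros tr dt)
  then have s: "(s \<longlongrightarrow> t) (at_right 0)" using t by simp
  have "(l \<longlongrightarrow> (t + t) / 2) (at_right 0)" unfolding l_def by (intro tendsto_intros tr s) simp
  then have l: "(l \<longlongrightarrow> t) (at_right 0)" by simp
  have "(m \<longlongrightarrow> (t - t) / 2) (at_right 0)" unfolding m_def by (intro tendsto_intros tr s) simp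
  then have m: "(m \<longlongrightarrow> 0) (at_right 0)" by simp
  have lr: "((\<lambda>e. l e powr (r - 1)) \<longlongrightarrow> t powr (r - 1)) (at_right 0)"
    using t by (intro tendsto_powr l tendsto_const) auto
  have m0: "0 \<le> m e" for e using psd_pow_2x2_approx(2)[OF psd, of 0 0 e] by (simp add: m_def s_def)
  have "((\<lambda>e. m e powr r) \<longlongrightarrow> 0) (at_right 0)"
    using m0 r by (intro tendsto_zero_powrI[OF m tendsto_const]) auto
  then have "((\<lambda>e. \<bar>m e powr r - l e powr (r - 1) * m e\<bar>) \<longlongrightarrow> \<bar>0 - t powr (r - 1) * 0\<bar>) (at_right 0)"
    by (intro tendsto_intros lr m)
  then have bound: "((\<lambda>e. \<bar>m e powr r - l e powr (r - 1) * m e\<bar>) \<longlongrightarrow> 0) (at_right 0)" by simp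
  show ?thesis
    unfolding mtends_def
  proof (intro conjI allI impI)
    fix i j :: nat assume ij: "i < 2" "j < 2"
    have "cmod (psd_pow (Z e) r $$ (i,j) - complex_of_real (l e powr (r - 1)) * Z e $$ (i,j)) \<le>
        \<bar>m e powr r - l e powr (r - 1) * m e\<bar>" for e
      using psd_pow_2x2_approx(1)[OF psd ij, of e r] by (simp add: l_def m_def s_def)
    then have "((\<lambda>e. psd_pow (Z e) r $$ (i,j) - complex_of_real (l e powr (r - 1)) * Z e $$ (i,j)) \<longlongrightarrow> 0) (at_right 0)"
      by (intro tendsto_norm_zero_cancel[OF tendsto_sandwich[OF _ _ tendsto_const bound]] always_eventually) auto
    moreover have "((\<lambda>e. complex_of_real (l e powr (r - 1)) * Z e $$ (i,j)) \<longlongrightarrow>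
        complex_of_real (t powr (r - 1)) * (c \<cdot>\<^sub>r outer v) $$ (i,j)) (at_right 0)"
      using lim ij unfolding mtends_def by (intro tendsto_mult tendsto_of_real lr) auto
    ultimately have "((\<lambda>e. (psd_pow (Z e) r $$ (i,j) - complex_of_real (l e powr (r - 1)) * Z e $$ (i,j)) +
        complex_of_real (l e powr (r - 1)) * Z e $$ (i,j)) \<longlongrightarrow>
        0 + complex_of_real (t powr (r - 1)) * (c \<cdot>\<^sub>r outer v) $$ (i,j)) (at_right 0)"
      by (rule tendsto_add)
    then show "((\<lambda>e. psd_pow (Z e) r $$ (i,j)) \<longlongrightarrow>
        ((t powr (r - 1) * c) \<cdot>\<^sub>r outer v) $$ (i,j)) (at_right 0)"
      unfolding smult_outer_index[OF ij] by (simp add: mult.assoc)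
  qed (use psd in auto)
qed

text \<open>The columns of \<open>Y\<close> are \<open>v\<close> and \<open>e\<close> times
  \<open>v\<close> turned by a right angle. The result is \<open>outer v\<close> plus
  \<open>e^2\<close> times the orthogonal rank one matrix: positive definite for
  \<open>e > 0\<close> and nonzero \<open>v\<close>, and tending to \<open>outer v\<close>.\<close>

definition gram2 :: "(nat \<Rightarrow> real) \<Rightarrow> real \<Rightarrow> complex mat" where
  "gram2 v e = (let Y = mat 2 2 (\<lambda>(i,j). complex_of_real
       (if j = 0 then v i else if i = 0 then - e * v 1 else e * v 0)) in Y * mat_adjoint Y)"

lemma gram2_psd: "psd_mat 2 (gram2 v e)"
  unfolding gram2_def Let_def by (rule psd_gram) simp

lemma gram2_index:
  "gram2 v e $$ (0,0) = complex_of_real ((v 0)\<^sup>2 + e\<^sup>2 * (v 1)\<^sup>2)"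
  "gram2 v e $$ (0,Suc 0) = complex_of_real (v 0 * v 1 * (1 - e\<^sup>2))"
  "gram2 v e $$ (Suc 0,0) = complex_of_real (v 0 * v 1 * (1 - e\<^sup>2))"
  "gram2 v e $$ (Suc 0,Suc 0) = complex_of_real ((v 1)\<^sup>2 + e\<^sup>2 * (v 0)\<^sup>2)"
  by (simp_all add: gram2_def Let_def mult_index_2x2 power2_eq_square algebra_simps
      del: index_mult_mat(1))

lemma gram2_det: "det (gram2 v e) = complex_of_real ((e * ((v 0)\<^sup>2 + (v 1)\<^sup>2))\<^sup>2)"
proof -
  have "det (gram2 v e) = complex_of_real (((v 0)\<^sup>2 + e\<^sup>2 * (v 1)\<^sup>2) * ((v 1)\<^sup>2 + e\<^sup>2 * (v 0)\<^sup>2) - (v 0 * v 1 * (1 - e\<^sup>2))\<^sup>2)"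
    using psd_matD(2)[OF gram2_psd] by (subst det_2x2) (simp_all add: gram2_index power2_eq_square)
  also have "((v 0)\<^sup>2 + e\<^sup>2 * (v 1)\<^sup>2) * ((v 1)\<^sup>2 + e\<^sup>2 * (v 0)\<^sup>2) - (v 0 * v 1 * (1 - e\<^sup>2))\<^sup>2 = (e * ((v 0)\<^sup>2 + (v 1)\<^sup>2))\<^sup>2"
    by (simp add: power2_eq_square algebra_simps)
  finally show ?thesis .
qed

lemma gram2_mtends: "mtends (gram2 v) (1 \<cdot>\<^sub>r outer v)"
proof -
  have e2: "((\<lambda>e::real. e\<^sup>2) \<longlongrightarrow> 0) (at_right 0)"
    by (rule tendsto_eq_rhs[of _ "0\<^sup>2"]) (auto intro!: tendsto_intros)
  have "((\<lambda>e. (v 0)\<^sup>2 + e\<^sup>2 * (v 1)\<^sup>2) \<longlongrightarrow> (v 0)\<^sup>2 + 0 * (v 1)\<^sup>2) (at_right 0)"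
    "((\<lambda>e. (v 1)\<^sup>2 + e\<^sup>2 * (v 0)\<^sup>2) \<longlongrightarrow> (v 1)\<^sup>2 + 0 * (v 0)\<^sup>2) (at_right 0)"
    "((\<lambda>e. v 0 * v 1 * (1 - e\<^sup>2)) \<longlongrightarrow> v 0 * v 1 * (1 - 0)) (at_right 0)"
    by (intro tendsto_intros e2)+
  from this[THEN tendsto_of_real[where 'a = complex]] show ?thesis
    unfolding mtends_def using psd_matD(2)[OF gram2_psd]
    by (auto simp: less_2 gram2_index smult_outer_index power2_eq_square mult.commute
        simp del: index_smult_mat(1) one_smult_mat of_real_1)
qed

lemma pd_of_psd_det:
  assumes A: "psd_mat n A" and det: "det A \<noteq> 0"
  shows "pd_mat n A" "psd_pow A 0 = 1\<^sub>m n"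
proof -
  obtain U d where U: "unitary_mat n U" and d: "\<forall>i<n. 0 \<le> d i"
    and AU: "A = udiag n U d"
    using psd_spectral[OF A] by blast
  note U' = unitary_matD[OF U]
  have "d i \<noteq> 0" if "i < n" for i using det that unfolding AU det_diag_conj[OF U] by auto
  with d have pos: "0 < d i" if "i < n" for i using that by (simp add: less_le)
  have "psd_pow A 0 = 1 \<cdot>\<^sub>r 1\<^sub>m n"
    unfolding psd_pow_diag[OF U d AU] one_eq_diag[OF U] by (rule diag_conj_cong) (use pos in force)
  then show "psd_pow A 0 = 1\<^sub>m n" by simp
  have "0 < qform A v" if v: "v \<in> carrier_vec n" "v \<noteq> 0\<^sub>v n" for v
  proof -
    define w where "w = mat_adjoint U *\<^sub>v v"
    have w: "w \<in> carrier_vec n" using U' v by (simp add: w_def)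
    have "U *\<^sub>v w = (U * mat_adjoint U) *\<^sub>v v"
      unfolding w_def using U'(1) v by (simp add: assoc_mult_mat_vec[of _ n n _ n])
    then have "U *\<^sub>v w = v" using U'(2) v by simp
    then have "w \<noteq> 0\<^sub>v n" using v(2) mult_zero_vec[OF U'(1)] by auto
    then obtain i where i: "i < n" "w $ i \<noteq> 0"
      using w by (metis carrier_vecD eq_vecI index_zero_vec)
    have "0 < (\<Sum>i<n. d i * (cmod (w $ i))\<^sup>2)"
      by (rule sum_pos2[of _ i]) (use i pos d in auto)
    then show ?thesis unfolding AU qform_diag[OF U v(1)] w_def .
  qed
  then show "pd_mat n A" using A by (auto simp: pd_mat_alt psd_mat_alt)
qed

lemma psd_pow_det_nonzero:
  assumes "psd_mat n A" "det A \<noteq> 0"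
  shows "det (psd_pow A r) \<noteq> 0"
  using assms det_psd_pow[OF assms(1)] by auto

lemma unitary_one: "unitary_mat n (1\<^sub>m n)"
  by (rule unitary_matI) auto

lemma real_diag_eq: "real_diag a = 1\<^sub>m 2 * real_diag a * mat_adjoint (1\<^sub>m 2)"
  by (simp add: left_mult_one_mat[of _ 2 2] right_mult_one_mat[of _ 2 2])

lemma real_diag_psd: "0 \<le> a 0 \<Longrightarrow> 0 \<le> a 1 \<Longrightarrow> psd_mat 2 (real_diag a)"
  using psd_diag_iff[OF unitary_one[of 2], of a] real_diag_eq[of a] by (auto simp: less_2)

lemma real_diag_pow:
  assumes "0 \<le> a 0" "0 \<le> a 1"
  shows "psd_pow (real_diag a) r = real_diag (\<lambda>i. a i powr r)"
  using psd_pow_diag[OF unitary_one _ real_diag_eq, of a r] assms real_diag_eq[of "\<lambda>i. a i powr r"] by (auto simp: less_2)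

lemma real_diag_det: "det (real_diag a) = complex_of_real (a 0 * a 1)"
  by (subst det_2x2) (auto simp: mat_diag_def)

text \<open>Lets the trace, whose limits are easy to compute, replace the largest eigenvalue at the
  cost of a factor 2. Such factors do no harm in the counterexamples, where one side is
  unbounded.\<close>

lemma eigval_trace2_bounds:
  assumes "psd_mat 2 X"
  shows "eigvals_desc X ! 0 \<le> trace2 X" "trace2 X \<le> 2 * eigvals_desc X ! 0"
    "loewner_le 2 X (c \<cdot>\<^sub>r 1\<^sub>m 2) \<longleftrightarrow> eigvals_desc X ! 0 \<le> c"
    "trace2 (psd_pow X r) \<le> 2 * trace2 X powr r \<or> r < 0"
proof -
  obtain U d where U: "unitary_mat 2 U" and d: "\<forall>i<2. 0 \<le> d i"
    and mono: "\<And>i j. i \<le> j \<Longrightarrow> j < 2 \<Longrightarrow> d j \<le> d i"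
    and XU: "X = udiag 2 U d"
    using psd_spectral_sorted[OF assms] by blast
  have "eigvals_desc X = map d [0..<2]"
    unfolding XU by (rule eigvals_desc_diag_conj_sorted[OF U mono])
  then have ev: "eigvals_desc X ! 0 = d 0" by simp
  have tr: "trace2 X = d 0 + d 1" unfolding XU by (rule trace2_diag_conj[OF U])
  have dd: "0 \<le> d 0" "0 \<le> d 1" "d 1 \<le> d 0" using d mono[of 0 1] by auto
  show "eigvals_desc X ! 0 \<le> trace2 X" "trace2 X \<le> 2 * eigvals_desc X ! 0" using dd ev tr by auto
  show "loewner_le 2 X (c \<cdot>\<^sub>r 1\<^sub>m 2) \<longleftrightarrow> eigvals_desc X ! 0 \<le> c"
    unfolding ev unfolding XU loewner_diag_scalar_iff[OF U] using dd by (auto simp: less_2)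
  show "trace2 (psd_pow X r) \<le> 2 * trace2 X powr r \<or> r < 0"
  proof (cases "r < 0")
    case False
    then have "d 0 powr r + d 1 powr r \<le> trace2 X powr r + trace2 X powr r"
      using dd tr by (intro add_mono powr_mono2) auto
    moreover have "trace2 (psd_pow X r) = d 0 powr r + d 1 powr r"
      unfolding psd_pow_diag[OF U d XU] by (rule trace2_diag_conj[OF U])
    ultimately show ?thesis by simp
  qed simp
qed

lemma log_maj_eigval:
  assumes X: "psd_mat 2 X" and Y: "psd_mat 2 Y" and pq: "0 < p" "0 < q"
    and maj: "log_maj 2 (psd_pow X (1/p)) (psd_pow Y (1/q))"
  shows "(eigvals_desc X ! 0) powr (1/p) \<le> (eigvals_desc Y ! 0) powr (1/q)"
    "(trace2 X / 2) powr (1/p) \<le> trace2 Y powr (1/q)"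
proof -
  have "(\<Prod>i<1. eigvals_desc (psd_pow X (1/p)) ! i) \<le> (\<Prod>i<1. eigvals_desc (psd_pow Y (1/q)) ! i)"
    using maj unfolding log_maj_def by (metis atLeastAtMost_iff one_le_numeral order_refl)
  then show *: "(eigvals_desc X ! 0) powr (1/p) \<le> (eigvals_desc Y ! 0) powr (1/q)"
    using pq eigvals_desc_psd_pow[OF X, of "1/p" 0] eigvals_desc_psd_pow[OF Y, of "1/q" 0] by simp
  have "(trace2 X / 2) powr (1/p) \<le> (eigvals_desc X ! 0) powr (1/p)"
    using pq eigval_trace2_bounds(1,2)[OF X] eigvals_desc_nonneg[OF X, of 0] by (intro powr_mono2) auto
  also note *
  also have "(eigvals_desc Y ! 0) powr (1/q) \<le> trace2 Y powr (1/q)"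
    using pq eigval_trace2_bounds(1)[OF Y] eigvals_desc_nonneg[OF Y, of 0] by (intro powr_mono2) auto
  finally show "(trace2 X / 2) powr (1/p) \<le> trace2 Y powr (1/q)" .
qed

subsection \<open>Necessary conditions\<close>

text \<open>For \<open>A = diag(x, 1)\<close> and \<open>B\<close> the rank one projection onto \<open>v = (\<surd>w, \<surd>(1 - w))\<close>, every quantity
  depends on \<open>A\<close> only through the moments \<open>\<langle>v, A\<^sup>s v\<rangle>\<close>.\<close>

definition moment :: "real \<Rightarrow> real \<Rightarrow> real \<Rightarrow> real" where
  "moment w x s = w * x powr s + (1 - w)"

lemma moment_pos: "0 < w \<Longrightarrow> w < 1 \<Longrightarrow> 0 < moment w x s"
  by (simp add: moment_def add_nonneg_pos)

definition weight_vec :: "real \<Rightarrow> nat \<Rightarrow> real" where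
  "weight_vec w i = (if i = 0 then sqrt w else sqrt (1 - w))"

definition diag_entry :: "real \<Rightarrow> nat \<Rightarrow> real" where
  "diag_entry x i = (if i = 0 then x else 1)"

text \<open>Covers both cores: (a, b, r) is (1/2, \<alpha>, p) for \<open>SG_core\<close> and
  (\<alpha>, 1/2, 2(1-\<alpha>)q) for \<open>SG_tilde_core\<close>. \<open>Z\<close> tends to
  \<open>outer u\<close> with \<open>u = A^(s/2) v\<close>, of squared length
  \<open>moment w x s\<close>. The power a only rescales this by \<open>moment^(a-1)\<close>, the
  outer factors of \<open>G\<close> turn \<open>u\<close> back into \<open>v\<close>, and
  compressing \<open>A^r\<close> to \<open>v\<close> leaves \<open>moment w x r\<close>.\<close>

lemma core_limit:
  assumes w: "0 < w" "w < 1" and x: "0 < x" and s: "0 < s" and a: "0 < a" and b: "0 < b"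
  defines "A \<equiv> real_diag (diag_entry x)"
  defines "Z \<equiv> \<lambda>e. sandwich s A (gram2 (weight_vec w) e)"
  defines "G \<equiv> \<lambda>e. psd_pow A (-s/2) * psd_pow (Z e) a * psd_pow A (-s/2)"
  shows "((\<lambda>e. trace2 (psd_pow (G e) b * psd_pow A r * psd_pow (G e) b)) \<longlongrightarrow>
    moment w x s powr (2 * (a - 1) * b) * moment w x r) (at_right 0)"
proof -
  have A: "psd_mat 2 A" unfolding A_def using x by (intro real_diag_psd) (auto simp: diag_entry_def)
  have Ap: "psd_pow A t = real_diag (\<lambda>i. diag_entry x i powr t)" for t
    unfolding A_def using x by (intro real_diag_pow) (auto simp: diag_entry_def)
  have Z: "psd_mat 2 (Z e)" and G: "psd_mat 2 (G e)" for e
    using A gram2_psd by (simp_all add: Z_def G_def)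
  have v2: "(weight_vec w 0)\<^sup>2 = w" "(weight_vec w 1)\<^sup>2 = 1 - w" using w by (simp_all add: weight_vec_def)
  let ?u = "\<lambda>i. diag_entry x i powr (s/2) * weight_vec w i"
  have m: "0 < moment w x t" for t using moment_pos w by blast
  have diag_entry_sq: "(diag_entry x i powr (s/2))\<^sup>2 = diag_entry x i powr s" for i
    using x by (simp add: diag_entry_def powr_powr flip: powr_numeral)
  have u2: "moment w x s = 1 * ((?u 0)\<^sup>2 + (?u 1)\<^sup>2)"
    unfolding power_mult_distrib diag_entry_sq v2 by (simp add: moment_def diag_entry_def mult.commute)
  have B: "mtends (\<lambda>e. psd_pow (gram2 (weight_vec w) e) s) (1 \<cdot>\<^sub>r outer (weight_vec w))"
    using mtends_psd_pow[OF gram2_psd gram2_mtends, of 1 "weight_vec w" s] s v2 by simp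
  have Zl: "mtends Z (1 \<cdot>\<^sub>r outer ?u)"
    unfolding Z_def sandwich_def Ap real_diag_outer_real_diag[symmetric]
    by (intro mtends_mult mtends_const B) simp_all
  from mtends_psd_pow[OF Z this u2 m a]
  have "mtends (\<lambda>e. psd_pow (Z e) a) ((moment w x s powr (a - 1) * 1) \<cdot>\<^sub>r outer ?u)" .
  then have "mtends G (real_diag (\<lambda>i. diag_entry x i powr (-s/2)) * ((moment w x s powr (a - 1) * 1) \<cdot>\<^sub>r outer ?u) * real_diag (\<lambda>i. diag_entry x i powr (-s/2)))"
    unfolding G_def Ap by (intro mtends_mult mtends_const) simp_all
  moreover have "(\<lambda>i. diag_entry x i powr (-s/2) * ?u i) = weight_vec w"
    using x by (auto simp: diag_entry_def powr_minus field_simps)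
  ultimately have Gl: "mtends G ((moment w x s powr (a - 1)) \<cdot>\<^sub>r outer (weight_vec w))"
    unfolding real_diag_outer_real_diag by simp
  have e: "moment w x s powr (a - 1) = moment w x s powr (a - 1) * ((weight_vec w 0)\<^sup>2 + (weight_vec w 1)\<^sup>2)"
    unfolding v2 by simp
  have "(moment w x s powr (a - 1)) powr (b - 1) * moment w x s powr (a - 1) = moment w x s powr ((a - 1) * b)"
    by (simp add: powr_powr powr_add[symmetric] algebra_simps)
  moreover have "0 < moment w x s powr (a - 1)" using m[of s] by simp
  ultimately have "mtends (\<lambda>e. psd_pow (G e) b) ((moment w x s powr ((a - 1) * b)) \<cdot>\<^sub>r outer (weight_vec w))"
    using mtends_psd_pow[OF G Gl e _ b] by simp
  then have "mtends (\<lambda>e. psd_pow (G e) b * psd_pow A r * psd_pow (G e) b)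
      (((moment w x s powr ((a - 1) * b)) \<cdot>\<^sub>r outer (weight_vec w)) * real_diag (\<lambda>i. diag_entry x i powr r) *
       ((moment w x s powr ((a - 1) * b)) \<cdot>\<^sub>r outer (weight_vec w)))"
    unfolding Ap by (intro mtends_mult mtends_const) simp_all
  from mtends_trace2[OF this]
  have "((\<lambda>e. trace2 (psd_pow (G e) b * psd_pow A r * psd_pow (G e) b)) \<longlongrightarrow>
      (moment w x s powr ((a - 1) * b))\<^sup>2 * (diag_entry x 0 powr r * (weight_vec w 0)\<^sup>2 + diag_entry x 1 powr r * (weight_vec w 1)\<^sup>2) *
      ((weight_vec w 0)\<^sup>2 + (weight_vec w 1)\<^sup>2)) (at_right 0)"
    unfolding outer_real_diag_outer trace2_smult_outer .
  moreover have "(moment w x s powr ((a - 1) * b))\<^sup>2 = moment w x s powr (2 * (a - 1) * b)"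
    using m by (simp add: powr_powr mult_ac flip: powr_numeral)
  ultimately show ?thesis unfolding v2 by (simp add: moment_def diag_entry_def mult.commute)
qed

lemma SG_core_limit:
  assumes "0 < w" "w < 1" "0 < x" "0 < p" "0 < \<alpha>"
  shows "((\<lambda>e. trace2 (SG_core \<alpha> p (real_diag (diag_entry x)) (gram2 (weight_vec w) e))) \<longlongrightarrow> moment w x p powr (1 - \<alpha>)) (at_right 0)"
proof -
  have "moment w x p powr (2 * (1/2 - 1) * \<alpha>) * moment w x p = moment w x p powr (1 - \<alpha>)"
    using moment_pos[OF assms(1,2), of x p] by (simp add: powr_minus powr_diff field_simps)
  then show ?thesis
    using core_limit[OF assms(1-4), of "1/2" \<alpha> p] assms(5) by (simp add: SG_core_def Let_def)
qed

lemma SG_tilde_core_limit: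
  assumes "0 < w" "w < 1" "0 < x" "0 < q" "0 < \<alpha>"
  shows "((\<lambda>e. trace2 (SG_tilde_core \<alpha> q (real_diag (diag_entry x)) (gram2 (weight_vec w) e))) \<longlongrightarrow>
    moment w x q powr (\<alpha> - 1) * moment w x (2 * (1 - \<alpha>) * q)) (at_right 0)"
proof -
  have e: "2 * (\<alpha> - 1) * (1/2) = \<alpha> - 1" by simp
  show ?thesis
    unfolding SG_tilde_core_def Let_def by (rule core_limit[OF assms, of "1/2", unfolded e]) simp
qed

lemma pd_family:
  assumes "0 < w" "w < 1" "0 < x" "0 < e"
  shows "pd_mat 2 (real_diag (diag_entry x))" "pd_mat 2 (gram2 (weight_vec w) e)"
proof -
  show "pd_mat 2 (real_diag (diag_entry x))"
    using assms by (intro pd_of_psd_det real_diag_psd) (auto simp: real_diag_det diag_entry_def)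
  show "pd_mat 2 (gram2 (weight_vec w) e)"
    using assms by (intro pd_of_psd_det gram2_psd) (auto simp: gram2_det weight_vec_def)
qed

text \<open>The factor 1/2 is the price for traces in \<open>log_maj_eigval\<close>; positivity of
  the limits makes \<open>powr\<close> continuous there.\<close>

lemma powr_half_le_limit:
  fixes f g :: "real \<Rightarrow> real"
  assumes f: "(f \<longlongrightarrow> a) (at_right 0)" and g: "(g \<longlongrightarrow> b) (at_right 0)" and ab: "0 < a" "0 < b"
    and le: "\<And>e. 0 < e \<Longrightarrow> (f e / 2) powr r \<le> g e powr s"
  shows "(a / 2) powr r \<le> b powr s"
proof (rule tendsto_le[of "at_right 0"])
  show "((\<lambda>e. (f e / 2) powr r) \<longlongrightarrow> (a / 2) powr r) (at_right 0)"
    using ab by (intro tendsto_powr tendsto_divide f tendsto_const) auto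
  show "((\<lambda>e. g e powr s) \<longlongrightarrow> b powr s) (at_right 0)"
    using ab by (intro tendsto_powr g tendsto_const) auto
  show "\<forall>\<^sub>F e in at_right 0. (f e / 2) powr r \<le> g e powr s"
    using eventually_at_right_less[of 0] by (rule eventually_mono) (use le in auto)
qed simp

lemma moment_ineq_SG_SG_tilde:
  assumes par: "0 < \<alpha>" "0 < p" "0 < q" and w: "0 < w" "w < 1" and x: "0 < x"
    and maj: "\<And>A B. pd_mat 2 A \<Longrightarrow> pd_mat 2 B \<Longrightarrow> log_maj 2 (SG \<alpha> p A B) (SG_tilde \<alpha> q A B)"
  shows "(moment w x p powr (1 - \<alpha>) / 2) powr (1/p) \<le>
    (moment w x q powr (\<alpha> - 1) * moment w x (2 * (1 - \<alpha>) * q)) powr (1/q)"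
proof (rule powr_half_le_limit[OF SG_core_limit[OF w x par(2,1)] SG_tilde_core_limit[OF w x par(3,1)]])
  have pos: "0 < moment w x s" for s using moment_pos w by blast
  then show "0 < moment w x p powr (1 - \<alpha>)" "0 < moment w x q powr (\<alpha> - 1) * moment w x (2 * (1 - \<alpha>) * q)"
    by (simp_all add: less_imp_neq[THEN not_sym])
  fix e :: real assume e: "0 < e"
  note pd = pd_family[OF w x e]
  note psd = pd_imp_psd[OF pd(1)] pd_imp_psd[OF pd(2)]
  show "(trace2 (SG_core \<alpha> p (real_diag (diag_entry x)) (gram2 (weight_vec w) e)) / 2) powr (1/p) \<le>
      trace2 (SG_tilde_core \<alpha> q (real_diag (diag_entry x)) (gram2 (weight_vec w) e)) powr (1/q)"
    using log_maj_eigval(2)[OF SG_core_psd[OF psd] SG_tilde_core_psd[OF psd] par(2,3)] maj[OF pd]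
    unfolding SG_eq[OF psd(1)] SG_tilde_eq[OF psd(1)] by blast
qed

lemma moment_ineq_SG_tilde_SG:
  assumes par: "0 < \<alpha>" "0 < p" "0 < q" and w: "0 < w" "w < 1" and x: "0 < x"
    and maj: "\<And>A B. pd_mat 2 A \<Longrightarrow> pd_mat 2 B \<Longrightarrow> log_maj 2 (SG_tilde \<alpha> q A B) (SG \<alpha> p A B)"
  shows "(moment w x q powr (\<alpha> - 1) * moment w x (2 * (1 - \<alpha>) * q) / 2) powr (1/q) \<le>
    (moment w x p powr (1 - \<alpha>)) powr (1/p)"
proof (rule powr_half_le_limit[OF SG_tilde_core_limit[OF w x par(3,1)] SG_core_limit[OF w x par(2,1)]])
  have pos: "0 < moment w x s" for s using moment_pos w by blast
  then show "0 < moment w x p powr (1 - \<alpha>)" "0 < moment w x q powr (\<alpha> - 1) * moment w x (2 * (1 - \<alpha>) * q)"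
    by (simp_all add: less_imp_neq[THEN not_sym])
  fix e :: real assume e: "0 < e"
  note pd = pd_family[OF w x e]
  note psd = pd_imp_psd[OF pd(1)] pd_imp_psd[OF pd(2)]
  show "(trace2 (SG_tilde_core \<alpha> q (real_diag (diag_entry x)) (gram2 (weight_vec w) e)) / 2) powr (1/q) \<le>
      trace2 (SG_core \<alpha> p (real_diag (diag_entry x)) (gram2 (weight_vec w) e)) powr (1/p)"
    using log_maj_eigval(2)[OF SG_tilde_core_psd[OF psd] SG_core_psd[OF psd] par(3,2)] maj[OF pd]
    unfolding SG_eq[OF psd(1)] SG_tilde_eq[OF psd(1)] by blast
qed

lemma exists_large_powr:
  fixes k :: real
  assumes "0 < k"
  obtains x where "1 < x" "D \<le> x" "C < x powr k"
proof
  define x where "x = max (max 2 D) ((\<bar>C\<bar> + 1) powr (1 / k))"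
  show "1 < x" "D \<le> x" by (auto simp: x_def)
  have "C < ((\<bar>C\<bar> + 1) powr (1 / k)) powr k" using assms by (simp add: powr_powr)
  also have "\<dots> \<le> x powr k" using assms by (intro powr_mono2) (auto simp: x_def)
  finally show "C < x powr k" .
qed

lemma moment_ge:
  assumes "0 < w" "w \<le> 1/2"
  shows "1/2 \<le> moment w x s" "w * x powr s \<le> moment w x s"
proof -
  have "0 \<le> w * x powr s" using assms by simp
  then show "1/2 \<le> moment w x s" "w * x powr s \<le> moment w x s" unfolding moment_def using assms by linarith+
qed

lemma small_weight:
  fixes \<sigma> :: real
  assumes "0 < \<sigma>" "1 < x" "2 powr (1 / \<sigma>) \<le> x"
  shows "0 < x powr - \<sigma>" "x powr - \<sigma> \<le> 1/2"
proof -
  have "2 = (2 powr (1 / \<sigma>)) powr \<sigma>" using assms by (simp add: powr_powr)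
  also have "\<dots> \<le> x powr \<sigma>" using assms by (intro powr_mono2) auto
  finally show "x powr - \<sigma> \<le> 1/2" using assms by (simp add: powr_minus field_simps)
qed (use assms in simp)

text \<open>With weight \<open>w = x\<^sup>-\<^sup>\<sigma>\<close> the moment of order \<open>s\<close> stays bounded for \<open>s \<le> \<sigma>\<close> and tends to infinity
  with \<open>x\<close> for \<open>s > \<sigma>\<close>.\<close>

lemma moment_weight_le:
  assumes "1 < x" "s \<le> \<sigma>"
  shows "moment (x powr - \<sigma>) x s \<le> 2"
proof -
  have "x powr - \<sigma> * x powr s = x powr (s - \<sigma>)" by (simp add: powr_add[symmetric])
  also have "\<dots> \<le> x powr 0" using assms by (intro powr_mono) auto
  finally have "x powr - \<sigma> * x powr s \<le> 1" using assms by simp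
  moreover have "0 \<le> x powr - \<sigma>" by simp
  ultimately show ?thesis unfolding moment_def by linarith
qed

lemma moment_weight_ge:
  assumes "0 < x powr - \<sigma>" "x powr - \<sigma> \<le> 1/2"
  shows "x powr (s - \<sigma>) \<le> moment (x powr - \<sigma>) x s"
  using moment_ge(2)[OF assms, of x s] by (simp add: powr_add[symmetric])

text \<open>Up to constants the limit inequality reads
  \<open>m p powr h p * m q powr h q \<le> m t powr (1/q)\<close>. The weight
  \<open>x powr - t\<close> bounds the right side. A violated condition makes p or q larger than t
  (\<open>1/2 < \<alpha>\<close> amounts to \<open>t < q\<close>), so one factor on the left is
  unbounded while the other stays away from 0.\<close>

lemma not_log_maj_SG_SG_tilde:
  assumes par: "0 < \<alpha>" "\<alpha> < 1" "0 < p" "0 < q" and viol: "1/2 < \<alpha> \<or> 2 * (1 - \<alpha>) * q < p"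
    and maj: "\<And>A B. pd_mat 2 A \<Longrightarrow> pd_mat 2 B \<Longrightarrow> log_maj 2 (SG \<alpha> p A B) (SG_tilde \<alpha> q A B)"
  shows False
proof -
  define t where "t = 2 * (1 - \<alpha>) * q"
  have t: "0 < t" using par by (simp add: t_def)
  define r where "r = (if 2 * (1 - \<alpha>) * q < p then p else q)"
  have "2 * (1 - \<alpha>) * q < 1 * q" if "1/2 < \<alpha>" using that par by (intro mult_strict_right_mono) auto
  then have r: "t < r" "0 < r" "r = p \<or> r = q" using viol par by (auto simp: r_def t_def)
  define h where "h s = (1 - \<alpha>) / s" for s :: real
  have h: "0 < h p" "0 < h q" "0 < h r" using par r by (auto simp: h_def)
  define k where "k = (r - t) * h r"
  have k: "0 < k" using r h by (simp add: k_def)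
  \<comment> \<open>The factors account for the halved trace, for \<open>m t \<le> 2\<close>, and
    for the lower bound 1/2 on the moment that need not grow; the last one is enlarged to serve both
    values of \<open>r\<close>.\<close>
  define C where "C = 2 powr (1/p) * 2 powr (1/q) * 2 powr (h p + h q)"
  obtain x where x: "1 < x" "2 powr (1 / t) \<le> x" "C < x powr k"
    using exists_large_powr[OF k] by blast
  define w where "w = x powr - t"
  note w = small_weight[OF t x(1,2), folded w_def]
  define m where "m s = moment w x s" for s
  have mpos: "1/2 \<le> m s" for s using moment_ge(1)[OF w] by (simp add: m_def)
  then have mpos': "0 < m s" for s by (rule less_le_trans[rotated]) simp
  have mt: "m t \<le> 2" using moment_weight_le[OF x(1), of t t] by (simp add: m_def w_def)
  have mr: "x powr (r - t) \<le> m r" using moment_weight_ge[of x t r] w by (simp add: m_def w_def)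
  have "(m p powr (1 - \<alpha>) / 2) powr (1/p) \<le> (m q powr (\<alpha> - 1) * m t) powr (1/q)"
    using moment_ineq_SG_SG_tilde[OF par(1,3,4) _ _ _ maj, of w x] w x by (simp add: m_def t_def)
  also have "(m p powr (1 - \<alpha>) / 2) powr (1/p) = m p powr h p / 2 powr (1/p)"
    using mpos' by (simp add: powr_divide powr_powr h_def)
  also have "(m q powr (\<alpha> - 1) * m t) powr (1/q) = m t powr (1/q) / m q powr h q"
  proof -
    have "(\<alpha> - 1) * (1/q) = - h q" by (simp add: h_def field_simps minus_divide_left[symmetric] diff_divide_distrib)
    then show ?thesis by (simp only: powr_mult powr_powr powr_minus) (simp add: field_simps)
  qed
  finally have "m p powr h p * m q powr h q \<le> 2 powr (1/p) * m t powr (1/q)"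
    using mpos'[of q] by (simp add: field_simps)
  also have "\<dots> \<le> 2 powr (1/p) * 2 powr (1/q)"
    using mt mpos'[of t] par by (intro mult_left_mono powr_mono2) auto
  finally have up: "m p powr h p * m q powr h q \<le> 2 powr (1/p) * 2 powr (1/q)" .
  have half: "(1/2) powr h s \<le> m s powr h s" if "0 < h s" for s
    using mpos that by (intro powr_mono2) auto
  have big: "x powr k \<le> m r powr h r"
  proof -
    have "x powr k = (x powr (r - t)) powr h r" by (simp add: powr_powr k_def)
    also have "\<dots> \<le> m r powr h r" using mr h by (intro powr_mono2) auto
    finally show ?thesis .
  qed
  have hp: "(1/2) powr (h p + h q) \<le> (1/2 :: real) powr h p" "(1/2) powr (h p + h q) \<le> (1/2 :: real) powr h q"
    using h by (auto intro!: powr_mono')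
  have "x powr k * (1/2) powr (h p + h q) \<le> m p powr h p * m q powr h q"
    using r(3)
  proof
    assume "r = p"
    then show ?thesis using big half[OF h(2)] hp(2) by (intro mult_mono) auto
  next
    assume "r = q"
    then have "x powr k * (1/2) powr (h p + h q) \<le> m q powr h q * m p powr h p"
      using big half[OF h(1)] hp(1) by (intro mult_mono) auto
    then show ?thesis by (simp add: mult.commute)
  qed
  with up have "x powr k * (1/2) powr (h p + h q) \<le> 2 powr (1/p) * 2 powr (1/q)" by simp
  then have "x powr k \<le> C" by (simp add: C_def powr_divide field_simps)
  with x show False by simp
qed

text \<open>As \<alpha> < 1/2, the order t = 2(1-\<alpha>)q exceeds q, and by \<open>viol\<close> it
  exceeds p. The weight with \<open>\<sigma> = max p q\<close> bounds the moments of orders p and q,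
  while that of order t, which the inequality bounds by them, grows with \<open>x\<close>.\<close>

lemma not_log_maj_SG_tilde_SG_small:
  assumes par: "0 < \<alpha>" "\<alpha> < 1/2" "0 < p" "0 < q" and viol: "p < 2 * (1 - \<alpha>) * q"
    and maj: "\<And>A B. pd_mat 2 A \<Longrightarrow> pd_mat 2 B \<Longrightarrow> log_maj 2 (SG_tilde \<alpha> q A B) (SG \<alpha> p A B)"
  shows False
proof -
  define t where "t = 2 * (1 - \<alpha>) * q"
  define \<sigma> where "\<sigma> = max p q"
  have "1 * q < 2 * (1 - \<alpha>) * q" using par by (intro mult_strict_right_mono) auto
  then have \<sigma>: "0 < \<sigma>" "\<sigma> < t" using par viol by (auto simp: \<sigma>_def t_def)
  define h where "h s = (1 - \<alpha>) / s" for s :: real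
  have h: "0 < h p" "0 < h q" using par by (auto simp: h_def)
  define k where "k = (t - \<sigma>) * (1/q)"
  have k: "0 < k" using \<sigma> par by (simp add: k_def)
  define C where "C = 2 powr (1/q) * 2 powr h p * 2 powr h q"
  obtain x where x: "1 < x" "2 powr (1 / \<sigma>) \<le> x" "C < x powr k"
    using exists_large_powr[OF k] by blast
  define w where "w = x powr - \<sigma>"
  note w = small_weight[OF \<sigma>(1) x(1,2), folded w_def]
  define m where "m s = moment w x s" for s
  have mpos: "1/2 \<le> m s" for s using moment_ge(1)[OF w] by (simp add: m_def)
  then have mpos': "0 < m s" for s by (rule less_le_trans[rotated]) simp
  have mp: "m p \<le> 2" and mq: "m q \<le> 2"
    using moment_weight_le[OF x(1), of p \<sigma>] moment_weight_le[OF x(1), of q \<sigma>] by (simp_all add: m_def w_def \<sigma>_def)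
  have mt: "x powr (t - \<sigma>) \<le> m t" using moment_weight_ge[of x \<sigma> t] w by (simp add: m_def w_def)
  have "(m q powr (\<alpha> - 1) * m t / 2) powr (1/q) \<le> (m p powr (1 - \<alpha>)) powr (1/p)"
    using moment_ineq_SG_tilde_SG[OF par(1,3,4) _ _ _ maj, of w x] w x by (simp add: m_def t_def)
  also have "(m p powr (1 - \<alpha>)) powr (1/p) = m p powr h p" by (simp add: powr_powr h_def)
  also have "(m q powr (\<alpha> - 1) * m t / 2) powr (1/q) = m t powr (1/q) / (2 powr (1/q) * m q powr h q)"
  proof -
    have "(\<alpha> - 1) * (1/q) = - h q" by (simp add: h_def field_simps minus_divide_left[symmetric] diff_divide_distrib)
    then show ?thesis by (simp only: powr_mult powr_divide powr_powr powr_minus) (simp add: field_simps)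
  qed
  finally have "m t powr (1/q) \<le> 2 powr (1/q) * m p powr h p * m q powr h q"
    using mpos'[of q] by (simp add: field_simps)
  also have "\<dots> \<le> C"
    unfolding C_def using mp mq mpos' h par by (intro mult_mono powr_mono2) (auto intro: less_imp_le)
  also have "C < x powr k" by (rule x)
  also have "x powr k = (x powr (t - \<sigma>)) powr (1/q)" by (simp add: powr_powr k_def)
  also have "\<dots> \<le> m t powr (1/q)" using mt par by (intro powr_mono2) auto
  finally show False by simp
qed

text \<open>The constant weight 1/2 suffices: all moments stay above 1/2, even that of the negative
  order t. Hence \<open>m p powr (1 - \<alpha>)\<close> on the \<open>SG\<close> side is bounded,
  whereas \<open>m q powr (\<alpha> - 1)\<close> on the other side grows with
  \<open>x\<close>.\<close>

lemma not_log_maj_SG_tilde_SG_gt_1: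
  assumes par: "1 < \<alpha>" "0 < p" "0 < q"
    and maj: "\<And>A B. pd_mat 2 A \<Longrightarrow> pd_mat 2 B \<Longrightarrow> log_maj 2 (SG_tilde \<alpha> q A B) (SG \<alpha> p A B)"
  shows False
proof -
  define t where "t = 2 * (1 - \<alpha>) * q"
  define h where "h s = (\<alpha> - 1) / s" for s :: real
  have h: "0 < h p" "0 < h q" using par by (auto simp: h_def)
  define k where "k = q * h q"
  have k: "0 < k" using h par by (simp add: k_def)
  define C where "C = 2 powr h p * 4 powr (1/q) * 2 powr h q"
  obtain x where x: "1 < x" "2 \<le> x" "C < x powr k"
    using exists_large_powr[OF k] by blast
  define m where "m s = moment (1/2) x s" for s
  have mpos: "1/2 \<le> m s" for s using moment_ge(1)[of "1/2"] by (simp add: m_def)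
  then have mpos': "0 < m s" for s by (rule less_le_trans[rotated]) simp
  have mq: "x powr q / 2 \<le> m q" using moment_ge(2)[of "1/2" x q] by (simp add: m_def)
  have "(m q powr (\<alpha> - 1) * m t / 2) powr (1/q) \<le> (m p powr (1 - \<alpha>)) powr (1/p)"
    using moment_ineq_SG_tilde_SG[OF _ par(2,3) _ _ _ maj, of "1/2" x] par x by (simp add: m_def t_def)
  also have "(m p powr (1 - \<alpha>)) powr (1/p) = 1 / m p powr h p"
  proof -
    have "(1 - \<alpha>) * (1/p) = - h p" by (simp add: h_def diff_divide_distrib)
    then show ?thesis by (simp only: powr_powr powr_minus) (simp add: field_simps)
  qed
  also have "(m q powr (\<alpha> - 1) * m t / 2) powr (1/q) = m q powr h q * (m t / 2) powr (1/q)"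
    by (simp add: powr_mult powr_divide powr_powr h_def)
  finally have "m p powr h p * (m q powr h q * (m t / 2) powr (1/q)) \<le> 1"
    using mpos'[of p] by (simp add: field_simps)
  moreover have "(1/2) powr h p * ((x powr q / 2) powr h q * ((1/2) / 2) powr (1/q)) \<le>
      m p powr h p * (m q powr h q * (m t / 2) powr (1/q))"
    using mpos mpos' mq h par by (intro mult_mono powr_mono2) (auto intro: less_imp_le divide_right_mono)
  ultimately have "(1/2) powr h p * ((x powr q / 2) powr h q * ((1/2) / 2) powr (1/q)) \<le> 1"
    by linarith
  moreover have "(x powr q / 2) powr h q = x powr k / 2 powr h q"
    by (simp add: powr_divide powr_powr k_def)
  moreover have "((1/2) / 2) powr (1/q) = 1 / (4 :: real) powr (1/q)" "(1/2) powr h p = 1 / (2 :: real) powr h p"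
    by (simp_all add: powr_divide)
  ultimately have "1 / 2 powr h p * (x powr k / 2 powr h q * (1 / 4 powr (1/q))) \<le> 1" by (simp only:)
  then have "x powr k \<le> C" by (simp add: C_def field_simps)
  with x show False by simp
qed

section \<open>The family with fixed mean\<close>

lemma trace2_mono:
  assumes "loewner_le 2 X Y"
  shows "trace2 X \<le> trace2 Y"
proof -
  note XY = loewner_leD[OF assms]
  have psd: "psd_mat 2 (Y - X)" using assms by (simp add: loewner_le_def)
  have "0 \<le> trace2 (Y - X)"
    using eigval_trace2_bounds(1)[OF psd] eigvals_desc_nonneg[OF psd, of 0] by simp
  also have "trace2 (Y - X) = trace2 Y - trace2 X" using XY by (simp add: trace2_def)
  finally show ?thesis by simp
qed

lemma trace2_smult: "A \<in> carrier_mat 2 2 \<Longrightarrow> trace2 (c \<cdot>\<^sub>r A) = c * trace2 A"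
  by (simp add: trace2_def algebra_simps)

text \<open>\<open>SG_tilde_core\<close> is built with negative powers of \<open>A\<close>, which
  blow up when \<open>A\<close> degenerates. The form from \<open>SG_tilde_core_le_iff\<close>
  contains none for \<alpha> \<ge> 1/2, and taking traces in it preserves the inequality.\<close>

lemma SG_tilde_core_trace2_le:
  assumes A: "psd_mat 2 A" and B: "psd_mat 2 B" and pq: "0 < p" "0 < q"
    and maj: "log_maj 2 (SG_tilde \<alpha> q A B) (SG \<alpha> p A B)"
  shows "trace2 (psd_pow (sandwich q A B) \<alpha>) \<le>
    trace2 (SG_core \<alpha> p A B) powr (q / p) * trace2 (psd_pow A ((2 * \<alpha> - 1) * q))"
proof -
  note X = SG_core_psd[OF A B, of \<alpha> p] and Y = SG_tilde_core_psd[OF A B, of \<alpha> q]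
  define x where "x = eigvals_desc (SG_core \<alpha> p A B) ! 0"
  define y where "y = eigvals_desc (SG_tilde_core \<alpha> q A B) ! 0"
  define c where "c = trace2 (SG_core \<alpha> p A B) powr (q / p)"
  have xy: "0 \<le> x" "0 \<le> y" using eigvals_desc_nonneg[OF X] eigvals_desc_nonneg[OF Y] by (simp_all add: x_def y_def)
  have "y powr (1/q) \<le> x powr (1/p)"
    using log_maj_eigval(1)[OF Y X pq(2,1)] maj unfolding SG_eq[OF A] SG_tilde_eq[OF A] x_def y_def by blast
  then have "(y powr (1/q)) powr q \<le> (x powr (1/p)) powr q" using pq by (intro powr_mono2) auto
  then have "y \<le> x powr (q / p)" using pq xy by (simp add: powr_powr)
  also have "\<dots> \<le> c"
    unfolding c_def using xy pq eigval_trace2_bounds(1)[OF X] by (intro powr_mono2) (auto simp: x_def)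
  finally have "loewner_le 2 (SG_tilde_core \<alpha> q A B) (c \<cdot>\<^sub>r 1\<^sub>m 2)"
    unfolding eigval_trace2_bounds(3)[OF Y] y_def .
  then have "loewner_le 2 (psd_pow (sandwich q A B) \<alpha>) (c \<cdot>\<^sub>r psd_pow A ((2 * \<alpha> - 1) * q))"
    by (subst (asm) SG_tilde_core_le_iff[OF A B]) (simp_all add: c_def)
  from trace2_mono[OF this] show ?thesis using A by (simp add: trace2_smult c_def)
qed

text \<open>Prescribes the mean instead of \<open>B\<close>: with \<open>A^p = H\<close> and
  \<open>B^p = G H G\<close> the sandwich is the square of \<open>H^(1/2) G H^(1/2)\<close>, and
  stripping the outer factors from its root gives back \<open>G\<close>, because \<open>H\<close> is
  invertible.\<close>

lemma SG_core_of_mean: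
  assumes H: "psd_mat n H" "det H \<noteq> 0" and G: "psd_mat n G" and p: "0 < p"
  shows "SG_core \<alpha> p (psd_pow H (1/p)) (psd_pow (G * H * G) (1/p)) = psd_pow G \<alpha> * H * psd_pow G \<alpha>"
proof -
  note [simp] = psd_matD(2)[OF H(1)] psd_matD(2)[OF G]
  note assoc = assoc_mult_mat[of _ n n _ n _ n]
  have GHG: "psd_mat n (G * H * G)" using psd_conj[OF H(1), of G] psd_matD(3)[OF G] by simp
  have e: "1 / p * p = 1" "1 / p * (p / 2) = 1 / 2" "1 / p * (- p / 2) = - 1 / 2" using p by simp_all
  define K where "K = psd_pow H (1/2) * G * psd_pow H (1/2)"
  have K: "psd_mat n K" using H G by (simp add: K_def)
  have HH: "psd_pow H (1/2) * (psd_pow H (1/2) * X) = H * X" if "X \<in> carrier_mat n n" for X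
    using psd_pow_mult_left[OF H(1) that, of "1/2" "1/2"] by (simp add: psd_pow_1[OF H(1)])
  have "sandwich p (psd_pow H (1/p)) (psd_pow (G * H * G) (1/p)) = psd_pow H (1/2) * (G * H * G) * psd_pow H (1/2)"
    unfolding sandwich_def psd_pow_pow[OF H(1)] psd_pow_pow[OF GHG] e psd_pow_1[OF GHG] ..
  also have "\<dots> = K * K" using H(1) by (simp add: K_def assoc HH)
  also have "\<dots> = psd_pow K 2" using psd_pow_mult[OF K, of 1 1] by (simp add: psd_pow_1[OF K])
  finally have S: "psd_pow (sandwich p (psd_pow H (1/p)) (psd_pow (G * H * G) (1/p))) (1/2) = K"
    by (simp add: psd_pow_pow[OF K] psd_pow_1[OF K])
  have "psd_pow H (-1/2) * K * psd_pow H (-1/2) = psd_pow H 0 * G * psd_pow H 0"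
    using H(1) by (simp add: K_def assoc psd_pow_mult[OF H(1)] psd_pow_mult_left[OF H(1)])
  also have "\<dots> = G" unfolding pd_of_psd_det(2)[OF H]
    by (simp add: left_mult_one_mat[of _ n n] right_mult_one_mat[of _ n n])
  finally have "psd_pow H (-1/2) * K * psd_pow H (-1/2) = G" .
  then show ?thesis
    unfolding SG_core_def Let_def S psd_pow_pow[OF H(1)] e psd_pow_1[OF H(1)] by simp
qed

text \<open>Here the mean \<open>G = diag(x, 1)\<close> is kept fixed, \<open>A\<^sup>p\<close> degenerates to the rank one projection onto \<open>v\<close>
  and \<open>B\<^sup>p = G A\<^sup>p G\<close>.\<close>

lemma moment_ineq_fixed_mean:
  assumes \<alpha>: "1/2 \<le> \<alpha>" and pq: "0 < p" "0 < q" and w: "0 < w" "w < 1" and x: "0 < x"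
    and maj: "\<And>A B. pd_mat 2 A \<Longrightarrow> pd_mat 2 B \<Longrightarrow> log_maj 2 (SG_tilde \<alpha> q A B) (SG \<alpha> p A B)"
  shows "(moment w x 2 powr (q/p - 1) * (moment w x 1)\<^sup>2) powr \<alpha> \<le> 2 * moment w x (2 * \<alpha>) powr (q/p)"
proof -
  define v where "v = weight_vec w"
  define G where "G = real_diag (diag_entry x)"
  define H where "H = gram2 v"
  define A where "A e = psd_pow (H e) (1/p)" for e
  define B where "B e = psd_pow (G * H e * G) (1/p)" for e
  define r where "r = q / p"
  have r: "0 < r" using pq by (simp add: r_def)
  have v2: "(v 0)\<^sup>2 = w" "(v 1)\<^sup>2 = 1 - w" using w by (simp_all add: v_def weight_vec_def)
  have G: "psd_mat 2 G" unfolding G_def using x by (intro real_diag_psd) (auto simp: diag_entry_def)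
  note [simp] = psd_matD(2)[OF G]
  have Gp: "psd_pow G t = real_diag (\<lambda>i. diag_entry x i powr t)" for t
    unfolding G_def using x by (intro real_diag_pow) (auto simp: diag_entry_def)
  have H: "psd_mat 2 (H e)" for e by (simp add: H_def gram2_psd)
  note [simp] = psd_matD(2)[OF H]
  have dH: "det (H e) \<noteq> 0" if "0 < e" for e
    unfolding H_def gram2_det v2 using that by simp
  have GHG: "psd_mat 2 (G * H e * G)" for e using psd_conj[OF H, of G] psd_matD(3)[OF G] by simp
  have "det G \<noteq> 0" unfolding G_def real_diag_det using x by (simp add: diag_entry_def)
  then have dGHG: "det (G * H e * G) \<noteq> 0" if "0 < e" for e
    using dH[OF that] by (simp add: det_mult[of _ 2])
  have Apsd: "psd_mat 2 (A e)" and Bpsd: "psd_mat 2 (B e)" for e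
    using H GHG by (simp_all add: A_def B_def)
  have pd: "pd_mat 2 (A e)" "pd_mat 2 (B e)" if "0 < e" for e
    using pd_of_psd_det(1)[OF Apsd] pd_of_psd_det(1)[OF Bpsd] psd_pow_det_nonzero[OF H dH[OF that]]
      psd_pow_det_nonzero[OF GHG dGHG[OF that]] by (simp_all add: A_def B_def)
  \<comment> \<open>The exponent with \<open>A^((2\<alpha>-1)q) = H^s\<close>. It is nonnegative by
    \<alpha> \<ge> 1/2, so the trace of \<open>H^s\<close> stays bounded as \<open>H\<close>
    degenerates.\<close>
  define s where "s = (2 * \<alpha> - 1) * r"
  have s: "0 \<le> s" using \<alpha> r by (simp add: s_def)
  define f where "f e = trace2 (psd_pow (sandwich q (A e) (B e)) \<alpha>)" for e
  define c where "c e = trace2 (psd_pow G \<alpha> * H e * psd_pow G \<alpha>)" for e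
  have ineq: "f e \<le> c e powr r * (2 * trace2 (H e) powr s)" if "0 < e" for e
  proof -
    have "f e \<le> trace2 (SG_core \<alpha> p (A e) (B e)) powr (q / p) * trace2 (psd_pow (A e) ((2 * \<alpha> - 1) * q))"
      unfolding f_def by (rule SG_tilde_core_trace2_le[OF Apsd Bpsd pq maj[OF pd[OF that]]])
    also have "SG_core \<alpha> p (A e) (B e) = psd_pow G \<alpha> * H e * psd_pow G \<alpha>"
      unfolding A_def B_def by (rule SG_core_of_mean[OF H dH[OF that] G pq(1)])
    also have "psd_pow (A e) ((2 * \<alpha> - 1) * q) = psd_pow (H e) s"
      by (simp add: A_def psd_pow_pow[OF H] s_def r_def)
    also have "trace2 (psd_pow G \<alpha> * H e * psd_pow G \<alpha>) powr (q / p) * trace2 (psd_pow (H e) s) \<le>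
        c e powr r * (2 * trace2 (H e) powr s)"
      unfolding c_def r_def using eigval_trace2_bounds(4)[OF H, of e s] s by (intro mult_left_mono) auto
    finally show ?thesis .
  qed
  have Hl: "mtends H (1 \<cdot>\<^sub>r outer v)" unfolding H_def by (rule gram2_mtends)
  have m: "0 < moment w x t" for t using moment_pos w by blast
  have tr1: "1 * ((v 0)\<^sup>2 + (v 1)\<^sup>2) = 1" unfolding v2 by simp
  have trH: "((\<lambda>e. trace2 (H e)) \<longlongrightarrow> 1) (at_right 0)"
    using mtends_trace2[OF Hl] unfolding trace2_smult_outer tr1 .
  have Hpow: "mtends (\<lambda>e. psd_pow (H e) t) (outer v)" if "0 < t" for t
    using mtends_psd_pow[OF H Hl tr1[symmetric] _ that] by simp
  have sq: "(diag_entry x i powr t * v i)\<^sup>2 = diag_entry x i powr (2 * t) * (v i)\<^sup>2" for i t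
    using x by (simp add: diag_entry_def power_mult_distrib powr_powr mult.commute flip: powr_numeral)
  have mom: "(diag_entry x 0 powr t * v 0)\<^sup>2 + (diag_entry x 1 powr t * v 1)\<^sup>2 = moment w x (2 * t)" for t
    unfolding sq v2 by (simp add: moment_def diag_entry_def mult.commute)
  have cl: "(c \<longlongrightarrow> moment w x (2 * \<alpha>)) (at_right 0)"
  proof -
    have "mtends (\<lambda>e. psd_pow G \<alpha> * H e * psd_pow G \<alpha>) (psd_pow G \<alpha> * (1 \<cdot>\<^sub>r outer v) * psd_pow G \<alpha>)"
      using G by (intro mtends_mult mtends_const Hl) simp_all
    from mtends_trace2[OF this] show ?thesis
      unfolding c_def Gp real_diag_outer_real_diag trace2_smult_outer mom by simp
  qed
  have fl: "(f \<longlongrightarrow> (moment w x 2 powr (r - 1) * (moment w x 1)\<^sup>2) powr \<alpha>) (at_right 0)"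
  proof -
    let ?u = "\<lambda>i. diag_entry x i * v i"
    have G1: "G * (1 \<cdot>\<^sub>r outer v) * G = 1 \<cdot>\<^sub>r outer ?u"
      unfolding G_def by (rule real_diag_outer_real_diag)
    have "mtends (\<lambda>e. G * H e * G) (G * (1 \<cdot>\<^sub>r outer v) * G)"
      by (intro mtends_mult mtends_const Hl) simp_all
    then have GHGl: "mtends (\<lambda>e. G * H e * G) (1 \<cdot>\<^sub>r outer ?u)" unfolding G1 .
    have u2: "moment w x 2 = 1 * ((?u 0)\<^sup>2 + (?u 1)\<^sup>2)"
      using mom[of 1] x by (simp add: diag_entry_def)
    define k where "k = moment w x 2 powr (r - 1)"
    have k: "0 < k" using m[of 2] by (simp add: k_def)
    have "mtends (\<lambda>e. psd_pow (G * H e * G) r) (k \<cdot>\<^sub>r outer ?u)"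
      using mtends_psd_pow[OF GHG GHGl u2 m r] by (simp add: k_def)
    \<comment> \<open>In the limit \<open>A^(q/2)\<close> is the projection \<open>outer v\<close>.
      Compressing \<open>outer u\<close>, where \<open>u = G v\<close>, to \<open>v\<close> leaves
      the squared inner product of \<open>u\<close> and \<open>v\<close>, which is
      \<open>(moment w x 1)^2\<close>.\<close>
    then have "mtends (\<lambda>e. psd_pow (H e) (r / 2) * psd_pow (G * H e * G) r * psd_pow (H e) (r / 2))
        (outer v * (k \<cdot>\<^sub>r outer ?u) * outer v)"
      using r by (intro mtends_mult Hpow) simp_all
    moreover have "sandwich q (A e) (B e) = psd_pow (H e) (r / 2) * psd_pow (G * H e * G) r * psd_pow (H e) (r / 2)" for e
      unfolding sandwich_def A_def B_def psd_pow_pow[OF H] psd_pow_pow[OF GHG] by (simp add: r_def)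
    moreover have "diag_entry x 0 * v 0 * v 0 + diag_entry x 1 * v 1 * v 1 = moment w x 1"
      using v2 x by (simp add: moment_def diag_entry_def power2_eq_square mult.assoc)
    ultimately have Sl: "mtends (\<lambda>e. sandwich q (A e) (B e)) ((k * (moment w x 1)\<^sup>2) \<cdot>\<^sub>r outer v)"
      unfolding outer_outer_outer by (simp only:)
    define t where "t = k * (moment w x 1)\<^sup>2"
    have t: "t = k * (moment w x 1)\<^sup>2 * ((v 0)\<^sup>2 + (v 1)\<^sup>2)" "0 < t"
      using k m[of 1] unfolding v2 by (simp_all add: t_def)
    have a: "0 < \<alpha>" using \<alpha> by simp
    from mtends_trace2[OF mtends_psd_pow[OF sandwich_psd[OF Apsd Bpsd] Sl t a]]
    have "(f \<longlongrightarrow> t powr (\<alpha> - 1) * (k * (moment w x 1)\<^sup>2) * ((v 0)\<^sup>2 + (v 1)\<^sup>2)) (at_right 0)"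
      unfolding trace2_smult_outer f_def .
    moreover have "t powr (\<alpha> - 1) * (k * (moment w x 1)\<^sup>2) * ((v 0)\<^sup>2 + (v 1)\<^sup>2) = t powr \<alpha>"
      unfolding v2 t_def[symmetric] using t(2) by (simp add: powr_diff)
    ultimately show ?thesis by (simp add: t_def k_def)
  qed
  have "(moment w x 2 powr (r - 1) * (moment w x 1)\<^sup>2) powr \<alpha> \<le> moment w x (2 * \<alpha>) powr r * (2 * 1 powr s)"
  proof (rule tendsto_le[OF _ _ fl])
    show "((\<lambda>e. c e powr r * (2 * trace2 (H e) powr s)) \<longlongrightarrow> moment w x (2 * \<alpha>) powr r * (2 * 1 powr s)) (at_right 0)"
      using m[of "2 * \<alpha>"] by (intro tendsto_mult tendsto_powr cl trH tendsto_const) auto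
    show "\<forall>\<^sub>F e in at_right 0. f e \<le> c e powr r * (2 * trace2 (H e) powr s)"
      using eventually_at_right_less[of 0] by (rule eventually_mono) (use ineq in auto)
  qed simp
  then show ?thesis by (simp add: r_def mult.commute)
qed

text \<open>The weight \<open>x powr - (2 * \<alpha>)\<close> bounds the moment of order 2\<alpha>
  on the right. The order 2 exceeds 2\<alpha>, so its moment is unbounded, and p < q gives it the
  positive exponent q/p - 1. For \<alpha> \<ge> 1/2 this shows that p \<ge> q is necessary, which
  implies p/q \<ge> 2(1-\<alpha>) and matches the sufficient condition.\<close>

lemma not_log_maj_SG_tilde_SG_large:
  assumes \<alpha>: "1/2 \<le> \<alpha>" "\<alpha> < 1" and pq: "0 < p" "p < q"
    and maj: "\<And>A B. pd_mat 2 A \<Longrightarrow> pd_mat 2 B \<Longrightarrow> log_maj 2 (SG_tilde \<alpha> q A B) (SG \<alpha> p A B)"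
  shows False
proof -
  define r where "r = q / p"
  have r: "1 < r" using pq by (simp add: r_def)
  define k where "k = (2 - 2 * \<alpha>) * (r - 1) * \<alpha>"
  have k: "0 < k" using \<alpha> r by (simp add: k_def)
  define C where "C = 2 * 2 powr r * 4 powr \<alpha>"
  obtain x where x: "1 < x" "2 powr (1 / (2 * \<alpha>)) \<le> x" "C < x powr k"
    using exists_large_powr[OF k] by blast
  define w where "w = x powr - (2 * \<alpha>)"
  have "0 < 2 * \<alpha>" using \<alpha> by simp
  note w = small_weight[OF this x(1,2), folded w_def]
  have m2: "x powr (2 - 2 * \<alpha>) \<le> moment w x 2" using moment_weight_ge[of x "2 * \<alpha>" 2] w by (simp add: w_def)
  have m1: "1/2 \<le> moment w x 1" by (rule moment_ge(1)[OF w])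
  have m\<alpha>: "0 \<le> moment w x (2 * \<alpha>)" "moment w x (2 * \<alpha>) \<le> 2"
    using moment_ge(1)[OF w, of x "2 * \<alpha>"] moment_weight_le[OF x(1), of "2 * \<alpha>" "2 * \<alpha>"] by (simp_all add: w_def)
  have "((x powr (2 - 2 * \<alpha>)) powr (r - 1) * (1/2)\<^sup>2) powr \<alpha> \<le> (moment w x 2 powr (r - 1) * (moment w x 1)\<^sup>2) powr \<alpha>"
    using m1 m2 r \<alpha> by (intro powr_mono2 mult_mono power_mono) auto
  also have "\<dots> \<le> 2 * moment w x (2 * \<alpha>) powr r"
    using moment_ineq_fixed_mean[OF \<alpha>(1) pq(1) _ _ _ _ maj, of w x] pq w x by (simp add: r_def)
  also have "\<dots> \<le> 2 * 2 powr r" using m\<alpha> r by (intro mult_left_mono powr_mono2) auto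
  also have "((x powr (2 - 2 * \<alpha>)) powr (r - 1) * (1/2)\<^sup>2) powr \<alpha> = x powr k / 4 powr \<alpha>"
    by (simp add: powr_mult powr_divide powr_powr k_def power2_eq_square)
  finally have "x powr k \<le> C" by (simp add: C_def field_simps)
  with x show False by simp
qed

theorem proposition3p15:
  shows
  "(\<forall>\<alpha> p q :: real. 0 < \<alpha> \<and> \<alpha> < 1 \<and> 0 < p \<and> 0 < q \<longrightarrow>
      (\<forall>A B. pd_mat 2 A \<and> pd_mat 2 B \<longrightarrow> log_maj 2 (SG \<alpha> p A B) (SG_tilde \<alpha> q A B)) \<longrightarrow>
      \<alpha> \<le> 1/2 \<and> p / q \<le> 2 * (1 - \<alpha>))
   \<and>
   (\<forall>\<alpha> p q :: real. 0 < \<alpha> \<and> \<alpha> < 1 \<and> 0 < p \<and> 0 < q \<longrightarrow>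
      (p / q \<ge> max 1 ((1 - \<alpha>) / \<alpha>) \<longrightarrow>
        (\<forall>n \<ge> 1. \<forall>A B. psd_mat n A \<and> psd_mat n B \<and> loewner_le n (supp_proj B) (supp_proj A) \<longrightarrow>
           log_maj n (SG_tilde \<alpha> q A B) (SG \<alpha> p A B))) \<and>
      ((\<forall>A B. pd_mat 2 A \<and> pd_mat 2 B \<longrightarrow> log_maj 2 (SG_tilde \<alpha> q A B) (SG \<alpha> p A B)) \<longrightarrow>
        p / q \<ge> 2 * (1 - \<alpha>)) \<and>
      2 * (1 - \<alpha>) \<le> max 1 ((1 - \<alpha>) / \<alpha>))
   \<and>
   (\<forall>\<alpha> p q :: real. 1 < \<alpha> \<and> 0 < p \<and> 0 < q \<longrightarrow> p \<le> q \<longrightarrow>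
      (\<forall>n \<ge> 1. \<forall>A B. psd_mat n A \<and> psd_mat n B \<and> loewner_le n (supp_proj B) (supp_proj A) \<longrightarrow>
         log_maj n (SG \<alpha> p A B) (SG_tilde \<alpha> q A B)))
   \<and>
   (\<forall>\<alpha> :: real. 1 < \<alpha> \<longrightarrow> (\<forall>p q :: real. 0 < p \<and> 0 < q \<longrightarrow>
      (\<exists>A B. pd_mat 2 A \<and> pd_mat 2 B \<and> \<not> log_maj 2 (SG_tilde \<alpha> q A B) (SG \<alpha> p A B))))"
proof (intro conjI allI impI)
  fix \<alpha> p q :: real
  assume par: "0 < \<alpha> \<and> \<alpha> < 1 \<and> 0 < p \<and> 0 < q"
    and maj: "\<forall>A B. pd_mat 2 A \<and> pd_mat 2 B \<longrightarrow> log_maj 2 (SG \<alpha> p A B) (SG_tilde \<alpha> q A B)"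
  then have "\<not> (1/2 < \<alpha> \<or> 2 * (1 - \<alpha>) * q < p)"
    using not_log_maj_SG_SG_tilde[of \<alpha> p q] by blast
  then show "\<alpha> \<le> 1/2" "p / q \<le> 2 * (1 - \<alpha>)" using par by (auto simp: field_simps)
next
  fix \<alpha> p q :: real and n :: nat and A B
  assume par: "0 < \<alpha> \<and> \<alpha> < 1 \<and> 0 < p \<and> 0 < q" and pq: "max 1 ((1 - \<alpha>) / \<alpha>) \<le> p / q"
    and AB: "psd_mat n A \<and> psd_mat n B \<and> loewner_le n (supp_proj B) (supp_proj A)"
  have "1 \<le> p / q" "(1 - \<alpha>) / \<alpha> \<le> p / q" using pq by auto
  then have "q \<le> p" "q * (1 - \<alpha>) \<le> p * \<alpha>" using par by (auto simp: field_simps)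
  then show "log_maj n (SG_tilde \<alpha> q A B) (SG \<alpha> p A B)"
    using par AB by (intro log_maj_SG_tilde_SG) auto
next
  fix \<alpha> p q :: real
  assume par: "0 < \<alpha> \<and> \<alpha> < 1 \<and> 0 < p \<and> 0 < q"
    and maj: "\<forall>A B. pd_mat 2 A \<and> pd_mat 2 B \<longrightarrow> log_maj 2 (SG_tilde \<alpha> q A B) (SG \<alpha> p A B)"
  show "2 * (1 - \<alpha>) \<le> p / q"
  proof (rule ccontr)
    assume "\<not> 2 * (1 - \<alpha>) \<le> p / q"
    then have viol: "p < 2 * (1 - \<alpha>) * q" using par by (simp add: field_simps)
    \<comment> \<open>Below 1/2 the family with degenerate \<open>B\<close> applies. From 1/2 on,
      2(1-\<alpha>) is at most 1, so \<open>viol\<close> implies p < q, which the family with fixed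
      mean refutes.\<close>
    show False
    proof (cases "\<alpha> < 1/2")
      case True
      then show False using not_log_maj_SG_tilde_SG_small[of \<alpha> p q] par viol maj by blast
    next
      case False
      then have "2 * (1 - \<alpha>) * q \<le> 1 * q" using par by (intro mult_right_mono) auto
      with viol have "p < q" by linarith
      then show False using not_log_maj_SG_tilde_SG_large[of \<alpha> p q] par maj False by force
    qed
  qed
next
  fix \<alpha> p q :: real
  assume par: "0 < \<alpha> \<and> \<alpha> < 1 \<and> 0 < p \<and> 0 < q"
  show "2 * (1 - \<alpha>) \<le> max 1 ((1 - \<alpha>) / \<alpha>)"
  proof (cases "\<alpha> < 1/2")
    case True
    then have "2 * \<alpha> * (1 - \<alpha>) \<le> 1 * (1 - \<alpha>)" using par by (intro mult_right_mono) auto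
    then have "2 * (1 - \<alpha>) \<le> (1 - \<alpha>) / \<alpha>" using par by (simp add: field_simps)
    then show ?thesis by simp
  qed simp
next
  fix \<alpha> p q :: real and n :: nat and A B
  assume "1 < \<alpha> \<and> 0 < p \<and> 0 < q" "p \<le> q"
    "psd_mat n A \<and> psd_mat n B \<and> loewner_le n (supp_proj B) (supp_proj A)"
  then show "log_maj n (SG \<alpha> p A B) (SG_tilde \<alpha> q A B)" by (intro log_maj_SG_SG_tilde) auto
next
  fix \<alpha> p q :: real
  assume "1 < \<alpha>" "0 < p \<and> 0 < q"
  then show "\<exists>A B. pd_mat 2 A \<and> pd_mat 2 B \<and> \<not> log_maj 2 (SG_tilde \<alpha> q A B) (SG \<alpha> p A B)"
    using not_log_maj_SG_tilde_SG_gt_1[of \<alpha> p q] by blast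
qed

end
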